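(* Let $\omega$ be a radial weight on the unit disk $\mathbb D$. The following statements are equivalent: (1) $P^+_\omega:L^1_\omega\to L^{1,\infty}_\omega$ is bounded; (2) $P^+_\omega:L^p_\omega\to L^p_\omega$ is bounded for every $1<p<\infty$; (3) $P^+_\omega:L^p_\omega\to L^p_\omega$ is bounded for some $p\in(1,\infty)\setminus\{2\}$; (4) $\omega\in\mathcal D$.
   Context: $\mathbb D=\{z\in\mathbb C:|z|<1\}$ and $dA(z)=dx\,dy/\pi$ is normalized area measure on $\mathbb D$. A radial weight is a nonnegative (measurable) integrable function $\omega$ on $[0,1)$, extended to $\mathbb D$ by $\omega(z)=\omega(|z|)$, and it is assumed throughout that $\widehat\omega(r)=\int_r^1\omega(s)\,ds>0$ for all $0\le r<1$. For $1\le p<\infty$, $L^p_\omega$ is the space of measurable $f$ on $\mathbb D$ with $\|f\|_{L^p_\omega}^p=\int_{\mathbb D}|f|^p\omega\,dA<\infty$. $L^{1,\infty}_\omega$ is the set of measurable $f$ on $\mathbb D$ with $\|f\|_{L^{1,\infty}_\omega}=\sup_{t>0}t\,\omega(\{z\in\mathbb D:|f(z)|>t\})<\infty$, where $\omega(E)=\int_E\omega\,dA$. Moments: $\omega_x=\int_0^1r^x\omega(r)\,dr$, $x\ge0$. The reproducing kernel of the weighted Bergman space $A^2_\omega$ (analytic functions in $L^2_\omega$) is $B_z^\omega(\zeta)=\sum_{n=0}^\infty\frac{(\overline z\zeta)^n}{2\omega_{2n+1}}$, $z,\zeta\in\mathbb D$, and the maximal weighted Bergman projection is $$P^+_\omega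 f(z)=\int_{\mathbb D}f(\zeta)\,|B_z^\omega(\zeta)|\,\omega(\zeta)\,dA(\zeta).$$ For each fixed $z\in\mathbb D$ the kernel $B^\omega_z$ is bounded on $\mathbb D$, so $P^+_\omega f(z)$ is defined for every $f\in L^1_\omega$. Boundedness of $P^+_\omega:X\to Y$ means there is a constant $C$ with $\|P^+_\omega f\|_Y\le C\|f\|_X$ for all $f\in X$. $\widehat{\mathcal D}$ is the class of radial weights $\omega$ for which there is a constant $C=C(\omega)\ge1$ with $\widehat\omega(r)\le C\,\widehat\omega\left(\frac{1+r}{2}\right)$ for all $0\le r<1$. $\mathcal D$ is the subclass of those $\omega\in\widehat{\mathcal D}$ for which there exist constants $C_1>1$ and $C_2>1$ such that $$\widehat\omega(r)\ge C_1\,\widehat\omega\left(1-\frac{1-r}{C_2}\right)\qquad\text{for all }0<r<1.$$ *)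

theory Defs
  imports "HOL-Analysis.Analysis"
begin

abbreviation disk :: "complex set" where
  "disk \<equiv> ball 0 1"

text \<open>
  A radial weight is a function \<open>\<omega> :: real \<Rightarrow> real\<close> of which only the values on \<open>[0,1)\<close>
  matter; its extension to the disk is \<open>\<lambda>z. \<omega> (norm z)\<close>.
  Measurability and integrability refer to Lebesgue (completed) measure.
\<close>

definition weight_tail :: "(real \<Rightarrow> real) \<Rightarrow> real \<Rightarrow> real" where
  "weight_tail \<omega> r = (LINT s:{r..<1}|lebesgue. \<omega> s)"

definition radial_weight :: "(real \<Rightarrow> real) \<Rightarrow> bool" where
  "radial_weight \<omega> \<longleftrightarrow>
     (\<forall>r\<in>{0..<1}. 0 \<le> \<omega> r) \<and>
     set_integrable lebesgue {0..<1} \<omega> \<and>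
     (\<forall>r\<in>{0..<1}. 0 < weight_tail \<omega> r)"

text \<open>
  The measure \<open>\<omega> dA\<close> on the disk, where \<open>dA = dx dy / pi\<close>. Its \<open>\<sigma>\<close>-algebra consists of the
  Lebesgue measurable subsets of the disk.
\<close>

definition weighted_area :: "(real \<Rightarrow> real) \<Rightarrow> complex measure" where
  "weighted_area \<omega> = density (lebesgue_on disk) (\<lambda>z. ennreal (\<omega> (norm z) / pi))"

definition Lp_space :: "(real \<Rightarrow> real) \<Rightarrow> real \<Rightarrow> (complex \<Rightarrow> complex) set" where
  "Lp_space \<omega> p =
     {f. f \<in> borel_measurable (weighted_area \<omega>) \<and>
         integrable (weighted_area \<omega>) (\<lambda>z. norm (f z) powr p)}"

definition Lp_norm :: "(real \<Rightarrow> real) \<Rightarrow> real \<Rightarrow> (complex \<Rightarrow> complex) \<Rightarrow> real" where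
  "Lp_norm \<omega> p f = (LINT z|weighted_area \<omega>. norm (f z) powr p) powr (1 / p)"

definition weak_L1_quasinorm :: "(real \<Rightarrow> real) \<Rightarrow> (complex \<Rightarrow> complex) \<Rightarrow> ennreal" where
  "weak_L1_quasinorm \<omega> f =
     (SUP t\<in>{0<..}. ennreal t * emeasure (weighted_area \<omega>) {z\<in>disk. norm (f z) > t})"

definition weak_L1_space :: "(real \<Rightarrow> real) \<Rightarrow> (complex \<Rightarrow> complex) set" where
  "weak_L1_space \<omega> =
     {f. f \<in> borel_measurable (weighted_area \<omega>) \<and> weak_L1_quasinorm \<omega> f < \<infinity>}"

definition weight_moment :: "(real \<Rightarrow> real) \<Rightarrow> real \<Rightarrow> real" where
  "weight_moment \<omega> x = (LINT r:{0..<1}|lebesgue. r powr x * \<omega> r)"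

definition bergman_kernel :: "(real \<Rightarrow> real) \<Rightarrow> complex \<Rightarrow> complex \<Rightarrow> complex" where
  "bergman_kernel \<omega> z \<zeta> =
     (\<Sum>n. (cnj z * \<zeta>) ^ n / of_real (2 * weight_moment \<omega> (2 * real n + 1)))"

definition max_bergman_projection ::
  "(real \<Rightarrow> real) \<Rightarrow> (complex \<Rightarrow> complex) \<Rightarrow> complex \<Rightarrow> complex" where
  "max_bergman_projection \<omega> f z =
     (LINT \<zeta>|weighted_area \<omega>. f \<zeta> * of_real (norm (bergman_kernel \<omega> z \<zeta>)))"

definition bounded_operator ::
  "'a set \<Rightarrow> ('a \<Rightarrow> real) \<Rightarrow> 'b set \<Rightarrow> ('b \<Rightarrow> real) \<Rightarrow> ('a \<Rightarrow> 'b) \<Rightarrow> bool" where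
  "bounded_operator X normX Y normY T \<longleftrightarrow>
     (\<exists>C. \<forall>f\<in>X. T f \<in> Y \<and> normY (T f) \<le> C * normX f)"

definition bounded_Lp_Lp :: "(real \<Rightarrow> real) \<Rightarrow> real \<Rightarrow> bool" where
  "bounded_Lp_Lp \<omega> p \<longleftrightarrow>
     bounded_operator (Lp_space \<omega> p) (Lp_norm \<omega> p) (Lp_space \<omega> p) (Lp_norm \<omega> p)
       (max_bergman_projection \<omega>)"

definition bounded_L1_weak_L1 :: "(real \<Rightarrow> real) \<Rightarrow> bool" where
  "bounded_L1_weak_L1 \<omega> \<longleftrightarrow>
     bounded_operator (Lp_space \<omega> 1) (Lp_norm \<omega> 1)
       (weak_L1_space \<omega>) (\<lambda>f. enn2real (weak_L1_quasinorm \<omega> f))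
       (max_bergman_projection \<omega>)"

definition class_D_hat :: "(real \<Rightarrow> real) set" where
  "class_D_hat = {\<omega>. radial_weight \<omega> \<and>
     (\<exists>C\<ge>1. \<forall>r. 0 \<le> r \<and> r < 1 \<longrightarrow> weight_tail \<omega> r \<le> C * weight_tail \<omega> ((1 + r) / 2))}"

definition class_D :: "(real \<Rightarrow> real) set" where
  "class_D = {\<omega>\<in>class_D_hat.
     \<exists>C1>1. \<exists>C2>1. \<forall>r. 0 < r \<and> r < 1 \<longrightarrow>
       weight_tail \<omega> r \<ge> C1 * weight_tail \<omega> (1 - (1 - r) / C2)}"

end

theory Submission
  imports Defs
begin

text \<open>
  Necessity: test the projection on the radial powers \<open>\<bar>\<zeta>\<bar> powr x\<close>. Pairing the modulus of the
  kernel with unimodular functions of the argument bounds the image from below by a single Fourier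
  coefficient, and pairing it with the bounded function \<open>Im (Ln (1 - \<rho> e\<^sup>i\<^sup>\<theta>))\<close> bounds it from below
  by a logarithmic sum of coefficients, as in Hardy's inequality. The former gives the doubling of the
  moments, for \<open>L\<^sup>p\<close> by convexity of the logarithm of the moments, where \<open>p \<noteq> 2\<close> is used; the latter
  then gives the reverse doubling.

  Sufficiency: repeated summation by parts shows that the kernel is at most of order
  \<open>M / \<omega>\<^bsub>2M+1\<^esub>\<close> at distance at least \<open>c / M\<close> from the singularity, so that it is dominated by
  a positive kernel over a tree of polar cells. This kernel satisfies the Schur test on every
  \<open>L\<^sup>p\<close>. For the weak type estimate, average the function over maximal cells of large mean and over the
  cells of the remaining points: away from the neighbours of the maximal cells this does not change
  the image, and the average is controlled in \<open>L\<^sup>2\<close>.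
\<close>

section \<open>Radial integration, tails and moments\<close>

text \<open>The exponent 2 is excluded because the test by a single coefficient is empty there: for
  \<open>q = 2\<close> the hypothesis of \<open>mom_doubling_from_convexity\<close> is midpoint
  convexity of the logarithm of the moments and holds for every weight, with constant 0. For
  \<open>q > 2\<close> it compares the slope near \<open>2 * n\<close> with slopes strictly further
  out, and this can be iterated to infinity. The weak estimate has no second exponent; there the
  free power \<open>x\<close> is chosen so that the moments depending on it cancel. Doubling still
  allows tails that hardly decrease, such as negative powers of a logarithm. For these the
  coefficients between \<open>N\<close> and \<open>k * N\<close> are almost constant, and their
  harmonic sum \<open>ln k\<close> contradicts boundedness as soon as \<open>k\<close> is large;
  with \<open>k\<close> fixed, the tail must drop by a fixed factor. In the converse direction
  doubling governs only the size of the kernel. Reverse doubling is what makes the sums over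
  generations geometric, in the Schur test as well as in the bound for the averages.\<close>

lemma distr_lborel_norm_complex:
  "distr lborel borel (norm :: complex \<Rightarrow> real) =
   density lborel (\<lambda>r. ennreal (2 * pi * r) * indicator {0..} r)"
proof (rule measure_eqI_generator_eq_countable[where E="range (\<lambda>a::real. {..a})" and A="(\<lambda>n. {..real n}) ` UNIV" and \<Omega>=UNIV])
  show "Int_stable (range (\<lambda>a::real. {..a}))"
    by (auto simp: Int_stable_def)
  show "sets (distr lborel borel (norm::complex\<Rightarrow>real)) = sigma_sets UNIV (range (\<lambda>a::real. {..a}))"
       "sets (density lborel (\<lambda>r. ennreal (2 * pi * r) * indicator {0..} r)) = sigma_sets UNIV (range (\<lambda>a::real. {..a}))"
    by (simp_all add: borel_eq_atMost)
  \<comment> \<open>Half-lines generate the Borel sets, and a half-line pulls back under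
    \<open>norm\<close> to a disc. Comparing areas of discs replaces a change to polar coordinates,
    since this formula is applied to radial functions only.\<close>
  have 1: "emeasure (distr lborel borel (norm::complex\<Rightarrow>real)) {..a} = ennreal (if a < 0 then 0 else pi * a\<^sup>2)" for a :: real
  proof -
    have "emeasure (distr lborel borel (norm::complex\<Rightarrow>real)) {..a} = emeasure lborel (cball (0::complex) a)"
      by (subst emeasure_distr) (auto simp: cball_def dist_norm vimage_def intro!: arg_cong2[where f=emeasure])
    also have "\<dots> = ennreal (if a < 0 then 0 else pi * a\<^sup>2)"
    proof (cases "a < 0")
      case False
      then show ?thesis
        by (subst emeasure_cball) (auto simp: unit_ball_vol_2)
    qed auto
    finally show ?thesis .
  qed
  have 2: "emeasure (density lborel (\<lambda>r. ennreal (2 * pi * r) * indicator {0..} r)) {..a}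
     = ennreal (if a < 0 then 0 else pi * a\<^sup>2)" for a :: real
  proof (cases "a < 0")
    case True
    then have "(\<lambda>x. ennreal (2 * pi * x) * indicator {0..} x * indicator {..a} x) = (\<lambda>x. 0)"
      by (auto simp: indicator_def fun_eq_iff)
    then show ?thesis using True by (subst emeasure_density) (auto)
  next
    case False
    have "emeasure (density lborel (\<lambda>r. ennreal (2 * pi * r) * indicator {0..} r)) {..a}
      = (\<integral>\<^sup>+x. ennreal (2 * pi * x) * indicator {0..a} x \<partial>lborel)"
      by (subst emeasure_density) (auto intro!: nn_integral_cong simp: indicator_def)
    also have "\<dots> = ennreal (pi * a\<^sup>2 - pi * 0\<^sup>2)"
      using False by (intro nn_integral_FTC_Icc) (auto intro!: derivative_eq_intros)
    finally show ?thesis using False by simp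
  qed
  show "emeasure (distr lborel borel (norm::complex\<Rightarrow>real)) X = emeasure (density lborel (\<lambda>r. ennreal (2 * pi * r) * indicator {0..} r)) X"
    if "X \<in> range (\<lambda>a::real. {..a})" for X
    using that unfolding image_iff by (elim bexE) (simp only: 1 2)
  show "emeasure (distr lborel borel (norm::complex\<Rightarrow>real)) X \<noteq> \<infinity>" if "X \<in> range (\<lambda>n. {..real n})" for X
    using that 1 by auto
  show "\<Union> (range (\<lambda>n. {..real n})) = UNIV"
    using real_arch_simple by auto
qed auto

text \<open>Identifies planar Lebesgue measure with that of \<open>real^2\<close>, where invariance
  under orthogonal transformations is at hand for the next lemma.\<close>

lemma distr_lborel_Complex:
  "distr lborel borel (\<lambda>v::real^2. Complex (v $ 1) (v $ 2)) = lborel"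
proof (rule lborel_eqI[symmetric])
  fix l u :: complex
  assume le: "\<And>b. b \<in> Basis \<Longrightarrow> l \<bullet> b \<le> u \<bullet> b"
  have "emeasure (distr lborel borel (\<lambda>v::real^2. Complex (v $ 1) (v $ 2))) (box l u)
     = emeasure lborel ((\<lambda>v::real^2. Complex (v $ 1) (v $ 2)) -` box l u \<inter> space lborel)"
    by (rule emeasure_distr) (auto intro!: borel_measurable_continuous_onI continuous_intros simp: Complex_eq)
  also have "(\<lambda>v::real^2. Complex (v $ 1) (v $ 2)) -` box l u \<inter> space lborel
     = box (vector [Re l, Im l]) (vector [Re u, Im u])"
    by (auto simp: in_box_complex_iff mem_box_cart forall_2)
  also have "emeasure lborel \<dots> = (\<Prod>b\<in>Basis. (vector [Re u, Im u] - vector [Re l, Im l] :: real^2) \<bullet> b)"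
  proof (rule emeasure_lborel_box)
    fix b :: "real^2" assume "b \<in> Basis"
    then obtain i where b: "b = axis i 1" by (auto simp: Basis_vec_def)
    have "Re l \<le> Re u" "Im l \<le> Im u" using le[of 1] le[of \<i>] by (auto simp: Basis_complex_def)
    then show "vector [Re l, Im l] \<bullet> b \<le> vector [Re u, Im u] \<bullet> b"
      using exhaust_2[of i] by (auto simp: b inner_axis)
  qed
  also have "\<dots> = (Re u - Re l) * (Im u - Im l)"
  proof -
    have B: "(Basis :: (real^2) set) = {axis 1 1, axis 2 1}"
      by (auto simp: Basis_vec_def UNIV_2)
    have ne: "axis 1 1 \<noteq> (axis 2 1 :: real^2)" by (simp add: axis_eq_axis)
    have "(\<Prod>b\<in>Basis. (vector [Re u, Im u] - vector [Re l, Im l] :: real^2) \<bullet> b) = (Re u - Re l) * (Im u - Im l)"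
      unfolding B using ne by (simp add: inner_axis)
    then show ?thesis by simp
  qed
  also have "\<dots> = (\<Prod>b\<in>Basis. (u - l) \<bullet> b)"
    by (simp add: Basis_complex_def)
  finally show "emeasure (distr lborel borel (\<lambda>v::real^2. Complex (v $ 1) (v $ 2))) (box l u) = (\<Prod>b\<in>Basis. (u - l) \<bullet> b)"
    by simp
qed auto

text \<open>Multiplication by \<open>c\<close> is conjugate to an orthogonal transformation
  \<open>F\<close> of \<open>real^2\<close>. Boxes are enough as test sets, and as they are bounded
  all measures involved are finite.\<close>

lemma distr_lborel_rotation:
  fixes c :: complex
  assumes c: "norm c = 1"
  shows "distr lborel borel (\<lambda>z. c * z) = lborel"
proof (rule lborel_eqI[symmetric])
  fix l u :: complex
  assume le: "\<And>b. b \<in> Basis \<Longrightarrow> l \<bullet> b \<le> u \<bullet> b"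
  let ?B = "box l u"
  define \<psi> where "\<psi> = (\<lambda>v::real^2. Complex (v $ 1) (v $ 2))"
  define \<phi> where "\<phi> = (\<lambda>z::complex. (vector [Re z, Im z] :: real^2))"
  define F where "F = (\<lambda>v. \<phi> (c * \<psi> v))"
  have \<psi>m [measurable]: "\<psi> \<in> borel_measurable borel"
    unfolding \<psi>_def by (auto intro!: borel_measurable_continuous_onI continuous_intros simp: Complex_eq)
  have \<phi>\<psi>: "\<phi> (\<psi> v) = v" for v by (simp add: \<phi>_def \<psi>_def vec_eq_iff forall_2)
  have \<psi>\<phi>: "\<psi> (\<phi> z) = z" for z by (simp add: \<phi>_def \<psi>_def)
  have n\<phi>: "norm (\<phi> z) = norm z" for z
    by (simp add: \<phi>_def norm_vec_def L2_set_def sum_2 cmod_def)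
  have n\<psi>: "norm (\<psi> v) = norm v" for v
    using n\<phi>[of "\<psi> v"] by (simp add: \<phi>\<psi>)
  have lin: "linear F"
    by (rule linearI) (auto simp: F_def \<phi>_def \<psi>_def vec_eq_iff forall_2 algebra_simps)
  have orth: "orthogonal_transformation F"
    unfolding orthogonal_transformation using lin c by (auto simp: F_def n\<phi> n\<psi> norm_mult)
  have bm: "\<psi> -` ?B \<in> sets borel" using measurable_sets[OF \<psi>m, of ?B] by simp
  have bm': "(\<lambda>z. c * z) -` ?B \<in> sets borel"
    using measurable_sets[of "(\<lambda>z. c * z)" borel borel ?B] by simp
  define S where "S = \<psi> -` ((\<lambda>z. c * z) -` ?B)"
  have Sb: "S \<in> sets borel" unfolding S_def using measurable_sets[OF \<psi>m bm'] by simp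
  have FS: "F ` S = \<psi> -` ?B"
  proof safe
    fix v assume "v \<in> S" then show "F v \<in> \<psi> -` ?B" by (auto simp: S_def F_def \<psi>\<phi>)
  next
    fix v assume v: "\<psi> v \<in> ?B"
    have "v = F (\<phi> (inverse c * \<psi> v))" using c by (auto simp: F_def \<psi>\<phi> \<phi>\<psi> field_simps)
    moreover have "\<phi> (inverse c * \<psi> v) \<in> S" using v c by (auto simp: S_def \<psi>\<phi> field_simps)
    ultimately show "v \<in> F ` S" by blast
  qed
  have "bounded S"
  proof -
    obtain R where R: "\<forall>x\<in>?B. norm x \<le> R" using bounded_box[of l u] bounded_iff by blast
    have "norm v \<le> R" if "v \<in> S" for v
      using that R c unfolding S_def by (metis mult_1 n\<psi> norm_mult vimageE)
    then show ?thesis using bounded_iff by blast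
  qed
  then have Sl: "S \<in> lmeasurable" using Sb by (simp add: bounded_set_imp_lmeasurable)
  have eqm: "F ` S \<in> lmeasurable" "measure lebesgue (F ` S) = measure lebesgue S"
    using measurable_orthogonal_image[OF orth Sl] measure_orthogonal_image[OF orth Sl] by auto
  have "emeasure (distr lborel borel (\<lambda>z. c * z)) ?B = emeasure lborel ((\<lambda>z. c * z) -` ?B)"
    by (subst emeasure_distr) auto
  also have "\<dots> = emeasure (distr lborel borel \<psi>) ((\<lambda>z. c * z) -` ?B)"
    unfolding \<psi>_def distr_lborel_Complex ..
  also have "\<dots> = emeasure lborel S"
    by (subst emeasure_distr) (auto simp: S_def bm')
  also have "\<dots> = ennreal (measure lebesgue S)"
    using emeasure_eq_measure2[OF Sl] emeasure_completion[of S lborel] Sb by simp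
  also have "\<dots> = emeasure lborel (\<psi> -` ?B)"
    using emeasure_eq_measure2[OF eqm(1)] eqm(2) emeasure_completion[of "F ` S" lborel] bm by (simp add: FS)
  also have "\<dots> = emeasure (distr lborel borel \<psi>) ?B"
    by (subst emeasure_distr) auto
  also have "\<dots> = (\<Prod>b\<in>Basis. (u - l) \<bullet> b)"
    unfolding \<psi>_def distr_lborel_Complex using le by (rule emeasure_lborel_box)
  finally show "emeasure (distr lborel borel (\<lambda>z. c * z)) ?B = (\<Prod>b\<in>Basis. (u - l) \<bullet> b)" .
qed auto

text \<open>The weight is only Lebesgue measurable, so it is replaced by a Borel function off a null
  set of radii. The circles over a null set have planar measure zero because the distribution of
  \<open>norm\<close> has a density.\<close>

lemma AE_lborel_norm:
  assumes "AE r in lborel. P r"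
  shows "AE z::complex in lborel. P (norm z)"
proof -
  obtain N where N: "{r \<in> space lborel. \<not> P r} \<subseteq> N" "N \<in> sets lborel" "emeasure lborel N = 0"
    using assms by (rule AE_E)
  have "AE r in lborel. r \<notin> N" using N(2,3) AE_not_in[of N lborel] by (auto simp: null_sets_def)
  then have "AE r in density lborel (\<lambda>r. ennreal (2 * pi * r) * indicator {0..} r). r \<notin> N"
    by (subst AE_density) auto
  then have "AE r in distr lborel borel (norm::complex \<Rightarrow> real). r \<notin> N"
    unfolding distr_lborel_norm_complex .
  then have "AE z::complex in lborel. norm z \<notin> N"
    using N(2) by (subst (asm) AE_distr_iff) auto
  then show ?thesis using N(1) by (auto elim!: eventually_mono)
qed

lemma borel_measurable_lebesgue:
  assumes "f \<in> borel_measurable borel" shows "f \<in> borel_measurable lebesgue"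
proof -
  have "f \<in> borel_measurable lborel" using assms by simp
  then show ?thesis by (rule measurable_completion)
qed

section \<open>The weight as a measure on radii and on the disk\<close>

locale radial =
  fixes \<omega> :: "real \<Rightarrow> real"
  assumes radial_weight: "radial_weight \<omega>"
begin

abbreviation "\<mu> \<equiv> weighted_area \<omega>"
abbreviation "hat \<equiv> weight_tail \<omega>"
abbreviation "mom \<equiv> weight_moment \<omega>"

text \<open>Nothing is assumed of \<omega> off [0,1), where it may even be negative. The cut-off
  makes it integrable and nonnegative on the whole line.\<close>

definition wt0 :: "real \<Rightarrow> real" where "wt0 r = indicator {0..<1} r * \<omega> r"

text \<open>The measure \<omega> dr on radii, without the factor \<open>2 * r\<close> of area. Tails
  and moments become its measures and integrals (\<open>hat_eq\<close>,
  \<open>mom_eq\<close>).\<close>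

definition \<nu> :: "real measure" where "\<nu> = density lebesgue (\<lambda>r. ennreal (wt0 r))"

lemma wt0_nonneg: "0 \<le> wt0 r"
  using radial_weight by (auto simp: wt0_def radial_weight_def indicator_def)

lemma integrable_wt0: "integrable lebesgue wt0"
proof -
  have "wt0 = (\<lambda>x. indicator {0..<1} x *\<^sub>R \<omega> x)" by (auto simp: wt0_def)
  then show ?thesis using radial_weight unfolding radial_weight_def set_integrable_def by simp
qed

lemma wt0_measurable [measurable]: "wt0 \<in> borel_measurable lebesgue"
  using integrable_wt0 by auto

lemma ennreal_wt0_measurable: "(\<lambda>r. ennreal (wt0 r)) \<in> borel_measurable lebesgue"
  by (rule measurable_compose[OF wt0_measurable measurable_ennreal])

lemma sets_\<nu> [simp]: "sets \<nu> = sets lebesgue"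
  by (simp add: \<nu>_def)

lemma measurable_\<nu>: "measurable \<nu> N = measurable lebesgue N"
  by (rule measurable_cong_sets[OF sets_\<nu> refl])

lemma space_\<nu> [simp]: "space \<nu> = UNIV"
  by (simp add: \<nu>_def)

lemma borel_\<nu>:
  assumes "f \<in> borel_measurable borel" shows "f \<in> borel_measurable \<nu>"
proof -
  have "f \<in> borel_measurable lebesgue" using assms by (rule borel_measurable_lebesgue)
  then show ?thesis by (simp only: measurable_\<nu>)
qed

lemma AE_\<nu>: "AE r in \<nu>. r \<in> {0..<1}"
  unfolding \<nu>_def AE_density[OF ennreal_wt0_measurable]
  by (rule AE_I2) (auto simp: wt0_def split: split_indicator_asm)

lemma finite_\<nu>: "finite_measure \<nu>"
proof
  have "emeasure \<nu> (space \<nu>) = (\<integral>\<^sup>+r. ennreal (wt0 r) \<partial>lebesgue)"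
    unfolding \<nu>_def by (subst emeasure_density[OF ennreal_wt0_measurable]) auto
  also have "\<dots> < \<infinity>" using integrable_wt0 wt0_nonneg by (simp add: nn_integral_eq_integral)
  finally show "emeasure \<nu> (space \<nu>) \<noteq> \<infinity>" by simp
qed

sublocale N: finite_measure \<nu> by (rule finite_\<nu>)

lemma integral_\<nu>:
  fixes f :: "real \<Rightarrow> real"
  assumes "f \<in> borel_measurable borel"
  shows "(LINT r|\<nu>. f r) = (LINT r:{0..<1}|lebesgue. f r * \<omega> r)"
proof -
  have [measurable]: "f \<in> borel_measurable lebesgue" using assms by (rule borel_measurable_lebesgue)
  have "(LINT r|\<nu>. f r) = (LINT r|lebesgue. wt0 r *\<^sub>R f r)"
    unfolding \<nu>_def by (rule integral_density) (auto simp: wt0_nonneg)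
  also have "\<dots> = (LINT r:{0..<1}|lebesgue. f r * \<omega> r)"
    unfolding set_lebesgue_integral_def by (auto simp: wt0_def mult_ac intro!: Bochner_Integration.integral_cong)
  finally show ?thesis .
qed

lemma hat_eq: assumes "0 \<le> r" shows "hat r = measure \<nu> {r..}"
proof -
  have "measure \<nu> {r..} = (LINT s|\<nu>. indicator {r..} s)" by simp
  also have "\<dots> = (LINT s:{0..<1}|lebesgue. indicator {r..} s * \<omega> s)" by (rule integral_\<nu>) auto
  also have "\<dots> = hat r" unfolding weight_tail_def set_lebesgue_integral_def
    using assms by (auto intro!: Bochner_Integration.integral_cong simp: indicator_def)
  finally show ?thesis by simp
qed

lemma mom_eq: "mom x = (LINT r|\<nu>. r powr x)"
  unfolding weight_moment_def by (subst integral_\<nu>) auto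

lemma hat_pos: "0 \<le> r \<Longrightarrow> r < 1 \<Longrightarrow> 0 < hat r"
  using radial_weight by (auto simp: radial_weight_def)

lemma hat_mono: "0 \<le> r \<Longrightarrow> r \<le> s \<Longrightarrow> hat s \<le> hat r"
  by (auto simp: hat_eq intro!: N.finite_measure_mono)

lemma integrable_\<nu>_bounded:
  fixes f :: "real \<Rightarrow> real"
  assumes "f \<in> borel_measurable borel" "\<And>r. 0 \<le> r \<Longrightarrow> r < 1 \<Longrightarrow> \<bar>f r\<bar> \<le> B"
  shows "integrable \<nu> f"
proof (rule N.integrable_const_bound[where B=B])
  show "AE x in \<nu>. norm (f x) \<le> B" using AE_\<nu> by eventually_elim (use assms(2) in auto)
qed (rule borel_\<nu>[OF assms(1)])

lemma integrable_\<nu>_powr: "x \<ge> 0 \<Longrightarrow> integrable \<nu> (\<lambda>r. r powr x)"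
  by (rule integrable_\<nu>_bounded[where B=1]) (auto intro!: powr_le1)

lemma mom_mono: assumes "0 \<le> x" "x \<le> y" shows "mom y \<le> mom x"
  unfolding mom_eq
proof (rule integral_mono_AE)
  show "AE r in \<nu>. r powr y \<le> r powr x" using AE_\<nu> by eventually_elim (use assms in \<open>auto intro!: powr_mono'\<close>)
qed (use assms integrable_\<nu>_powr in auto)

text \<open>Markov's inequality for \<open>s powr x\<close> under \<nu>; it is the source of all
  lower bounds for moments.\<close>

lemma mom_ge_hat:
  assumes "x \<ge> 0" "0 \<le> r" "r < 1"
  shows "r powr x * hat r \<le> mom x"
proof -
  have "r powr x * hat r = (LINT s|\<nu>. r powr x * indicator {r..} s)"
    using assms by (simp add: hat_eq)
  also have "\<dots> \<le> (LINT s|\<nu>. s powr x)"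
  proof (rule integral_mono_AE)
    show "integrable \<nu> (\<lambda>s. r powr x * indicator {r..} s)"
      by (rule integrable_\<nu>_bounded[where B="r powr x"]) (auto simp: indicator_def)
    show "integrable \<nu> (\<lambda>r. r powr x)" by (rule integrable_\<nu>_powr[OF assms(1)])
    show "AE s in \<nu>. r powr x * indicator {r..} s \<le> s powr x"
      using assms by (auto simp: indicator_def intro!: powr_mono2)
  qed
  finally show ?thesis by (simp add: mom_eq)
qed

lemma mom_pos: "x \<ge> 0 \<Longrightarrow> 0 < mom x"
proof -
  assume "x \<ge> 0"
  have "0 < (1/2) powr x * hat (1/2)" using hat_pos[of "1/2"] by simp
  also have "\<dots> \<le> mom x" using \<open>x \<ge> 0\<close> by (intro mom_ge_hat) auto
  finally show ?thesis .
qed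

lemma measurable_wt_norm: "(\<lambda>z::complex. wt0 (norm z)) \<in> borel_measurable lebesgue"
proof -
  obtain g where g: "g \<in> borel_measurable lborel" "AE r in lborel. wt0 r = g r"
    using completion_ex_borel_measurable_real[of wt0 lborel] by auto
  have "AE z::complex in lborel. g (norm z) = wt0 (norm z)"
    by (rule AE_lborel_norm) (use g(2) in auto)
  then have "AE z::complex in lebesgue. g (norm z) = wt0 (norm z)" by (rule AE_completion)
  moreover have "(\<lambda>z::complex. g (norm z)) \<in> borel_measurable lebesgue"
    by (rule measurable_completion) (use g(1) in simp)
  ultimately show ?thesis by (rule borel_measurable_AE[rotated])
qed

lemma space_\<mu> [simp]: "space \<mu> = disk" by (simp add: weighted_area_def)

lemma sets_\<mu>: "sets \<mu> = sets (lebesgue_on disk)" by (simp add: weighted_area_def)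

lemma measurable_\<mu>: "measurable \<mu> N = measurable (lebesgue_on disk) N"
  by (rule measurable_cong_sets[OF sets_\<mu> refl])

lemma borel_\<mu>: 
  assumes "f \<in> borel_measurable borel" shows "f \<in> borel_measurable \<mu>"
proof -
  have "f \<in> borel_measurable lebesgue" using assms by (rule borel_measurable_lebesgue)
  then have "f \<in> borel_measurable (lebesgue_on disk)" by (rule measurable_restrict_space1)
  then show ?thesis by (simp only: measurable_\<mu>)
qed

lemma measurable_weight_disk: "(\<lambda>z. ennreal (\<omega> (norm z) / pi)) \<in> borel_measurable (lebesgue_on disk)"
proof -
  have "(\<lambda>z::complex. ennreal (wt0 (norm z) / pi)) \<in> borel_measurable (lebesgue_on disk)"
    using measurable_wt_norm by (intro measurable_restrict_space1) auto
  then show ?thesis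
    by (rule measurable_cong[THEN iffD1, rotated]) (auto simp: wt0_def)
qed

lemma nn_integral_\<mu>:
  assumes "f \<in> borel_measurable \<mu>"
  shows "(\<integral>\<^sup>+z. f z \<partial>\<mu>) = (\<integral>\<^sup>+z. ennreal (wt0 (norm z) / pi) * f z \<partial>lebesgue)"
proof -
  have "f \<in> borel_measurable (lebesgue_on disk)" using assms by (simp only: measurable_\<mu>)
  then have "(\<integral>\<^sup>+z. f z \<partial>\<mu>) = (\<integral>\<^sup>+z. ennreal (\<omega> (norm z) / pi) * f z \<partial>(lebesgue_on disk))"
    unfolding weighted_area_def by (rule nn_integral_density[OF measurable_weight_disk])
  also have "\<dots> = (\<integral>\<^sup>+z. ennreal (\<omega> (norm z) / pi) * f z * indicator disk z \<partial>lebesgue)"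
    by (rule nn_integral_restrict_space) auto
  also have "\<dots> = (\<integral>\<^sup>+z. ennreal (wt0 (norm z) / pi) * f z \<partial>lebesgue)"
    by (intro nn_integral_cong) (auto simp: wt0_def indicator_def)
  finally show ?thesis .
qed

text \<open>The factor \<open>2 * r\<close> is the circumference \<open>2 * pi * r\<close> divided
  by the pi that normalizes area. A Borel version \<open>g\<close> of the weight is needed to pass
  through the distribution of \<open>norm\<close> and back.\<close>

lemma nn_integral_radial:
  assumes h: "h \<in> borel_measurable borel"
  shows "(\<integral>\<^sup>+z. h (norm z) \<partial>\<mu>) = (\<integral>\<^sup>+r. ennreal (2 * r) * h r \<partial>\<nu>)"
proof -
  obtain g where g: "g \<in> borel_measurable lborel" "AE r in lborel. wt0 r = g r"
    using completion_ex_borel_measurable_real[of wt0 lborel] by auto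
  have g' [measurable]: "g \<in> borel_measurable borel" "h \<in> borel_measurable borel" using g h by auto
  have gc: "AE z::complex in lborel. wt0 (norm z) = g (norm z)"
    by (rule AE_lborel_norm) (use g(2) in auto)
  have hl: "(\<lambda>r. ennreal (2 * r) * h r) \<in> borel_measurable lebesgue" by (rule borel_measurable_lebesgue) simp
  have "(\<integral>\<^sup>+z. h (norm z) \<partial>\<mu>) = (\<integral>\<^sup>+(z::complex). ennreal (wt0 (norm z) / pi) * h (norm z) \<partial>lborel)"
    by (subst nn_integral_\<mu>) (auto intro!: borel_\<mu> simp: nn_integral_completion)
  also have "\<dots> = (\<integral>\<^sup>+(z::complex). ennreal (g (norm z) / pi) * h (norm z) \<partial>lborel)"
    by (rule nn_integral_cong_AE) (use gc in \<open>auto elim!: eventually_mono\<close>)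
  also have "\<dots> = (\<integral>\<^sup>+r. ennreal (g r / pi) * h r \<partial>distr lborel borel (norm::complex \<Rightarrow> real))"
    by (subst nn_integral_distr) auto
  also have "\<dots> = (\<integral>\<^sup>+r. ennreal (2 * pi * r) * indicator {0..} r * (ennreal (g r / pi) * h r) \<partial>lborel)"
    unfolding distr_lborel_norm_complex by (subst nn_integral_density) auto
  also have "\<dots> = (\<integral>\<^sup>+r. ennreal (wt0 r) * (ennreal (2 * r) * h r) \<partial>lborel)"
  proof (rule nn_integral_cong_AE, use g(2) in eventually_elim)
    fix r assume r: "wt0 r = g r"
    show "ennreal (2 * pi * r) * indicator {0..} r * (ennreal (g r / pi) * h r) = ennreal (wt0 r) * (ennreal (2 * r) * h r)"
    proof (cases "r \<ge> 0")
      case True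
      have "ennreal (2 * pi * r) * ennreal (g r / pi) = ennreal (wt0 r) * ennreal (2 * r)"
        using True wt0_nonneg[of r] by (simp add: r mult_ac flip: ennreal_mult)
      then show ?thesis using True by (simp add: mult.assoc [symmetric])
    qed (auto simp: wt0_def)
  qed
  also have "\<dots> = (\<integral>\<^sup>+r. ennreal (2 * r) * h r \<partial>\<nu>)"
    unfolding \<nu>_def nn_integral_density[OF ennreal_wt0_measurable hl] by (simp add: nn_integral_completion)
  finally show ?thesis .
qed

lemma emeasure_annulus_le: "emeasure \<mu> (space \<mu>) \<le> 2 * emeasure \<nu> (space \<nu>)"
proof -
  have "emeasure \<mu> (space \<mu>) = (\<integral>\<^sup>+z. 1 \<partial>\<mu>)" by simp
  also have "\<dots> = (\<integral>\<^sup>+r. ennreal (2 * r) * 1 \<partial>\<nu>)" using nn_integral_radial[of "\<lambda>_. 1"] by simp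
  also have "\<dots> \<le> (\<integral>\<^sup>+r. 2 \<partial>\<nu>)"
  proof (rule nn_integral_mono_AE)
    show "AE r in \<nu>. ennreal (2 * r) * 1 \<le> 2"
      using AE_\<nu> by eventually_elim (auto simp flip: ennreal_numeral intro!: ennreal_leI)
  qed
  finally show ?thesis by simp
qed

lemma finite_\<mu>: "finite_measure \<mu>"
proof
  show "emeasure \<mu> (space \<mu>) \<noteq> \<infinity>"
    using emeasure_annulus_le N.emeasure_finite[of "space \<nu>"]
    by (auto simp: ennreal_mult_eq_top_iff top_unique)
qed

sublocale M: finite_measure \<mu> by (rule finite_\<mu>)

text \<open>The measurable sets of \<mu> are Lebesgue sets, so invariance is stated for the image
  measures on \<open>borel\<close>. This is what rotating Borel integrands and Borel sets
  requires.\<close>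

lemma distr_\<mu>_rotation:
  fixes c :: complex assumes c: "norm c = 1"
  shows "distr \<mu> borel (\<lambda>z. c * z) = distr \<mu> borel (\<lambda>z. z)"
proof (rule measure_eqI)
  obtain g where g: "g \<in> borel_measurable lborel" "AE r in lborel. wt0 r = g r"
    using completion_ex_borel_measurable_real[of wt0 lborel] by auto
  have g' [measurable]: "g \<in> borel_measurable borel" using g by auto
  have gc: "AE z::complex in lborel. wt0 (norm z) = g (norm z)"
    by (rule AE_lborel_norm) (use g(2) in auto)
  have *: "(\<integral>\<^sup>+z. f z \<partial>\<mu>) = (\<integral>\<^sup>+(z::complex). ennreal (g (norm z) / pi) * f z \<partial>lborel)"
    if f: "f \<in> borel_measurable borel" for f
  proof -
    have "(\<integral>\<^sup>+z. f z \<partial>\<mu>) = (\<integral>\<^sup>+(z::complex). ennreal (wt0 (norm z) / pi) * f z \<partial>lborel)"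
      using f by (subst nn_integral_\<mu>) (auto intro!: borel_\<mu> simp: nn_integral_completion)
    also have "\<dots> = (\<integral>\<^sup>+(z::complex). ennreal (g (norm z) / pi) * f z \<partial>lborel)"
      by (rule nn_integral_cong_AE) (use gc in \<open>auto elim!: eventually_mono\<close>)
    finally show ?thesis .
  qed
  fix A assume "A \<in> sets (distr \<mu> borel (\<lambda>z. c * z))"
  then have A [measurable]: "A \<in> sets borel" by simp
  have "emeasure (distr \<mu> borel (\<lambda>z. c * z)) A = (\<integral>\<^sup>+z. indicator A z \<partial>distr \<mu> borel (\<lambda>z. c * z))" by simp
  also have "\<dots> = (\<integral>\<^sup>+z. indicator A (c * z) \<partial>\<mu>)"
    by (subst nn_integral_distr) (auto intro!: borel_\<mu>)
  also have "\<dots> = (\<integral>\<^sup>+(z::complex). ennreal (g (norm z) / pi) * indicator A (c * z) \<partial>lborel)"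
    by (rule *) auto
  also have "\<dots> = (\<integral>\<^sup>+(z::complex). ennreal (g (norm (c * z)) / pi) * indicator A (c * z) \<partial>lborel)"
    by (simp add: norm_mult c)
  also have "\<dots> = (\<integral>\<^sup>+(z::complex). ennreal (g (norm z) / pi) * indicator A z \<partial>distr lborel borel (\<lambda>z. c * z))"
    by (subst nn_integral_distr) auto
  also have "\<dots> = (\<integral>\<^sup>+z. indicator A z \<partial>\<mu>)"
    unfolding distr_lborel_rotation[OF c] by (rule *[symmetric]) auto
  also have "\<dots> = (\<integral>\<^sup>+z. indicator A z \<partial>distr \<mu> borel (\<lambda>z. z))"
    by (subst nn_integral_distr) (auto intro!: borel_\<mu>)
  finally show "emeasure (distr \<mu> borel (\<lambda>z. c * z)) A = emeasure (distr \<mu> borel (\<lambda>z. z)) A" by simp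
qed simp

lemma integral_\<mu>_rotation:
  fixes c :: complex and f :: "complex \<Rightarrow> 'b::{banach, second_countable_topology}"
  assumes c: "norm c = 1" and f: "f \<in> borel_measurable borel"
  shows "(LINT z|\<mu>. f (c * z)) = (LINT z|\<mu>. f z)"
  using integral_distr[OF borel_\<mu> f, of "\<lambda>z. c * z"] integral_distr[OF borel_\<mu> f, of "\<lambda>z. z"] distr_\<mu>_rotation[OF c]
  by simp

lemma emeasure_\<mu>_rotation:
  fixes c :: complex
  assumes c: "norm c = 1" and A: "A \<in> sets borel"
  shows "emeasure \<mu> {z \<in> disk. c * z \<in> A} = emeasure \<mu> {z\<in>disk. z \<in> A}"
  using emeasure_distr[OF borel_\<mu>, of "\<lambda>z. c * z" A] emeasure_distr[OF borel_\<mu>, of "\<lambda>z. z" A] distr_\<mu>_rotation[OF c] A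
  by (simp add: vimage_def Int_def conj_commute)

text \<open>The shift from \<open>y\<close> to \<open>y + 1\<close> is the factor \<open>r\<close>
  of the area element. All norms of radial powers come from this formula.\<close>

lemma has_bochner_integral_powr:
  assumes "y \<ge> 0"
  shows "has_bochner_integral \<mu> (\<lambda>z. norm z powr y) (2 * mom (y + 1))"
proof (rule has_bochner_integral_nn_integral)
  have "(\<integral>\<^sup>+z. ennreal (norm z powr y) \<partial>\<mu>) = (\<integral>\<^sup>+r. ennreal (2 * r) * ennreal (r powr y) \<partial>\<nu>)"
    by (rule nn_integral_radial) auto
  also have "\<dots> = (\<integral>\<^sup>+r. ennreal (2 * r powr (y + 1)) \<partial>\<nu>)"
  proof (rule nn_integral_cong_AE)
    show "AE r in \<nu>. ennreal (2 * r) * ennreal (r powr y) = ennreal (2 * r powr (y + 1))"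
      using AE_\<nu> by eventually_elim (auto simp: powr_add mult_ac simp flip: ennreal_mult)
  qed
  also have "\<dots> = ennreal (LINT r|\<nu>. 2 * r powr (y + 1))"
    using assms integrable_\<nu>_powr[of "y+1"] by (intro nn_integral_eq_integral) auto
  also have "\<dots> = ennreal (2 * mom (y + 1))" by (simp add: mom_eq)
  finally show "(\<integral>\<^sup>+z. ennreal (norm z powr y) \<partial>\<mu>) = ennreal (2 * mom (y + 1))" .
  show "0 \<le> 2 * mom (y + 1)" using mom_pos[of "y+1"] assms by simp
qed (auto intro!: borel_\<mu>)

lemma mom_nat: "n \<ge> 1 \<Longrightarrow> mom (real n) = (LINT r|\<nu>. r ^ n)"
  unfolding mom_eq
proof (rule integral_cong_AE)
  show "n \<ge> 1 \<Longrightarrow> AE r in \<nu>. r powr real n = r ^ n"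
    using AE_\<nu> by eventually_elim (auto simp: powr_realpow')
qed (auto intro!: borel_\<nu>)

section \<open>Tails against moments\<close>

lemma emeasure_hat: "0 \<le> r \<Longrightarrow> emeasure \<nu> {r..} = ennreal (hat r)"
  by (simp add: hat_eq N.emeasure_eq_measure)

lemma emeasure_ge_1:
  assumes "1 \<le> r" shows "emeasure \<nu> {r..} = 0"
proof -
  have "AE s in \<nu>. \<not> r \<le> s" using AE_\<nu> by eventually_elim (use assms in auto)
  then show ?thesis using emeasure_eq_0_AE[of "\<lambda>s. r \<le> s" \<nu>] by (simp add: atLeast_def)
qed

text \<open>Writes \<open>s ^ Suc n\<close> as the integral of its derivative over [0,s] and
  exchanges the integrals. \<beta> is \<nu> on Borel sets only, where joint measurability for Fubini
  is at hand.\<close>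

lemma layer_cake:
  "ennreal (mom (real (Suc n))) =
   (\<integral>\<^sup>+t. ennreal (real (Suc n) * t ^ n) * indicator {0..} t * emeasure \<nu> {t..} \<partial>lborel)"
proof -
  define \<beta> where "\<beta> = distr \<nu> borel (\<lambda>x. x)"
  have id: "(\<lambda>x. x) \<in> measurable \<nu> borel" by (rule borel_\<nu>) auto
  have fin: "finite_measure \<beta>" unfolding \<beta>_def by (rule N.finite_measure_distr[OF id])
  interpret B: finite_measure \<beta> by (rule fin)
  interpret P: pair_sigma_finite \<beta> lborel ..
  have sb [measurable_cong]: "sets \<beta> = sets borel" by (simp add: \<beta>_def)
  have n\<beta>: "(\<integral>\<^sup>+x. f x \<partial>\<nu>) = (\<integral>\<^sup>+x. f x \<partial>\<beta>)" if "f \<in> borel_measurable borel" for f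
    unfolding \<beta>_def using nn_integral_distr[OF id] that by simp
  have e\<beta>: "emeasure \<beta> {t..} = emeasure \<nu> {t..}" for t
    unfolding \<beta>_def by (subst emeasure_distr[OF id]) auto
  have "ennreal (mom (real (Suc n))) = ennreal (LINT r|\<nu>. r ^ Suc n)" by (subst mom_nat) auto
  also have "\<dots> = (\<integral>\<^sup>+s. ennreal (s ^ Suc n) \<partial>\<nu>)"
  proof (rule nn_integral_eq_integral[symmetric])
    show "integrable \<nu> (\<lambda>r. r ^ Suc n)" 
      by (rule integrable_\<nu>_bounded[where B=1]) (auto simp del: power_Suc simp: power_abs power_le_one)
    show "AE r in \<nu>. 0 \<le> r ^ Suc n" using AE_\<nu> by eventually_elim auto
  qed
  also have "\<dots> = (\<integral>\<^sup>+s. (\<integral>\<^sup>+t. ennreal (real (Suc n) * t ^ n) * indicator {0..s} t \<partial>lborel) \<partial>\<nu>)"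
  proof (rule nn_integral_cong_AE)
    show "AE s in \<nu>. ennreal (s ^ Suc n) = (\<integral>\<^sup>+t. ennreal (real (Suc n) * t ^ n) * indicator {0..s} t \<partial>lborel)"
      using AE_\<nu>
    proof eventually_elim
      fix s :: real assume s: "s \<in> {0..<1}"
      have "(\<integral>\<^sup>+t. ennreal (real (Suc n) * t ^ n) * indicator {0..s} t \<partial>lborel) = ennreal (s ^ Suc n - 0 ^ Suc n)"
        using s DERIV_pow[of "Suc n"] by (intro nn_integral_FTC_Icc) (auto simp del: power_Suc of_nat_Suc)
      then show "ennreal (s ^ Suc n) = (\<integral>\<^sup>+t. ennreal (real (Suc n) * t ^ n) * indicator {0..s} t \<partial>lborel)" by simp
    qed
  qed
  also have "\<dots> = (\<integral>\<^sup>+s. (\<integral>\<^sup>+t. ennreal (real (Suc n) * t ^ n) * indicator {0..s} t \<partial>lborel) \<partial>\<beta>)"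
  proof (rule n\<beta>)
    have [measurable]: "Measurable.pred (borel \<Otimes>\<^sub>M borel) (\<lambda>x. snd x \<in> {0..fst x::real})"
      unfolding atLeastAtMost_iff by measurable
    show "(\<lambda>s. \<integral>\<^sup>+t. ennreal (real (Suc n) * t ^ n) * indicator {0..s} t \<partial>lborel) \<in> borel_measurable borel"
      by measurable
  qed
  also have "\<dots> = (\<integral>\<^sup>+t. (\<integral>\<^sup>+s. ennreal (real (Suc n) * t ^ n) * indicator {0..s} t \<partial>\<beta>) \<partial>lborel)"
  proof (rule P.Fubini'[symmetric])
    have [measurable]: "Measurable.pred (borel \<Otimes>\<^sub>M borel) (\<lambda>x. snd x \<in> {0..fst x::real})"
      unfolding atLeastAtMost_iff by measurable
    show "(\<lambda>(s, t). ennreal (real (Suc n) * t ^ n) * indicator {0..s} t) \<in> borel_measurable (\<beta> \<Otimes>\<^sub>M lborel)"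
      by measurable
  qed
  also have "\<dots> = (\<integral>\<^sup>+t. ennreal (real (Suc n) * t ^ n) * indicator {0..} t * emeasure \<nu> {t..} \<partial>lborel)"
  proof (rule nn_integral_cong)
    fix t :: real
    have "(\<integral>\<^sup>+s. ennreal (real (Suc n) * t ^ n) * indicator {0..s} t \<partial>\<beta>) =
       (\<integral>\<^sup>+s. (ennreal (real (Suc n) * t ^ n) * indicator {0..} t) * indicator {t..} s \<partial>\<beta>)"
      by (intro nn_integral_cong) (auto simp: indicator_def)
    also have "\<dots> = ennreal (real (Suc n) * t ^ n) * indicator {0..} t * emeasure \<beta> {t..}"
      by (rule nn_integral_cmult_indicator) (simp add: sb)
    finally show "(\<integral>\<^sup>+s. ennreal (real (Suc n) * t ^ n) * indicator {0..s} t \<partial>\<beta>) =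
      ennreal (real (Suc n) * t ^ n) * indicator {0..} t * emeasure \<nu> {t..}" by (simp add: e\<beta>)
  qed
  finally show ?thesis .
qed

lemma measurable_emeasure_tail: "(\<lambda>t. emeasure \<nu> {t..}) \<in> borel_measurable borel"
proof -
  have "mono (\<lambda>t. - measure \<nu> {t..})" by (auto simp: mono_def intro!: N.finite_measure_mono)
  then have "(\<lambda>t. - (- measure \<nu> {t..})) \<in> borel_measurable borel"
    by (intro borel_measurable_uminus borel_measurable_mono)
  then show ?thesis by (simp add: N.emeasure_eq_measure)
qed

text \<open>In the layer-cake formula, doubling moves the tail from \<open>t\<close> to
  \<open>(1 + t) / 2\<close>. Substituting \<open>t = 2 * s - 1\<close> costs the factor 2, and
  \<open>2 * s - 1 \<le> s\<^sup>2\<close> turns the power \<open>n\<close> into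
  \<open>2 * n\<close>.\<close>

lemma D_hat_moment:
  assumes C: "C \<ge> 0" "\<And>r. 0 \<le> r \<Longrightarrow> r < 1 \<Longrightarrow> hat r \<le> C * hat ((1 + r) / 2)"
  shows "mom (real n + 1) \<le> 2 * C * mom (2 * real n + 1)"
proof -
  have mt: "(\<lambda>t. emeasure \<nu> {(1 + t)/2..}) \<in> borel_measurable borel"
    by (rule measurable_compose[OF _ measurable_emeasure_tail]) auto
  have mt': "(\<lambda>t. ennreal (real (Suc n) * t ^ n) * indicator {0..} t * emeasure \<nu> {(1 + t)/2..}) \<in> borel_measurable borel"
    by (intro borel_measurable_times_ennreal mt) auto
  have "ennreal (mom (real (Suc n))) =
   (\<integral>\<^sup>+t. ennreal (real (Suc n) * t ^ n) * indicator {0..} t * emeasure \<nu> {t..} \<partial>lborel)" by (rule layer_cake)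
  also have "\<dots> \<le> (\<integral>\<^sup>+t. ennreal C * (ennreal (real (Suc n) * t ^ n) * indicator {0..} t * emeasure \<nu> {(1 + t)/2..}) \<partial>lborel)"
  proof (rule nn_integral_mono)
    fix t :: real
    have "emeasure \<nu> {t..} \<le> ennreal C * emeasure \<nu> {(1 + t)/2..}" if "t \<ge> 0"
    proof (cases "t < 1")
      case True
      then show ?thesis using that C by (simp add: emeasure_hat ennreal_leI flip: ennreal_mult')
    next
      case False
      then show ?thesis using emeasure_ge_1[of t] by simp
    qed
    then show "ennreal (real (Suc n) * t ^ n) * indicator {0..} t * emeasure \<nu> {t..} \<le>
      ennreal C * (ennreal (real (Suc n) * t ^ n) * indicator {0..} t * emeasure \<nu> {(1 + t)/2..})"
      by (auto simp: indicator_def mult.left_commute[of "ennreal C"] intro!: mult_left_mono simp del: of_nat_Suc)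
  qed
  also have "\<dots> = ennreal C * (\<integral>\<^sup>+t. ennreal (real (Suc n) * t ^ n) * indicator {0..} t * emeasure \<nu> {(1 + t)/2..} \<partial>lborel)"
    by (rule nn_integral_cmult) (use mt' in simp)
  also have "(\<integral>\<^sup>+t. ennreal (real (Suc n) * t ^ n) * indicator {0..} t * emeasure \<nu> {(1 + t)/2..} \<partial>lborel)
    = ennreal \<bar>2\<bar> * (\<integral>\<^sup>+s. ennreal (real (Suc n) * (-1 + 2 * s) ^ n) * indicator {0..} (-1 + 2 * s) * emeasure \<nu> {(1 + (-1 + 2 * s))/2..} \<partial>lborel)"
    by (rule nn_integral_real_affine[OF mt']) simp
  also have "(\<integral>\<^sup>+s. ennreal (real (Suc n) * (-1 + 2 * s) ^ n) * indicator {0..} (-1 + 2 * s) * emeasure \<nu> {(1 + (-1 + 2 * s))/2..} \<partial>lborel)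
     \<le> (\<integral>\<^sup>+s. ennreal (real (Suc (2*n)) * s ^ (2*n)) * indicator {0..} s * emeasure \<nu> {s..} \<partial>lborel)"
  proof (rule nn_integral_mono)
    fix s :: real
    have "real (Suc n) * (-1 + 2 * s) ^ n \<le> real (Suc (2*n)) * s ^ (2*n)" if "0 \<le> -1 + 2 * s"
    proof (rule mult_mono)
      have "0 \<le> (s - 1)\<^sup>2" by simp
      then have "-1 + 2 * s \<le> s\<^sup>2" by (simp add: power2_eq_square algebra_simps)
      then show "(-1 + 2 * s) ^ n \<le> s ^ (2*n)" using that power_mono[of "-1 + 2 * s" "s\<^sup>2" n] by (simp add: power_mult)
    qed (use that in auto)
    then show "ennreal (real (Suc n) * (-1 + 2 * s) ^ n) * indicator {0..} (-1 + 2 * s) * emeasure \<nu> {(1 + (-1 + 2 * s))/2..}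
       \<le> ennreal (real (Suc (2*n)) * s ^ (2*n)) * indicator {0..} s * emeasure \<nu> {s..}"
      by (auto simp: indicator_def intro!: mult_right_mono ennreal_leI simp del: of_nat_Suc)
  qed
  also have "\<dots> = ennreal (mom (real (Suc (2*n))))" by (rule layer_cake[symmetric])
  finally have "ennreal (mom (real (Suc n))) \<le> ennreal C * (ennreal \<bar>2\<bar> * ennreal (mom (real (Suc (2*n)))))"
    by (simp add: mult_left_mono)
  also have "\<dots> = ennreal (2 * C * mom (real (Suc (2*n))))"
    using C(1) by (simp add: mult_ac flip: ennreal_mult' del: of_nat_Suc) (metis ennreal_mult' ennreal_numeral mult.assoc mult.commute zero_le_numeral)
  finally have "mom (real (Suc n)) \<le> 2 * C * mom (real (Suc (2*n)))"
    using C(1) mom_pos[of "real (Suc (2*n))"] by (subst (asm) ennreal_le_iff) auto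
  then show ?thesis by (simp add: algebra_simps)
qed

text \<open>A converse to \<open>mom_ge_hat\<close>: the layer-cake integrand is at most
  \<open>A * Suc k * t ^ (k - n)\<close>, from which the tail has disappeared. The loss is bounded
  when \<open>k\<close> exceeds \<open>n\<close> by a fixed proportion.\<close>

lemma mom_sup_bound:
  assumes A: "\<And>r. 0 \<le> r \<Longrightarrow> r < 1 \<Longrightarrow> r ^ n * hat r \<le> A" and k: "n \<le> k"
  shows "mom (real (Suc k)) \<le> A * real (Suc k) / real (Suc k - n)"
proof -
  have "0 \<le> (1/2::real) ^ n * hat (1/2)" using hat_pos[of "1/2"] by (intro mult_nonneg_nonneg) auto
  then have A0: "0 \<le> A" using A[of "1/2"] by simp
  have "ennreal (mom (real (Suc k))) =
   (\<integral>\<^sup>+t. ennreal (real (Suc k) * t ^ k) * indicator {0..} t * emeasure \<nu> {t..} \<partial>lborel)" by (rule layer_cake)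
  also have "\<dots> \<le> (\<integral>\<^sup>+t. ennreal (A * real (Suc k) * t ^ (k - n)) * indicator {0..1} t \<partial>lborel)"
  proof (rule nn_integral_mono)
    fix t :: real
    have "ennreal (real (Suc k) * t ^ k) * emeasure \<nu> {t..} \<le> ennreal (A * real (Suc k) * t ^ (k - n)) " if "t \<ge> 0" "t < 1"
    proof -
      have "real (Suc k) * t ^ k * hat t = real (Suc k) * t ^ (k - n) * (t ^ n * hat t)"
        using k by (simp flip: power_add)
      also have "\<dots> \<le> real (Suc k) * t ^ (k - n) * A" using that A by (intro mult_left_mono) auto
      finally have *: "real (Suc k) * t ^ k * hat t \<le> A * real (Suc k) * t ^ (k - n)" by (simp only: mult_ac)
      have "ennreal (real (Suc k) * t ^ k) * emeasure \<nu> {t..} = ennreal (real (Suc k) * t ^ k * hat t)"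
        using that hat_pos[of t] by (simp add: emeasure_hat flip: ennreal_mult'' del: of_nat_Suc)
      then show ?thesis using ennreal_leI[OF *] by (simp only:)
    qed
    then show "ennreal (real (Suc k) * t ^ k) * indicator {0..} t * emeasure \<nu> {t..} \<le> ennreal (A * real (Suc k) * t ^ (k - n)) * indicator {0..1} t"
      by (cases "t < 1") (auto simp: indicator_def emeasure_ge_1 simp del: of_nat_Suc)
  qed
  also have "\<dots> = ennreal (A * real (Suc k) / real (Suc k - n) * 1 ^ (Suc k - n) - A * real (Suc k) / real (Suc k - n) * 0 ^ (Suc k - n))"
  proof (rule nn_integral_FTC_Icc)
    fix x :: real
    show "((\<lambda>a. A * real (Suc k) / real (Suc k - n) * a ^ (Suc k - n)) has_real_derivative A * real (Suc k) * x ^ (k - n)) (at x)"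
      using k DERIV_cmult[OF DERIV_pow[of "Suc k - n" x UNIV], of "A * real (Suc k) / real (Suc k - n)"]
      by (simp add: Suc_diff_le field_simps del: of_nat_Suc power_Suc)
  qed (use A0 in auto)
  also have "\<dots> = ennreal (A * real (Suc k) / real (Suc k - n))" using k by (simp add: Suc_diff_le)
  finally show ?thesis using A0 by (subst (asm) ennreal_le_iff) auto
qed

end

section \<open>Doubling of moments\<close>

lemma one_minus_inverse_powr_ge:
  fixes x :: real assumes "x \<ge> 2"
  shows "exp (-2) \<le> (1 - 1 / x) powr x"
proof -
  have "- (1/x) - 2 * (1/x)\<^sup>2 \<le> ln (1 - 1/x)"
    using assms by (intro ln_one_minus_pos_lower_bound) (auto simp: field_simps)
  then have "x * (- (1/x) - 2 * (1/x)\<^sup>2) \<le> x * ln (1 - 1/x)" using assms by (intro mult_left_mono) auto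
  moreover have "x * (- (1/x) - 2 * (1/x)\<^sup>2) = -1 - 2 / x" using assms by (simp add: field_simps power2_eq_square)
  moreover have "2 / x \<le> 1" using assms by simp
  ultimately have "-2 \<le> x * ln (1 - 1/x)" by linarith
  moreover have "1 - 1/x > 0" using assms by simp
  ultimately show ?thesis using assms by (auto simp: powr_def)
qed

lemma one_minus_powr_le_exp:
  fixes u y :: real assumes "0 \<le> u" "u \<le> 1" "0 \<le> y"
  shows "(1 - u) powr y \<le> exp (- u * y)"
proof -
  have "(1 - u) powr y \<le> exp (-u) powr y"
    using assms exp_ge_add_one_self[of "-u"] by (intro powr_mono2) auto
  also have "\<dots> = exp (- u * y)" by (simp add: powr_def)
  finally show ?thesis .
qed

lemma square_le_two_power: "4 \<le> n \<Longrightarrow> n\<^sup>2 \<le> (2::nat) ^ n"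
proof (induction n rule: dec_induct)
  case (step n)
  have "2 * n + 1 \<le> n * n" using step(1) by (auto intro: order_trans[OF _ mult_le_mono1[of 4 n n]])
  then show ?case using step by (simp add: power2_eq_square algebra_simps)
qed auto

text \<open>For the absorption in \<open>mom_doubling_hat\<close>: \<open>j\<close> doublings cost
  \<open>K ^ j\<close>, but the gain has order \<open>2 ^ j\<close> in the exponent.\<close>

lemma exists_power_exp_small:
  fixes K :: real assumes "K > 0"
  shows "\<exists>j::nat. K ^ j * exp (- ((2 ^ j - 1) / 2)) \<le> 1 / 2"
proof -
  define a where "a = ln K"
  obtain j :: nat where j: "j \<ge> 4" "real j \<ge> 2 * a + 4"
    by (metis max.cobounded1 max.cobounded2 nat_ceiling_le_eq order_trans real_nat_ceiling_ge linorder_le_cases of_nat_le_iff)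
  have "real (j\<^sup>2) \<le> 2 ^ j" using square_le_two_power[OF j(1)] by (metis of_nat_le_iff of_nat_numeral of_nat_power)
  moreover have "a * j \<le> (real j - 4) / 2 * j" using j by (intro mult_right_mono) auto
  moreover have "(real j - 4) / 2 * j = real j * real j / 2 - 2 * real j" by (simp add: field_simps)
  ultimately have "a * j - (2 ^ j - 1) / 2 \<le> 1/2 - 2 * real j"
    unfolding power2_eq_square of_nat_mult diff_divide_distrib by linarith
  also have "\<dots> \<le> -1" using j by simp
  finally have *: "a * j - (2 ^ j - 1) / 2 \<le> -1" .
  have "K ^ j * exp (- ((2 ^ j - 1) / 2)) = exp (a * j - (2 ^ j - 1) / 2)"
  proof -
    have "K ^ j = exp (a * real j)" using assms by (simp add: a_def exp_of_nat2_mult)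
    then show ?thesis by (simp only: exp_add[symmetric] diff_conv_add_uminus)
  qed
  also have "\<dots> \<le> exp (-1)" using * by simp
  also have "\<dots> \<le> 1 / 2" using exp_ge_add_one_self[of 1] by (simp add: exp_minus field_simps)
  finally show ?thesis by blast
qed

lemma convex_slope_mono:
  fixes f :: "real \<Rightarrow> real"
  assumes f: "convex_on I f" and I: "a \<in> I" "d \<in> I" and le: "a < b" "c < d" "a \<le> c" "b \<le> d"
  shows "(f b - f a) / (b - a) \<le> (f d - f c) / (d - c)"
proof -
  have "(f b - f a) / (b - a) \<le> (f d - f a) / (d - a)"
    using convex_on_slope_le(1)[OF f I le(1)] le by (cases "b = d") (auto simp: minus_divide_right minus_divide_left[symmetric] field_simps)
  also have "\<dots> \<le> (f d - f c) / (d - c)"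
    using convex_on_slope_le(2)[OF f I _ le(2)] le by (cases "a = c") (auto simp: field_simps)
  finally show ?thesis .
qed

context radial
begin

text \<open>At radius \<open>1 - 1 / x\<close> the power \<open>x\<close> is still at least
  \<open>exp (-2)\<close>, so a moment controls the tail at distance \<open>1 / x\<close> from the
  boundary. The opposite bound needs doubling (\<open>mom_doubling_hat\<close>).\<close>

lemma mom_ge_hat_exp: "x \<ge> 2 \<Longrightarrow> exp (-2) * hat (1 - 1 / x) \<le> mom x"
  using mom_ge_hat[of x "1 - 1/x"] one_minus_inverse_powr_ge[of x] hat_pos[of "1 - 1/x"]
  by (smt (verit, best) divide_less_eq_1_pos divide_pos_pos mult_right_mono)

text \<open>The moment form of doubling, for real exponents; \<open>mom_doubling_imp_D_hat\<close>
  leads from it to tails.\<close>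

definition mom_doubling :: bool where
  "mom_doubling \<longleftrightarrow> (\<exists>K\<ge>1. \<forall>x\<ge>1. mom x \<le> K * mom (2 * x))"

text \<open>Split at radius \<open>1 - 1 / (2 * x)\<close>: below it the surplus power
  \<open>(M - 1) * x\<close> is exponentially small in \<open>M\<close>, above it all powers are at
  most 1.\<close>

lemma mom_le_mom_hat:
  assumes x: "x \<ge> 1" and M: "M \<ge> 1"
  shows "mom (M * x) \<le> exp (- ((M - 1) / 2)) * mom x + hat (1 - 1 / (2 * x))"
proof -
  let ?u = "1 - 1 / (2 * x)"
  have u: "0 \<le> ?u" "?u < 1" using x by auto
  have "mom (M * x) = (LINT s|\<nu>. s powr (M * x))" by (rule mom_eq)
  also have "\<dots> \<le> (LINT s|\<nu>. exp (- ((M - 1) / 2)) * s powr x + indicator {?u..} s)"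
  proof (rule integral_mono_AE)
    show "integrable \<nu> (\<lambda>s. s powr (M * x))" using x M by (intro integrable_\<nu>_powr) auto
    show "integrable \<nu> (\<lambda>s. exp (- ((M - 1) / 2)) * s powr x + indicator {?u..} s)"
      using x by (intro Bochner_Integration.integrable_add integrable_mult_right integrable_\<nu>_powr
         integrable_\<nu>_bounded[where B=1]) (auto simp: indicator_def)
    show "AE s in \<nu>. s powr (M * x) \<le> exp (- ((M - 1) / 2)) * s powr x + indicator {?u..} s"
      using AE_\<nu>
    proof eventually_elim
      fix s :: real assume s: "s \<in> {0..<1}"
      show "s powr (M * x) \<le> exp (- ((M - 1) / 2)) * s powr x + indicator {?u..} s"
      proof (cases "?u \<le> s")
        case True
        have "s powr (M * x) \<le> 1" using s x M by (intro powr_le1) auto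
        moreover have "0 \<le> exp (- ((M - 1) / 2)) * s powr x" by simp
        ultimately have "s powr (M * x) \<le> exp (- ((M - 1) / 2)) * s powr x + 1" by linarith
        then show ?thesis using True by (simp add: indicator_def)
      next
        case False
        have "s powr (M * x) = s powr ((M - 1) * x) * s powr x" by (simp add: algebra_simps flip: powr_add)
        also have "s powr ((M - 1) * x) \<le> ?u powr ((M - 1) * x)" using s False x M by (intro powr_mono2) auto
        also have "\<dots> \<le> exp (- (1 / (2 * x)) * ((M - 1) * x))"
          using x M by (intro one_minus_powr_le_exp) (auto simp: field_simps)
        also have "- (1 / (2 * x)) * ((M - 1) * x) = - ((M - 1) / 2)" using x by (simp add: field_simps)
        finally show ?thesis using False by (simp add: mult_right_mono)
      qed
    qed
  qed
  also have "\<dots> = exp (- ((M - 1) / 2)) * mom x + hat ?u"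
    using x u by (subst Bochner_Integration.integral_add)
      (auto simp: mom_eq hat_eq integrable_\<nu>_powr intro!: integrable_\<nu>_bounded[where B=1] split: split_indicator)
  finally show ?thesis .
qed

lemma mom_doubling_iterate:
  assumes "K \<ge> 0" "\<And>x. x \<ge> b \<Longrightarrow> mom x \<le> K * mom (a * x)" "a \<ge> 1" "x \<ge> b" "x \<ge> 0"
  shows "mom x \<le> K ^ j * mom (a ^ j * x)"
proof (induction j)
  case (Suc j)
  have "1 * x \<le> a ^ j * x" using assms by (intro mult_right_mono) auto
  then have "mom (a ^ j * x) \<le> K * mom (a * (a ^ j * x))" using assms by (intro assms(2)) auto
  then have "K ^ j * mom (a ^ j * x) \<le> K ^ j * (K * mom (a * (a ^ j * x)))" using assms by (intro mult_left_mono) auto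
  then show ?case using Suc by (simp add: mult_ac)
qed auto

text \<open>Doubling \<open>j\<close> times and applying \<open>mom_le_mom_hat\<close> with
  \<open>M = 2 ^ j\<close> leaves at most half of \<open>mom x\<close> on the right, which is
  absorbed. The radius \<open>1 - 1 / (2 * x)\<close> lies halfway between \<open>1 - 1 / x\<close>
  and the boundary, as doubling of tails demands.\<close>

lemma mom_doubling_hat:
  assumes "mom_doubling"
  obtains K where "K \<ge> 1" "\<And>x. x \<ge> 1 \<Longrightarrow> mom x \<le> K * hat (1 - 1 / (2 * x))"
proof -
  obtain K where K: "K \<ge> 1" "\<And>x. x \<ge> 1 \<Longrightarrow> mom x \<le> K * mom (2 * x)"
    using assms by (auto simp: mom_doubling_def)
  obtain j where j: "K ^ j * exp (- ((2 ^ j - 1) / 2)) \<le> 1 / 2"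
    using exists_power_exp_small[of K] K by auto
  show thesis
  proof (rule that)
    show "1 \<le> 2 * K ^ j" using one_le_power[OF K(1), of j] by linarith
    fix x :: real assume x: "x \<ge> 1"
    have it: "mom x \<le> K ^ j * mom (2 ^ j * x)" using K x by (intro mom_doubling_iterate[where b=1]) auto
    have "mom (2 ^ j * x) \<le> exp (- ((2 ^ j - 1) / 2)) * mom x + hat (1 - 1 / (2 * x))"
      using x by (intro mom_le_mom_hat) auto
    then have "K ^ j * mom (2 ^ j * x) \<le> K ^ j * (exp (- ((2 ^ j - 1) / 2)) * mom x + hat (1 - 1 / (2 * x)))"
      using K by (intro mult_left_mono) auto
    also have "\<dots> = (K ^ j * exp (- ((2 ^ j - 1) / 2))) * mom x + K ^ j * hat (1 - 1 / (2 * x))"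
      by (simp add: algebra_simps)
    also have "\<dots> \<le> 1 / 2 * mom x + K ^ j * hat (1 - 1 / (2 * x))"
      using j x mom_pos[of x] by (intro add_right_mono mult_right_mono) auto
    finally show "mom x \<le> 2 * K ^ j * hat (1 - 1 / (2 * x))" using it by simp
  qed
qed

lemma mom_doubling_imp_D_hat:
  assumes "mom_doubling"
  shows "\<omega> \<in> class_D_hat"
proof -
  obtain K where K: "K \<ge> 1" "\<And>x. x \<ge> 1 \<Longrightarrow> mom x \<le> K * hat (1 - 1 / (2 * x))"
    using mom_doubling_hat[OF assms] by blast
  \<comment> \<open>The second entry handles \<open>r < 1/2\<close>, where
    \<open>1 / (1 - r)\<close> is below 2 and \<open>mom_ge_hat_exp\<close> does not apply.\<close>
  define C where "C = max (exp 2 * K) (hat 0 / hat (3/4))"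
  have e: "1 \<le> exp (2::real)" by simp
  have "1 * 1 \<le> exp 2 * K" by (rule mult_mono) (use e K in auto)
  then have C1: "C \<ge> 1" unfolding C_def by linarith
  have "hat r \<le> C * hat ((1 + r) / 2)" if r: "0 \<le> r" "r < 1" for r
  proof (cases "r < 1/2")
    case True
    have p: "hat (3/4) > 0" "hat ((1 + r) / 2) > 0" using r by (auto intro!: hat_pos)
    have "hat r \<le> hat 0" using r by (intro hat_mono) auto
    also have "\<dots> = hat 0 / hat (3/4) * hat (3/4)" using p by simp
    also have "\<dots> \<le> C * hat (3/4)" unfolding C_def by (intro mult_right_mono) (use p in auto)
    also have "\<dots> \<le> C * hat ((1 + r) / 2)" using True r C1 by (intro mult_left_mono hat_mono) auto
    finally show ?thesis .
  next
    case False
    define x where "x = 1 / (1 - r)"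
    have x: "x \<ge> 2" "1 - 1 / x = r" "1 - 1 / (2 * x) = (1 + r) / 2" using False r by (auto simp: x_def field_simps)
    have "hat r = exp 2 * (exp (-2) * hat r)" by (simp add: exp_minus)
    also have "\<dots> \<le> exp 2 * mom x" using mom_ge_hat_exp[of x] x by simp
    also have "\<dots> \<le> exp 2 * (K * hat ((1 + r) / 2))" using K(2)[of x] x by simp
    also have "\<dots> = (exp 2 * K) * hat ((1 + r) / 2)" by simp
    also have "\<dots> \<le> C * hat ((1 + r) / 2)" unfolding C_def using hat_pos[of "(1+r)/2"] r by (intro mult_right_mono) auto
    finally show ?thesis .
  qed
  then show ?thesis using C1 radial_weight by (auto simp: class_D_hat_def)
qed

text \<open>If tails decayed too slowly, the moments at \<open>2 * N + 1\<close> and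
  \<open>2 * k * N + 1\<close> would be comparable, against the factor \<open>ln k\<close>. Doubling
  makes tails and moments comparable, so one fixed \<open>k\<close> with \<open>ln k\<close> large
  halves every tail.\<close>

lemma mom_log_imp_class_D:
  assumes "mom_doubling" 
    and L: "\<And>N k::nat. N \<ge> 1 \<Longrightarrow> k \<ge> 2 \<Longrightarrow> ln (real k) * mom (2 * real k * real N + 1) \<le> C * mom (2 * real N + 1)"
  shows "\<omega> \<in> class_D"
proof -
  obtain K where K: "K \<ge> 1" "\<And>x. x \<ge> 1 \<Longrightarrow> mom x \<le> K * hat (1 - 1 / (2 * x))"
    using mom_doubling_hat[OF assms(1)] by blast
  define C' where "C' = max C 1"
  \<comment> \<open>The factors are the losses along the chain below: \<open>exp 2\<close> from tail
    to moment, \<open>K\<close> from moment to tail, \<open>C'\<close> from the hypothesis, and 2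
    for the desired ratio.\<close>
  define T where "T = 2 * exp 2 * C' * K"
  have C': "C' \<ge> 1" "C \<le> C'" by (auto simp: C'_def)
  obtain k :: nat where k: "real k \<ge> exp T" "k \<ge> 2"
    by (metis max.cobounded1 max.cobounded2 nat_ceiling_le_eq order_trans linorder_le_cases of_nat_le_iff)
  have lnk: "ln (real k) \<ge> T" using k by (metis exp_gt_zero ln_exp ln_mono)
  \<comment> \<open>\<open>N\<close> is an integer between \<open>x\<close> and
    \<open>2 * x\<close>, so \<open>2 * k * N + 1 \<le> 5 * k * x\<close>. This is the source of the
    5.\<close>
  have "hat r \<ge> 2 * hat (1 - (1 - r) / (5 * real k))" if r: "0 < r" "r < 1" for r
  proof -
    define x where "x = 1 / (1 - r)"
    define N where "N = nat \<lceil>x\<rceil>"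
    have x: "x \<ge> 1" "1 - 1 / x = r" "1 - r = 1 / x" using r by (auto simp: x_def field_simps)
    have N: "real N \<ge> x" "real N \<le> 2 * x" "N \<ge> 1" using x(1) unfolding N_def by linarith+
    have kN: "2 * real k * real N + 1 \<le> 5 * real k * x"
    proof -
      have "real k * real N \<le> real k * (2 * x)" using N by (intro mult_left_mono) auto
      moreover have "1 * 1 \<le> real k * x" using k x by (intro mult_mono) auto
      ultimately show ?thesis by linarith
    qed
    have kN2: "2 * real k * real N + 1 \<ge> 2"
    proof -
      have "1 * 1 \<le> real k * real N" using k N by (intro mult_mono) auto
      then show ?thesis by linarith
    qed
    let ?m1 = "mom (2 * real N + 1)" and ?m2 = "mom (2 * real k * real N + 1)"
    have pos: "?m1 > 0" "?m2 > 0" by (auto intro!: mom_pos)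
    have "2 * hat (1 - (1 - r) / (5 * real k)) = 2 * hat (1 - 1 / (5 * real k * x))"
      by (simp add: x(3) mult.commute)
    also have "\<dots> \<le> 2 * hat (1 - 1 / (2 * real k * real N + 1))"
      using kN kN2 by (intro mult_left_mono hat_mono) (auto intro!: divide_left_mono mult_pos_pos simp: field_simps)
    also have "\<dots> = 2 * exp 2 * (exp (-2) * hat (1 - 1 / (2 * real k * real N + 1)))" by (simp add: exp_minus)
    also have "\<dots> \<le> 2 * exp 2 * ?m2" using mom_ge_hat_exp[OF kN2] by (intro mult_left_mono) auto
    also have "\<dots> \<le> ?m1 / K"
    proof -
      have "T * ?m2 \<le> ln k * ?m2" using lnk pos by (intro mult_right_mono) auto
      also have "\<dots> \<le> C * ?m1" using L[OF N(3) k(2)] .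
      also have "\<dots> \<le> C' * ?m1" using C' pos by (intro mult_right_mono) auto
      finally have "C' * (2 * exp 2 * K * ?m2) \<le> C' * ?m1" by (simp add: T_def mult_ac)
      then have "2 * exp 2 * K * ?m2 \<le> ?m1" using C' by simp
      then show ?thesis using K(1) by (simp add: field_simps)
    qed
    also have "\<dots> \<le> hat (1 - 1 / (2 * (2 * real N + 1)))"
      using K(2)[of "2 * real N + 1"] K(1) by (simp add: field_simps)
    also have "\<dots> \<le> hat r" unfolding x(2)[symmetric] using x N
      by (intro hat_mono) (auto intro!: divide_left_mono simp: field_simps)
    finally show ?thesis .
  qed
  moreover have "5 * real k > 1" using k by auto
  ultimately show ?thesis using mom_doubling_imp_D_hat[OF assms(1)]
    unfolding class_D_def by (intro CollectI conjI exI[of _ "2::real"] exI[of _ "5 * real k"]) auto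
qed

text \<open>Any factor \<open>a > 1\<close> and any starting point will do: some power of
  \<open>a\<close> is at least 2, and on the bounded range left over the moments lie between
  positive constants.\<close>

lemma mom_doublingI:
  assumes a: "a > 1" and r: "\<And>x. x \<ge> b \<Longrightarrow> mom x \<le> K * mom (a * x)"
  shows "mom_doubling"
proof -
  define x1 where "x1 = max b 1"
  define K1 where "K1 = max K 1"
  obtain j where j: "2 \<le> a ^ j" using real_arch_pow[OF a, of 2] by (auto intro: less_imp_le)
  define K2 where "K2 = max (K1 ^ j) (mom 1 / mom (2 * x1))"
  have K1: "K1 ^ j \<ge> 1" by (simp add: K1_def)
  have "mom x \<le> K2 * mom (2 * x)" if x: "x \<ge> 1" for x
  proof (cases "x \<ge> x1")
    case True
    have "mom x \<le> K1 ^ j * mom (a ^ j * x)"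
    proof (rule mom_doubling_iterate[where b=x1])
      fix y assume y: "y \<ge> x1"
      then have "mom y \<le> K * mom (a * y)" by (intro r) (auto simp: x1_def)
      also have "\<dots> \<le> K1 * mom (a * y)" using mom_pos[of "a * y"] y a
        by (intro mult_right_mono) (auto simp: K1_def x1_def)
      finally show "mom y \<le> K1 * mom (a * y)" .
    qed (use a True x in \<open>auto simp: K1_def\<close>)
    also have "\<dots> \<le> K1 ^ j * mom (2 * x)" using j x K1 by (intro mult_left_mono mom_mono mult_right_mono) auto
    also have "\<dots> \<le> K2 * mom (2 * x)" unfolding K2_def using mom_pos[of "2*x"] x by (intro mult_right_mono) auto
    finally show ?thesis .
  next
    case False
    have p: "mom (2 * x1) > 0" by (intro mom_pos) (auto simp: x1_def)
    have "mom x \<le> mom 1" using x by (intro mom_mono) auto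
    also have "\<dots> = mom 1 / mom (2 * x1) * mom (2 * x1)" using p by simp
    also have "\<dots> \<le> K2 * mom (2 * x1)" unfolding K2_def using p by (intro mult_right_mono) auto
    also have "\<dots> \<le> K2 * mom (2 * x)" using False x K1 by (intro mult_left_mono mom_mono) (auto simp: K2_def)
    finally show ?thesis .
  qed
  moreover have "K2 \<ge> 1" using K1 by (auto simp: K2_def)
  ultimately show ?thesis by (auto simp: mom_doubling_def)
qed

text \<open>Hoelder's inequality, obtained from the pointwise inequality of Young after dividing
  both powers by their moments.\<close>

lemma convex_ln_mom: "convex_on {0..} (\<lambda>x. ln (mom x))"
proof (rule convex_onI)
  fix t x y :: real
  assume t: "0 < t" "t < 1" and xy: "x \<in> {0..}" "y \<in> {0..}"
  let ?z = "(1 - t) * x + t * y"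
  let ?c = "mom x powr (1 - t) * mom y powr t"
  have z: "?z \<ge> 0" using t xy by simp
  have px: "mom x > 0" "mom y > 0" "mom ?z > 0" using xy z by (auto intro!: mom_pos)
  have "(LINT r|\<nu>. r powr ?z / ?c) \<le> (LINT r|\<nu>. (1 - t) * (r powr x / mom x) + t * (r powr y / mom y))"
  proof (rule integral_mono_AE)
    show "AE r in \<nu>. r powr ?z / ?c \<le> (1 - t) * (r powr x / mom x) + t * (r powr y / mom y)"
      using AE_\<nu>
    proof eventually_elim
      fix r :: real assume r: "r \<in> {0..<1}"
      show "r powr ?z / ?c \<le> (1 - t) * (r powr x / mom x) + t * (r powr y / mom y)"
      proof (cases "r = 0")
        case False
        have "(r powr x / mom x) powr (1 - t) * (r powr y / mom y) powr t \<le> (1 - t) * (r powr x / mom x) + t * (r powr y / mom y)"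
          using r False px t by (intro Youngs_inequality_0) auto
        moreover have "(r powr x / mom x) powr (1 - t) * (r powr y / mom y) powr t = r powr ?z / ?c"
          using r px by (simp add: powr_divide powr_powr powr_add mult.commute)
        ultimately show ?thesis by simp
      qed (use px t in \<open>simp add: divide_nonneg_pos\<close>)
    qed
    show "integrable \<nu> (\<lambda>r. (1 - t) * (r powr x / mom x) + t * (r powr y / mom y))"
      using xy by (intro Bochner_Integration.integrable_add integrable_mult_right integrable_divide integrable_\<nu>_powr) auto
  qed (use z in \<open>auto intro!: integrable_\<nu>_powr\<close>)
  also have "\<dots> = 1"
    using px xy by (subst Bochner_Integration.integral_add) (auto intro!: integrable_\<nu>_powr simp flip: mom_eq)
  finally have "mom ?z \<le> ?c" using px by (simp add: divide_le_eq flip: mom_eq)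
  then have "ln (mom ?z) \<le> ln ?c" using px by simp
  also have "\<dots> = (1 - t) * ln (mom x) + t * ln (mom y)" using px by (simp add: ln_mult ln_powr)
  finally show "ln (mom ((1 - t) *\<^sub>R x + t *\<^sub>R y)) \<le> (1 - t) * ln (mom x) + t * ln (mom y)" by simp
qed auto

text \<open>Convexity makes the decrement \<open>e y = L y - L (y + 1)\<close> decreasing. With
  \<open>x\<close> a suitable multiple of \<open>n\<close>, the hypothesis bounds \<open>e\<close>
  at \<open>2 * n + 1\<close> by \<open>K / n\<close> plus \<open>e\<close> at a larger multiple of
  \<open>n\<close>. Iterating outwards, where \<open>e\<close> vanishes in the limit, yields
  \<open>e (2 * n + 1) \<le> K' / n\<close>, which is doubling.\<close>

lemma mom_doubling_from_convexity:
  assumes q: "q > 2"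
    and I: "\<And>n x. n \<ge> 1 \<Longrightarrow> 0 \<le> x \<Longrightarrow> x < real n \<Longrightarrow>
      ln (mom (real n + x + 1)) - ln (mom (2 * real n + 1)) \<le> C + (ln (mom (q * x + 1)) - ln (mom (q * real n + 1))) / q"
  shows "mom_doubling"
proof -
  define L where "L = (\<lambda>x. ln (mom x))"
  define e where "e = (\<lambda>y. L y - L (y + 1))"
  have conv: "convex_on {0..} L" unfolding L_def by (rule convex_ln_mom)
  have slope: "(L c - L d) / (d - c) \<le> (L a - L b) / (b - a)" if "0 \<le> a" "a < b" "c < d" "a \<le> c" "b \<le> d" for a b c d
  proof -
    have "(L b - L a) / (b - a) \<le> (L d - L c) / (d - c)"
      using that by (intro convex_slope_mono[OF conv]) auto
    then show ?thesis by (simp add: diff_divide_distrib)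
  qed
  have e_anti: "e z \<le> e y" if "0 \<le> y" "y \<le> z" for y z
    using slope[of y "y + 1" z "z + 1"] that by (simp add: e_def)
  \<comment> \<open>Moments do not decay exponentially: the positive tail at
    \<open>exp (- \<epsilon> / 2)\<close> bounds \<open>L n\<close> below by
    \<open>- (\<epsilon> / 2) * n\<close> up to a constant, while the \<open>n\<close> decrements
    before \<open>n\<close> sum to at least \<open>n * e n\<close>.\<close>
  have e_small: "\<exists>n0. \<forall>n\<ge>n0. e (real n) \<le> \<epsilon>" if \<epsilon>: "\<epsilon> > 0" for \<epsilon>
  proof -
    define r where "r = exp (- \<epsilon> / 2)"
    have r: "0 < r" "r < 1" "ln r = - \<epsilon> / 2" using \<epsilon> by (auto simp: r_def)
    have hr: "hat r > 0" using r by (intro hat_pos) auto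
    have lower: "L (real n) \<ge> - (\<epsilon> / 2) * real n + ln (hat r)" for n
    proof -
      have "ln (r powr real n * hat r) \<le> L (real n)"
        unfolding L_def using r hr mom_ge_hat[of "real n" r] mom_pos[of "real n"] by (subst ln_le_cancel_iff) auto
      moreover have "ln (r powr real n * hat r) = - (\<epsilon> / 2) * real n + ln (hat r)"
        using r hr by (simp add: ln_mult ln_powr)
      ultimately show ?thesis by simp
    qed
    have upper: "real n * e (real n) \<le> L 0 - L (real n)" for n
    proof -
      have "(\<Sum>i<n. e (real n)) \<le> (\<Sum>i<n. e (real i))" by (intro sum_mono e_anti) auto
      also have "\<dots> = L 0 - L (real n)"
        by (induction n) (auto simp: e_def add.commute)
      finally show ?thesis by simp
    qed
    obtain n0 :: nat where n0: "real n0 \<ge> 2 * (L 0 - ln (hat r)) / \<epsilon>" using real_arch_simple by blast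
    show ?thesis
    proof (intro exI allI impI)
      fix n assume n: "n \<ge> max n0 1"
      have "2 * (L 0 - ln (hat r)) / \<epsilon> \<le> real n" using n n0 by linarith
      then have "L 0 - ln (hat r) \<le> \<epsilon> / 2 * real n" using \<epsilon> by (simp add: field_simps)
      then have "real n * e (real n) \<le> real n * \<epsilon>" using upper[of n] lower[of n] by (simp add: field_simps)
      then show "e (real n) \<le> \<epsilon>" using n by simp
    qed
  qed
  \<comment> \<open>Any value strictly between \<open>2 / q\<close> and 1 works, and there is one
    because \<open>q > 2\<close>. \<open>\<theta> < 1\<close> keeps \<open>n - \<theta> * n\<close>
    proportional to \<open>n\<close>, and \<open>q * \<theta> > 2\<close> sends the argument
    \<open>2 * n\<close> further out. \<tau> is kept below \<sigma> to absorb rounding to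
    integers.\<close>
  define \<theta> where "\<theta> = (1 + 2 / q) / 2"
  define \<sigma> where "\<sigma> = q * \<theta> / 2"
  define \<tau> where "\<tau> = (1 + \<sigma>) / 2"
  have th: "0 < \<theta>" "\<theta> < 1" "\<sigma> > 1" "\<tau> > 1" "\<tau> < \<sigma>" using q by (auto simp: \<theta>_def \<sigma>_def \<tau>_def field_simps)
  define K where "K = \<bar>C\<bar> / (1 - \<theta>)"
  have K0: "K \<ge> 0" using th by (auto simp: K_def)
  obtain n0 :: nat where n0: "real n0 \<ge> 3 / (\<sigma> - 1)" using real_arch_simple by blast
  \<comment> \<open>Convexity bounds the decrement at \<open>2 * n + 1\<close> by the mean slope to
    its left. The hypothesis trades this for the mean slope between
    \<open>q * \<theta> * n + 1\<close> and \<open>q * n + 1\<close>, which convexity bounds by the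
    decrement at \<open>q * \<theta> * n\<close>.\<close>
  have step: "\<exists>n'. \<tau> * real n \<le> real n' \<and> e (2 * real n + 1) \<le> K / real n + e (2 * real n' + 1)"
    if n: "n \<ge> max n0 1" for n
  proof -
    have np: "real n > 0" using n by auto
    let ?x = "\<theta> * real n"
    have x: "0 \<le> ?x" "?x < real n" using th np by auto
    have "e (2 * real n + 1) \<le> (L (real n + ?x + 1) - L (2 * real n + 1)) / (real n - ?x)"
      using slope[of "real n + ?x + 1" "2 * real n + 1" "2 * real n + 1" "2 * real n + 1 + 1"] x th by (simp add: e_def algebra_simps)
    also have "\<dots> \<le> (C + (L (q * ?x + 1) - L (q * real n + 1)) / q) / (real n - ?x)"
      using I[of n ?x] x n th unfolding L_def by (intro divide_right_mono) auto
    also have "\<dots> = C / (real n - ?x) + (L (q * ?x + 1) - L (q * real n + 1)) / (q * real n + 1 - (q * ?x + 1))"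
      using q x by (simp add: add_divide_distrib right_diff_distrib)
    also have "\<dots> \<le> K / real n + e (q * ?x)"
    proof (rule add_mono)
      show "(L (q * ?x + 1) - L (q * real n + 1)) / (q * real n + 1 - (q * ?x + 1)) \<le> e (q * ?x)"
        using slope[of "q * ?x" "q * ?x + 1" "q * ?x + 1" "q * real n + 1"] x q th by (simp add: e_def)
      have "C / (real n - ?x) \<le> \<bar>C\<bar> / (real n - ?x)" using x th by (intro divide_right_mono) auto
      also have "\<dots> = K / real n" unfolding K_def divide_divide_eq_left by (simp add: left_diff_distrib)
      finally show "C / (real n - ?x) \<le> K / real n" .
    qed
    finally have 1: "e (2 * real n + 1) \<le> K / real n + e (q * ?x)" .
    define n' where "n' = nat \<lfloor>\<sigma> * real n - 1 / 2\<rfloor>"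
    have "3 / (\<sigma> - 1) \<le> real n" using n0 n by linarith
    then have 3: "3 \<le> (\<sigma> - 1) * real n" using th by (simp add: field_simps)
    have pos: "\<sigma> * real n - 1 / 2 \<ge> 0"
    proof -
      have "1 * 1 \<le> \<sigma> * real n" using th n by (intro mult_mono) auto
      then show ?thesis by simp
    qed
    have n': "real n' \<le> \<sigma> * real n - 1 / 2" "real n' \<ge> \<sigma> * real n - 3 / 2"
      using pos unfolding n'_def by linarith+
    have "2 * (\<tau> * real n) = real n + \<sigma> * real n" by (simp add: \<tau>_def algebra_simps)
    then have "\<tau> * real n \<le> real n'" using 3 n' by (simp add: algebra_simps)
    moreover have "e (q * ?x) \<le> e (2 * real n' + 1)"
    proof (rule e_anti)
      have "q * ?x = 2 * (\<sigma> * real n)" by (simp add: \<sigma>_def)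
      then show "2 * real n' + 1 \<le> q * ?x" using n' by linarith
    qed auto
    ultimately show ?thesis using 1 by (intro exI[of _ n']) auto
  qed
  \<comment> \<open>The solution of \<open>K + K' / \<tau> = K'\<close>: each step multiplies
    \<open>n\<close> by at least \<tau>, so the errors \<open>K / n\<close> form a geometric
    series.\<close>
  define K' where "K' = K / (1 - 1 / \<tau>)"
  have t1: "1 / \<tau> < 1" using th by simp
  have K': "K' \<ge> 0" "K + K' / \<tau> = K'"
    using K0 t1 th by (auto simp: K'_def) (simp add: field_simps)
  have iter: "e (2 * real n + 1) \<le> K' / real n + e (2 * real N + 1)" if "n \<ge> max n0 1" for n N
    using that
  proof (induction "N - n" arbitrary: n rule: less_induct)
    case less
    show ?case
    proof (cases "n \<ge> N")
      case True
      then have "e (2 * real n + 1) \<le> e (2 * real N + 1)" by (intro e_anti) auto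
      then show ?thesis using K' by (simp add: add_increasing)
    next
      case False
      obtain n' where n': "\<tau> * real n \<le> real n'" "e (2 * real n + 1) \<le> K / real n + e (2 * real n' + 1)"
        using step[OF less.prems] by blast
      have np: "real n > 0" using less.prems by auto
      have "1 * real n < \<tau> * real n" using th np by (intro mult_strict_right_mono) auto
      then have nn': "n < n'" using n' by simp
      have "e (2 * real n' + 1) \<le> K' / real n' + e (2 * real N + 1)"
        using nn' False less.prems by (intro less.hyps) auto
      moreover have "K' / real n' \<le> K' / (\<tau> * real n)" using n' np nn' th K' by (intro divide_left_mono) auto
      ultimately have "e (2 * real n' + 1) \<le> K' / (\<tau> * real n) + e (2 * real N + 1)" by linarith
      then have "e (2 * real n + 1) \<le> (K + K' / \<tau>) / real n + e (2 * real N + 1)"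
        using n'(2) by (simp add: add_divide_distrib)
      then show ?thesis by (simp add: K')
    qed
  qed
  have e_bound: "e (2 * real n + 1) \<le> K' / real n" if n: "n \<ge> max n0 1" for n
  proof (rule field_le_epsilon)
    fix \<epsilon> :: real assume "\<epsilon> > 0"
    then obtain N0 where N0: "\<forall>n\<ge>N0. e (real n) \<le> \<epsilon>" using e_small by blast
    have "e (2 * real N0 + 1) \<le> \<epsilon>" using N0[rule_format, of "2 * N0 + 1"] by (simp add: algebra_simps)
    then show "e (2 * real n + 1) \<le> K' / real n + \<epsilon>" using iter[OF n, of N0] by linarith
  qed
  \<comment> \<open>From \<open>2 * n + 1\<close> to \<open>4 * n + 2\<close> the logarithm drops by
    at most \<open>2 * n + 1\<close> times the first decrement, hence by a bounded amount.\<close>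
  have dbl: "mom (2 * real n + 1) \<le> exp (3 * K') * mom (4 * real n + 2)" if n: "n \<ge> max n0 1" for n
  proof -
    have np: "real n \<ge> 1" using n by auto
    have "(L (2 * real n + 1) - L (4 * real n + 2)) / (4 * real n + 2 - (2 * real n + 1)) \<le> e (2 * real n + 1)"
      using slope[of "2 * real n + 1" "2 * real n + 1 + 1" "2 * real n + 1" "4 * real n + 2"] np by (simp add: e_def)
    also have "\<dots> \<le> K' / real n" by (rule e_bound[OF n])
    finally have "L (2 * real n + 1) - L (4 * real n + 2) \<le> K' / real n * (2 * real n + 1)"
      by (simp add: divide_le_eq)
    also have "\<dots> = K' * (2 + 1 / real n)" using np by (simp add: field_simps)
    also have "\<dots> \<le> K' * 3" using np K' by (intro mult_left_mono) auto
    finally have "exp (L (2 * real n + 1)) \<le> exp (3 * K' + L (4 * real n + 2))" by simp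
    then show ?thesis unfolding L_def exp_add
      using mom_pos[of "2 * real n + 1"] mom_pos[of "4 * real n + 2"] by simp
  qed
  show ?thesis
  \<comment> \<open>The 6/5 leaves room for rounding: \<open>x \<le> 2 * n + 3\<close> and
    \<open>n \<ge> 1\<close> give \<open>6 / 5 * x \<le> 4 * n + 2\<close>.\<close>
  proof (rule mom_doublingI[where a="6/5"])
    fix x :: real assume x: "x \<ge> real (2 * n0 + 9)"
    define n where "n = nat \<lfloor>(x - 1) / 2\<rfloor>"
    have "x \<ge> 9" using x by simp
    then have "real n = of_int \<lfloor>(x - 1) / 2\<rfloor>" unfolding n_def by simp
    then have "real n \<le> (x - 1) / 2 \<and> (x - 1) / 2 < real n + 1"
      using floor_correct[of "(x - 1) / 2"] by (simp only: of_int_add of_int_1)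
    then have n: "2 * real n + 1 \<le> x" "x \<le> 2 * real n + 3" by (auto simp: field_simps)
    have "real (2 * n0 + 9) \<le> real (2 * n + 3)" using x n by simp
    then have "2 * n0 + 9 \<le> 2 * n + 3" by (simp only: of_nat_le_iff)
    then have nn: "n \<ge> max n0 1" by auto
    have "mom x \<le> mom (2 * real n + 1)" using n by (intro mom_mono) auto
    also have "\<dots> \<le> exp (3 * K') * mom (4 * real n + 2)" by (rule dbl[OF nn])
    also have "\<dots> \<le> exp (3 * K') * mom (6 / 5 * x)" using n x by (intro mult_left_mono mom_mono) auto
    finally show "mom x \<le> exp (3 * K') * mom (6 / 5 * x)" .
  qed auto
qed

text \<open>\<open>mom_sup_bound\<close>, with \<open>2 * j\<close> in the role of \<open>n\<close>,
  bounds \<open>mom (3 * j)\<close> by \<open>3 * C * mom (4 * j + 1)\<close>. For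
  \<open>x \<ge> 30\<close> between \<open>3 * j\<close> and \<open>3 * j + 3\<close> the exponent
  \<open>4 * j + 1\<close> exceeds \<open>6 / 5 * x\<close>.\<close>

lemma mom_doubling_from_hat:
  assumes H: "\<And>n r. n \<ge> 1 \<Longrightarrow> 0 \<le> r \<Longrightarrow> r < 1 \<Longrightarrow> r ^ n * hat r \<le> C * mom (2 * real n + 1)"
  shows "mom_doubling"
proof (rule mom_doublingI[where a="6/5"])
  fix x :: real assume x: "x \<ge> 30"
  define j where "j = nat \<lfloor>x / 3\<rfloor>"
  have "real j = of_int \<lfloor>x / 3\<rfloor>" unfolding j_def using x by simp
  then have j: "3 * real j \<le> x" "x \<le> 3 * real j + 3" using floor_correct[of "x / 3"] by linarith+
  have j1: "j \<ge> 1" using j x by (cases "j = 0") auto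
  have "mom x \<le> mom (real (Suc (3 * j - 1)))" using j j1 by (intro mom_mono) (auto simp: of_nat_diff)
  also have "\<dots> \<le> C * mom (2 * real (2 * j) + 1) * real (Suc (3 * j - 1)) / real (Suc (3 * j - 1) - 2 * j)"
    using j1 by (intro mom_sup_bound H) auto
  also have "\<dots> = 3 * C * mom (2 * real (2 * j) + 1)" using j1 by (simp add: of_nat_diff)
  also have "\<dots> \<le> 3 * C * mom (6 / 5 * x)"
  proof (intro mult_left_mono mom_mono)
    have "0 \<le> (1/2) ^ 1 * hat (1/2)" using hat_pos[of "1/2"] by simp
    also have "\<dots> \<le> C * mom (2 * real 1 + 1)" by (rule H) auto
    finally show "0 \<le> 3 * C" using mom_pos[of "2 * real 1 + 1"] by (simp add: zero_le_mult_iff)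
  qed (use j x in auto)
  finally show "mom x \<le> 3 * C * mom (6 / 5 * x)" .
qed auto

end

section \<open>Necessity\<close>

lemma cnj_measurable [measurable (raw)]:
  "f \<in> borel_measurable M \<Longrightarrow> (\<lambda>x. cnj (f x)) \<in> borel_measurable M"
  by (rule measurable_compose[of f M borel]) (auto intro!: borel_measurable_continuous_onI continuous_intros)

context radial
begin

definition kern_coeff :: "nat \<Rightarrow> real" where "kern_coeff n = 1 / (2 * mom (2 * real n + 1))"

definition kern :: "complex \<Rightarrow> complex" where "kern w = (\<Sum>n. of_real (kern_coeff n) * w ^ n)"

definition kern_abs :: "real \<Rightarrow> real" where "kern_abs x = (\<Sum>n. kern_coeff n * x ^ n)"

lemma bergman_kernel_eq: "bergman_kernel \<omega> z \<zeta> = kern (cnj z * \<zeta>)"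
  unfolding bergman_kernel_def kern_def kern_coeff_def by (intro suminf_cong) simp

lemma kern_coeff_pos: "kern_coeff n > 0"
  by (auto simp: kern_coeff_def intro!: mom_pos)

text \<open>Positive tails at all radii keep the moments from decaying exponentially: for each
  \<open>s < 1\<close>, \<open>mom (2 * n + 1)\<close> is at least a constant times
  \<open>s ^ n\<close>.\<close>

lemma summable_kern_coeff:
  assumes "0 \<le> x" "x < 1" shows "summable (\<lambda>n. kern_coeff n * x ^ n)"
proof -
  define s where "s = (1 + x) / 2"
  define r where "r = sqrt s"
  have s: "0 < s" "s < 1" "x < s" using assms by (auto simp: s_def)
  have r: "0 < r" "r < 1" "r\<^sup>2 = s" using s by (auto simp: r_def)
  have h: "hat r > 0" using r by (intro hat_pos) auto
  show ?thesis
  proof (rule summable_comparison_test'[where N=0])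
    show "summable (\<lambda>n. 1 / (2 * r * hat r) * (x / s) ^ n)"
      using assms s by (intro summable_mult summable_geometric) auto
    fix n :: nat
    have "s ^ n * r * hat r = r powr (2 * real n + 1) * hat r"
    proof -
      have "r powr (2 * real n + 1) = r powr real (2 * n + 1)" by (simp add: add.commute)
      also have "\<dots> = r ^ (2 * n + 1)" using r(1) by (rule powr_realpow)
      also have "\<dots> = s ^ n * r" by (simp add: power_add power_mult r)
      finally show ?thesis by simp
    qed
    also have "\<dots> \<le> mom (2 * real n + 1)" using r by (intro mom_ge_hat) auto
    finally have "2 * (s ^ n * r * hat r) \<le> 2 * mom (2 * real n + 1)" by simp
    moreover have "0 < s ^ n * r * hat r" using s r h by simp
    ultimately have "kern_coeff n \<le> 1 / (2 * (s ^ n * r * hat r))" unfolding kern_coeff_def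
      using s r h mom_pos[of "2 * real n + 1"] by (intro divide_left_mono mult_pos_pos) auto
    then have "kern_coeff n * x ^ n \<le> 1 / (2 * (s ^ n * r * hat r)) * x ^ n" using assms by (intro mult_right_mono) auto
    also have "\<dots> = 1 / (2 * r * hat r) * (x / s) ^ n" by (simp add: power_divide)
    finally show "norm (kern_coeff n * x ^ n) \<le> 1 / (2 * r * hat r) * (x / s) ^ n"
      using assms kern_coeff_pos[of n] by simp
  qed
qed

lemma summable_kern: "norm w < 1 \<Longrightarrow> summable (\<lambda>n. norm (of_real (kern_coeff n) * w ^ n :: complex))"
  using summable_kern_coeff[of "norm w"] by (simp add: norm_mult norm_power abs_of_pos[OF kern_coeff_pos])

lemma norm_kern_le:
  assumes "norm w \<le> x" "x < 1" shows "norm (kern w) \<le> kern_abs x"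
proof -
  have x0: "0 \<le> x" using assms(1) norm_ge_zero order_trans by blast
  have "norm (kern w) \<le> (\<Sum>n. norm (of_real (kern_coeff n) * w ^ n))"
    unfolding kern_def using assms by (intro summable_norm summable_kern) auto
  also have "\<dots> \<le> kern_abs x"
    unfolding kern_abs_def using assms summable_kern[of w] summable_kern_coeff[OF x0 assms(2)] kern_coeff_pos
    by (intro suminf_le) (auto simp: norm_mult norm_power abs_of_pos[OF kern_coeff_pos] less_imp_le intro!: mult_left_mono power_mono)
  finally show ?thesis .
qed

lemma kern_measurable [measurable]: "kern \<in> borel_measurable borel"
  unfolding kern_def by measurable

lemma norm_cnj_mult_le: "\<zeta> \<in> disk \<Longrightarrow> norm (cnj z * \<zeta>) \<le> norm z"
  by (simp add: norm_mult mult_left_le)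

lemma integrable_\<mu>_bounded:
  fixes f :: "complex \<Rightarrow> 'b::{banach, second_countable_topology}"
  assumes "f \<in> borel_measurable borel" "\<And>z. z \<in> disk \<Longrightarrow> norm (f z) \<le> B"
  shows "integrable \<mu> f"
  by (rule M.integrable_const_bound[where B=B]) (use assms in \<open>auto intro!: AE_I2 borel_\<mu>\<close>)

section \<open>Images of radial powers and their Fourier coefficients\<close>

definition powr_proj :: "real \<Rightarrow> complex \<Rightarrow> real" where
  "powr_proj x z = (LINT \<zeta>|\<mu>. norm \<zeta> powr x * norm (kern (cnj z * \<zeta>)))"

lemma norm_powr_le_1: "\<zeta> \<in> disk \<Longrightarrow> x \<ge> 0 \<Longrightarrow> norm \<zeta> powr x \<le> 1"
  by (auto intro!: powr_le1)

lemma integrable_powr_proj: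
  assumes "z \<in> disk" "x \<ge> 0"
  shows "integrable \<mu> (\<lambda>\<zeta>. norm \<zeta> powr x * norm (kern (cnj z * \<zeta>)))"
proof (rule integrable_\<mu>_bounded[where B="1 * kern_abs (norm z)"])
  fix \<zeta> assume \<zeta>: "\<zeta> \<in> disk"
  have "norm \<zeta> powr x * norm (kern (cnj z * \<zeta>)) \<le> 1 * kern_abs (norm z)"
    using norm_powr_le_1[OF \<zeta>] assms norm_kern_le[OF norm_cnj_mult_le[OF \<zeta>], of z] by (intro mult_mono) auto
  then show "norm (norm \<zeta> powr x * norm (kern (cnj z * \<zeta>))) \<le> 1 * kern_abs (norm z)" by simp
qed measurable

lemma max_bergman_projection_powr:
  "max_bergman_projection \<omega> (\<lambda>\<zeta>. of_real (norm \<zeta> powr x)) z = of_real (powr_proj x z)"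
proof -
  have "max_bergman_projection \<omega> (\<lambda>\<zeta>. of_real (norm \<zeta> powr x)) z
    = (LINT \<zeta>|\<mu>. complex_of_real (norm \<zeta> powr x * norm (kern (cnj z * \<zeta>))))"
    by (simp add: max_bergman_projection_def bergman_kernel_eq)
  then show ?thesis unfolding powr_proj_def integral_complex_of_real .
qed

lemma cis_power: "cis a ^ n = cis (real n * a)"
  by (rule Complex.DeMoivre)

text \<open>Phases are taken of \<open>cnj z * \<zeta>\<close>, to match the argument of the kernel.
  For \<open>n \<noteq> m\<close>, rotation by the angle \<open>pi / (n - m)\<close> reverses the
  sign of the integrand.\<close>

lemma phase_integral:
  fixes z :: complex
  assumes z: "z \<noteq> 0" and y: "y \<ge> 0"
  shows "(LINT \<zeta>|\<mu>. of_real (norm \<zeta> powr y) * (sgn (cnj z * \<zeta>) ^ n * cnj (sgn (cnj z * \<zeta>)) ^ m))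
    = of_real (if n = m then 2 * mom (y + 1) else 0)"
proof (cases "n = m")
  case True
  have "(of_real (norm \<zeta> powr y) * (sgn (cnj z * \<zeta>) ^ n * cnj (sgn (cnj z * \<zeta>)) ^ m) :: complex) = of_real (norm \<zeta> powr y)" for \<zeta>
  proof (cases "\<zeta> = 0")
    case False
    then have "norm (sgn (cnj z * \<zeta>)) = 1" using z by (simp add: norm_sgn)
    then have "sgn (cnj z * \<zeta>) * cnj (sgn (cnj z * \<zeta>)) = 1" by (simp add: complex_norm_square[symmetric])
    then show ?thesis by (simp add: True flip: power_mult_distrib)
  qed simp
  then have "(LINT \<zeta>|\<mu>. of_real (norm \<zeta> powr y) * (sgn (cnj z * \<zeta>) ^ n * cnj (sgn (cnj z * \<zeta>)) ^ m))
    = (LINT \<zeta>|\<mu>. complex_of_real (norm \<zeta> powr y))" by (simp only:)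
  also have "\<dots> = of_real (2 * mom (y + 1))"
    unfolding integral_complex_of_real has_bochner_integral_integral_eq[OF has_bochner_integral_powr[OF y]] ..
  finally show ?thesis using True by (simp only: if_True refl)
next
  case False
  define f where "f = (\<lambda>\<zeta>. (of_real (norm \<zeta> powr y) * (sgn (cnj z * \<zeta>) ^ n * cnj (sgn (cnj z * \<zeta>)) ^ m)) :: complex)"
  define a where "a = pi / (real n - real m)"
  define c where "c = cis a"
  have "(real n - real m) * a = pi" using False by (simp add: a_def)
  then have a: "real n * a - real m * a = pi" by (simp add: left_diff_distrib)
  have "c ^ n * cnj c ^ m = cis (real n * a - real m * a)"
    unfolding c_def cis_cnj cis_power cis_mult by simp
  then have cc: "c ^ n * cnj c ^ m = -1" unfolding a by simp
  have nc: "norm c = 1" by (simp add: c_def)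
  have sc: "sgn c = c" by (simp add: sgn_eq c_def)
  have fm: "f \<in> borel_measurable borel" unfolding f_def sgn_eq by measurable
  have "f (c * \<zeta>) = (c ^ n * cnj c ^ m) * f \<zeta>" for \<zeta>
    unfolding f_def mult.left_commute[of "cnj z" c] sgn_mult[of c] sc by (simp add: norm_mult nc power_mult_distrib)
  then have fc: "f (c * \<zeta>) = - f \<zeta>" for \<zeta> by (simp add: cc)
  have "(LINT \<zeta>|\<mu>. f \<zeta>) = (LINT \<zeta>|\<mu>. f (c * \<zeta>))" by (rule integral_\<mu>_rotation[OF nc fm, symmetric])
  also have "\<dots> = - (LINT \<zeta>|\<mu>. f \<zeta>)" by (simp add: fc)
  finally have "(LINT \<zeta>|\<mu>. f \<zeta>) = 0" by simp
  then show ?thesis using False by (simp add: f_def)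
qed

lemma sgn_cnj_measurable [measurable]: "(\<lambda>\<zeta>. sgn (cnj z * \<zeta>)) \<in> borel_measurable borel"
  unfolding sgn_eq by measurable

lemma norm_phase_le: "norm (sgn w ^ k * cnj (sgn w) ^ m :: complex) \<le> 1"
  by (simp add: norm_mult norm_power norm_sgn power_0_left)

text \<open>In the expansion of the kernel only the term of index \<open>m - k\<close> survives
  orthogonality. For \<open>k > m\<close> there is none, because the kernel has no negative
  frequencies.\<close>

lemma kern_phase_integral:
  fixes z :: complex
  assumes z: "z \<in> disk" "z \<noteq> 0" and x: "x \<ge> 0"
  shows "(LINT \<zeta>|\<mu>. of_real (norm \<zeta> powr x) * (sgn (cnj z * \<zeta>) ^ k * cnj (sgn (cnj z * \<zeta>)) ^ m) * kern (cnj z * \<zeta>))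
    = of_real (if k \<le> m then norm z ^ (m - k) * mom (x + real (m - k) + 1) / mom (2 * real (m - k) + 1) else 0)"
proof -
  define g where "g = (\<lambda>n \<zeta>. (of_real (norm \<zeta> powr (x + real n)) * (sgn (cnj z * \<zeta>) ^ (n + k) * cnj (sgn (cnj z * \<zeta>)) ^ m)) :: complex)"
  define f where "f = (\<lambda>n \<zeta>. of_real (kern_coeff n * norm z ^ n) * g n \<zeta>)"
  have nz: "norm z < 1" using z by simp
  have feq: "of_real (norm \<zeta> powr x) * (sgn (cnj z * \<zeta>) ^ k * cnj (sgn (cnj z * \<zeta>)) ^ m) * (of_real (kern_coeff n) * (cnj z * \<zeta>) ^ n) = f n \<zeta>" for n \<zeta>
  proof (cases "\<zeta> = 0")
    case False
    have "cnj z * \<zeta> = of_real (norm z * norm \<zeta>) * sgn (cnj z * \<zeta>)"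
      using False z by (simp add: sgn_eq norm_mult)
    then have "(cnj z * \<zeta>) ^ n = of_real (norm z ^ n * norm \<zeta> ^ n) * sgn (cnj z * \<zeta>) ^ n"
      by (metis of_real_power power_mult_distrib)
    moreover have "norm \<zeta> powr (x + real n) = norm \<zeta> powr x * norm \<zeta> ^ n"
      using False by (simp add: powr_add powr_realpow)
    ultimately show ?thesis by (simp add: f_def g_def power_add mult_ac)
  qed (simp add: f_def g_def)
  have gm [measurable]: "g n \<in> borel_measurable borel" for n unfolding g_def by measurable
  have gb: "norm (g n \<zeta>) \<le> 1" if "\<zeta> \<in> disk" for n \<zeta>
  proof -
    have "norm (g n \<zeta>) = norm \<zeta> powr (x + real n) * norm (sgn (cnj z * \<zeta>) ^ (n + k) * cnj (sgn (cnj z * \<zeta>)) ^ m)"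
      by (simp add: g_def norm_mult)
    also have "\<dots> \<le> 1 * 1" using norm_powr_le_1[OF that, of "x + real n"] x norm_phase_le by (intro mult_mono) auto
    finally show ?thesis by simp
  qed
  have gi: "integrable \<mu> (g n)" for n by (rule integrable_\<mu>_bounded[where B=1]) (use gb in auto)
  have fi: "integrable \<mu> (f n)" for n unfolding f_def by (intro integrable_mult_right gi)
  have nf: "norm (f n \<zeta>) \<le> kern_coeff n * norm z ^ n" if "\<zeta> \<in> disk" for n \<zeta>
    using gb[OF that, of n] kern_coeff_pos[of n] by (auto simp: f_def norm_mult norm_power intro!: mult_left_le)
  have "(LINT \<zeta>|\<mu>. of_real (norm \<zeta> powr x) * (sgn (cnj z * \<zeta>) ^ k * cnj (sgn (cnj z * \<zeta>)) ^ m) * kern (cnj z * \<zeta>))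
     = (LINT \<zeta>|\<mu>. (\<Sum>n. f n \<zeta>))"
  proof (rule Bochner_Integration.integral_cong)
    fix \<zeta> assume "\<zeta> \<in> space \<mu>"
    then have "norm (cnj z * \<zeta>) < 1" using norm_cnj_mult_le[of \<zeta> z] nz by simp
    then have "summable (\<lambda>n. of_real (kern_coeff n) * (cnj z * \<zeta>) ^ n)" by (rule summable_norm_cancel[OF summable_kern])
    then have "(\<lambda>n. of_real (norm \<zeta> powr x) * (sgn (cnj z * \<zeta>) ^ k * cnj (sgn (cnj z * \<zeta>)) ^ m) * (of_real (kern_coeff n) * (cnj z * \<zeta>) ^ n)) sums
      (of_real (norm \<zeta> powr x) * (sgn (cnj z * \<zeta>) ^ k * cnj (sgn (cnj z * \<zeta>)) ^ m) * kern (cnj z * \<zeta>))"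
      unfolding kern_def by (intro sums_mult summable_sums)
    then show "of_real (norm \<zeta> powr x) * (sgn (cnj z * \<zeta>) ^ k * cnj (sgn (cnj z * \<zeta>)) ^ m) * kern (cnj z * \<zeta>) = (\<Sum>n. f n \<zeta>)"
      unfolding feq by (rule sums_unique)
  qed simp
  also have "\<dots> = (\<Sum>n. LINT \<zeta>|\<mu>. f n \<zeta>)"
  proof (rule integral_suminf)
    show "AE \<zeta> in \<mu>. summable (\<lambda>n. norm (f n \<zeta>))"
    proof (rule AE_I2)
      fix \<zeta> assume "\<zeta> \<in> space \<mu>"
      then have "\<zeta> \<in> disk" by simp
      then have "norm (norm (f n \<zeta>)) \<le> kern_coeff n * norm z ^ n" for n using nf[of \<zeta> n] by simp
      then show "summable (\<lambda>n. norm (f n \<zeta>))"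
        using summable_comparison_test'[OF summable_kern_coeff[OF norm_ge_zero nz], of 0 "\<lambda>n. norm (f n \<zeta>)"] by blast
    qed
    show "summable (\<lambda>n. LINT \<zeta>|\<mu>. norm (f n \<zeta>))"
    proof (rule summable_comparison_test'[where N=0])
      show "summable (\<lambda>n. kern_coeff n * norm z ^ n * measure \<mu> (space \<mu>))"
        using summable_kern_coeff[of "norm z"] nz by (intro summable_mult2) auto
      fix n
      have "(LINT \<zeta>|\<mu>. norm (f n \<zeta>)) \<le> (LINT \<zeta>|\<mu>. kern_coeff n * norm z ^ n)"
        using nf by (intro integral_mono integrable_norm fi) auto
      then show "norm (LINT \<zeta>|\<mu>. norm (f n \<zeta>)) \<le> kern_coeff n * norm z ^ n * measure \<mu> (space \<mu>)"
        by (simp add: mult_ac)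
    qed
  qed (rule fi)
  also have "\<dots> = (\<Sum>n. of_real (if n + k = m then norm z ^ n * mom (x + real n + 1) / mom (2 * real n + 1) else 0))"
  proof (rule suminf_cong)
    fix n
    have "(LINT \<zeta>|\<mu>. f n \<zeta>) = of_real (kern_coeff n * norm z ^ n) * (LINT \<zeta>|\<mu>. g n \<zeta>)"
      unfolding f_def by (rule integral_mult_right_zero)
    also have "(LINT \<zeta>|\<mu>. g n \<zeta>) = of_real (if n + k = m then 2 * mom (x + real n + 1) else 0)"
      unfolding g_def using x by (intro phase_integral z) auto
    finally show "(LINT \<zeta>|\<mu>. f n \<zeta>) = of_real (if n + k = m then norm z ^ n * mom (x + real n + 1) / mom (2 * real n + 1) else 0)"
      by (simp add: kern_coeff_def)
  qed
  also have "\<dots> = of_real (if k \<le> m then norm z ^ (m - k) * mom (x + real (m - k) + 1) / mom (2 * real (m - k) + 1) else 0)"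
  proof (cases "k \<le> m")
    case True
    then show ?thesis by (subst suminf_finite[of "{m - k}"]) auto
  next
    case False
    then have "(n + k = m) = False" for n by auto
    then show ?thesis using False by simp
  qed
  finally show ?thesis .
qed

definition powr_coeff :: "real \<Rightarrow> complex \<Rightarrow> nat \<Rightarrow> real" where
  "powr_coeff x z m = norm z ^ m * mom (x + real m + 1) / mom (2 * real m + 1)"

lemma powr_coeff_nonneg: "x \<ge> 0 \<Longrightarrow> 0 \<le> powr_coeff x z m"
  unfolding powr_coeff_def using mom_pos[of "x + real m + 1"] mom_pos[of "2 * real m + 1"] by auto

text \<open>The passage from the modulus of the kernel, which is hard to expand, to the kernel
  itself, whose pairings with phases are known.\<close>

lemma powr_proj_ge_of_bounded:
  assumes z: "z \<in> disk" and x: "x \<ge> 0" and g: "g \<in> borel_measurable borel" "\<And>\<zeta>. norm (g \<zeta>) \<le> B"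
  shows "norm (LINT \<zeta>|\<mu>. of_real (norm \<zeta> powr x) * g \<zeta> * kern (cnj z * \<zeta>)) \<le> B * powr_proj x z"
proof -
  note [measurable] = g(1)
  have B0: "B \<ge> 0" using g(2)[of 0] norm_ge_zero order_trans by blast
  have le: "norm (of_real (norm \<zeta> powr x) * g \<zeta> * kern (cnj z * \<zeta>)) \<le> B * (norm \<zeta> powr x * norm (kern (cnj z * \<zeta>)))" for \<zeta>
  proof -
    have "norm (of_real (norm \<zeta> powr x) * g \<zeta> * kern (cnj z * \<zeta>)) = norm (g \<zeta>) * (norm \<zeta> powr x * norm (kern (cnj z * \<zeta>)))"
      by (simp add: norm_mult mult_ac)
    also have "\<dots> \<le> B * (norm \<zeta> powr x * norm (kern (cnj z * \<zeta>)))" using g(2) by (intro mult_right_mono) auto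
    finally show ?thesis .
  qed
  have int: "integrable \<mu> (\<lambda>\<zeta>. B * (norm \<zeta> powr x * norm (kern (cnj z * \<zeta>))))"
    by (intro integrable_mult_right integrable_powr_proj z x)
  have "norm (LINT \<zeta>|\<mu>. of_real (norm \<zeta> powr x) * g \<zeta> * kern (cnj z * \<zeta>))
    \<le> (LINT \<zeta>|\<mu>. norm (of_real (norm \<zeta> powr x) * g \<zeta> * kern (cnj z * \<zeta>)))"
    by (rule integral_norm_bound)
  also have "\<dots> \<le> (LINT \<zeta>|\<mu>. B * (norm \<zeta> powr x * norm (kern (cnj z * \<zeta>))))"
  proof (rule integral_mono[OF _ int le])
    show "integrable \<mu> (\<lambda>\<zeta>. norm (of_real (norm \<zeta> powr x) * g \<zeta> * kern (cnj z * \<zeta>)))"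
    proof (rule Bochner_Integration.integrable_bound[OF int])
      show "AE \<zeta> in \<mu>. norm (norm (of_real (norm \<zeta> powr x) * g \<zeta> * kern (cnj z * \<zeta>))) \<le> norm (B * (norm \<zeta> powr x * norm (kern (cnj z * \<zeta>))))"
        using le B0 by (intro AE_I2) (auto simp: abs_mult)
    qed (rule borel_\<mu>, measurable)
  qed
  also have "\<dots> = B * powr_proj x z" by (simp add: powr_proj_def)
  finally show ?thesis .
qed

text \<open>The factor \<open>cnj (sgn (cnj z * \<zeta>)) ^ m\<close> extracts the coefficient of
  index \<open>m\<close>. At \<open>z = 0\<close> this phase degenerates to
  \<open>sgn 0 = 0\<close>.\<close>

lemma powr_proj_ge_single:
  assumes z: "z \<in> disk" and x: "x \<ge> 0"
  shows "powr_coeff x z m \<le> powr_proj x z \<or> z = 0"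
proof (cases "z = 0")
  case False
  have "of_real (powr_coeff x z m) = (LINT \<zeta>|\<mu>. of_real (norm \<zeta> powr x) * (sgn (cnj z * \<zeta>) ^ 0 * cnj (sgn (cnj z * \<zeta>)) ^ m) * kern (cnj z * \<zeta>))"
    using kern_phase_integral[OF z False x, of 0 m] by (simp add: powr_coeff_def)
  then have "norm (of_real (powr_coeff x z m) :: complex) \<le> 1 * powr_proj x z"
    using norm_phase_le[where k=0] by (simp only:) (intro powr_proj_ge_of_bounded z x, measurable)
  then show ?thesis by (simp add: abs_le_iff)
qed simp

lemma powr_proj_ge_sum:
  assumes z: "z \<in> disk" "z \<noteq> 0" and x: "x \<ge> 0"
  shows "(\<Sum>m=1..M. powr_coeff x z m / real m) \<le> 2 * pi * powr_proj x z"
proof -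
  \<comment> \<open>The damping makes the logarithmic series converge geometrically, uniformly in
    the phase, yet by Bernoulli's inequality \<open>\<rho> ^ m \<ge> 1 / 2\<close> for
    \<open>m \<le> M\<close>. This half, the bound \<open>pi / 2\<close> and the coefficients of
    size \<open>1 / (2 * m)\<close> make up the constant \<open>2 * pi\<close>.\<close>
  define \<rho> where "\<rho> = 1 - 1 / (2 * real (Suc M))"
  have \<rho>: "0 < \<rho>" "\<rho> < 1" by (auto simp: \<rho>_def field_simps)
  define s where "s = (\<lambda>\<zeta>. sgn (cnj z * \<zeta>))"
  have sm [measurable]: "s \<in> borel_measurable borel" unfolding s_def by measurable
  have ns: "norm (s \<zeta>) \<le> 1" for \<zeta> by (simp add: s_def norm_sgn)
  \<comment> \<open>a function bounded by \<open>pi / 2\<close> whose Fourier coefficients have size \<open>\<rho>\<^sup>m / (2 * m)\<close>\<close>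
  define G where "G = (\<lambda>\<zeta>. of_real (Im (Ln (1 - of_real \<rho> * s \<zeta>))) :: complex)"
  have nrs: "norm (of_real \<rho> * s \<zeta>) < 1" for \<zeta>
  proof -
    have "norm (of_real \<rho> * s \<zeta>) \<le> \<rho> * 1" unfolding norm_mult using ns[of \<zeta>] \<rho> by (intro mult_mono) auto
    then show ?thesis using \<rho> by simp
  qed
  have re: "Re (1 - of_real \<rho> * s \<zeta>) > 0" for \<zeta>
    using nrs[of \<zeta>] complex_Re_le_cmod[of "of_real \<rho> * s \<zeta>"] by simp
  have Gb: "norm (G \<zeta>) \<le> pi / 2" for \<zeta>
    using Re_Ln_pos_lt_imp[OF re[of \<zeta>]] by (simp add: G_def)
  define t where "t = (\<lambda>m \<zeta>. of_real (Im (- ((of_real \<rho> * s \<zeta>) ^ m) / of_nat m)) :: complex)"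
  have tsums: "(\<lambda>m. t m \<zeta>) sums G \<zeta>" for \<zeta>
  proof -
    have "(\<lambda>n. - ((- (- (of_real \<rho> * s \<zeta>)))^n) / of_nat n) sums ln (1 + - (of_real \<rho> * s \<zeta>))"
      by (rule Ln_series') (use nrs in simp)
    then have "(\<lambda>n. - ((of_real \<rho> * s \<zeta>)^n) / of_nat n) sums Ln (1 - of_real \<rho> * s \<zeta>)" by simp
    then show ?thesis unfolding t_def G_def by (intro sums_of_real sums_Im)
  qed
  have tm [measurable]: "t m \<in> borel_measurable borel" for m unfolding t_def by measurable
  have Gm [measurable]: "G \<in> borel_measurable borel"
  proof -
    have "G = (\<lambda>\<zeta>. \<Sum>m. t m \<zeta>)" using tsums by (auto simp: fun_eq_iff sums_iff)
    then show ?thesis by simp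
  qed
  have tb: "norm (t m \<zeta>) \<le> \<rho> ^ m" for m \<zeta>
  proof -
    have "norm (t m \<zeta>) \<le> norm (- ((of_real \<rho> * s \<zeta>) ^ m) / of_nat m)"
      unfolding t_def norm_of_real using abs_Im_le_cmod by blast
    also have "\<dots> = \<rho> ^ m * norm (s \<zeta>) ^ m / real m" using \<rho> by (simp add: norm_divide norm_power norm_mult power_mult_distrib)
    also have "\<dots> \<le> \<rho> ^ m * 1 / 1"
    proof (cases "m = 0")
      case False
      then show ?thesis using \<rho> ns[of \<zeta>] by (intro frac_le mult_left_mono power_le_one) auto
    qed (use \<rho> in auto)
    finally show ?thesis by simp
  qed
  define f where "f = (\<lambda>m \<zeta>. of_real (norm \<zeta> powr x) * t m \<zeta> * kern (cnj z * \<zeta>))"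
  have fm [measurable]: "f m \<in> borel_measurable borel" for m unfolding f_def by measurable
  have fb: "norm (f m \<zeta>) \<le> \<rho> ^ m * (norm \<zeta> powr x * norm (kern (cnj z * \<zeta>)))" for m \<zeta>
  proof -
    have "norm (f m \<zeta>) = norm (t m \<zeta>) * (norm \<zeta> powr x * norm (kern (cnj z * \<zeta>)))" by (simp add: f_def norm_mult mult_ac)
    also have "\<dots> \<le> \<rho> ^ m * (norm \<zeta> powr x * norm (kern (cnj z * \<zeta>)))" using tb by (intro mult_right_mono) auto
    finally show ?thesis .
  qed
  have bi: "integrable \<mu> (\<lambda>\<zeta>. \<rho> ^ m * (norm \<zeta> powr x * norm (kern (cnj z * \<zeta>))))" for m
    by (intro integrable_mult_right integrable_powr_proj z x)
  have fi: "integrable \<mu> (f m)" for m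
  proof (rule Bochner_Integration.integrable_bound[OF bi])
    show "AE \<zeta> in \<mu>. norm (f m \<zeta>) \<le> norm (\<rho> ^ m * (norm \<zeta> powr x * norm (kern (cnj z * \<zeta>))))"
      using fb \<rho> by (intro AE_I2) (auto simp: abs_mult)
  qed (rule borel_\<mu>, measurable)
  have sumsf: "summable (\<lambda>m. norm (f m \<zeta>))" for \<zeta>
    by (rule summable_comparison_test'[where N=0 and g="\<lambda>m. \<rho> ^ m * (norm \<zeta> powr x * norm (kern (cnj z * \<zeta>)))"])
       (use fb \<rho> in \<open>auto intro!: summable_mult2 summable_geometric\<close>)
  have sint: "summable (\<lambda>m. LINT \<zeta>|\<mu>. norm (f m \<zeta>))"
  proof (rule summable_comparison_test'[where N=0])
    show "summable (\<lambda>m. \<rho> ^ m * powr_proj x z)" using \<rho> by (intro summable_mult2 summable_geometric) auto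
    fix m
    have "(LINT \<zeta>|\<mu>. norm (f m \<zeta>)) \<le> (LINT \<zeta>|\<mu>. \<rho> ^ m * (norm \<zeta> powr x * norm (kern (cnj z * \<zeta>))))"
      using fb by (intro integral_mono integrable_norm fi bi) auto
    then show "norm (LINT \<zeta>|\<mu>. norm (f m \<zeta>)) \<le> \<rho> ^ m * powr_proj x z" by (simp add: powr_proj_def)
  qed
  \<comment> \<open>The imaginary part contains the phases \<open>s ^ m\<close> and
    \<open>cnj s ^ m\<close>. The first pairs to zero with the kernel and the second gives the
    coefficient, so all contributions have the same argument and cannot cancel.\<close>
  have If: "(LINT \<zeta>|\<mu>. f m \<zeta>) = - \<i> / 2 * of_real (\<rho> ^ m * powr_coeff x z m / real m)" for m
  proof (cases "m = 0")
    case True then show ?thesis by (simp add: f_def t_def)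
  next
    case False
    have teq: "t m \<zeta> = of_real (\<rho> ^ m / real m) * (\<i> / 2) * (s \<zeta> ^ m * cnj (s \<zeta>) ^ 0 - s \<zeta> ^ 0 * cnj (s \<zeta>) ^ m)" for \<zeta>
    proof -
      have "- ((of_real \<rho> * s \<zeta>) ^ m) / of_nat m = of_real (- (\<rho> ^ m / real m)) * s \<zeta> ^ m"
        by (simp add: power_mult_distrib)
      then have "t m \<zeta> = of_real (- (\<rho> ^ m / real m)) * of_real (Im (s \<zeta> ^ m))"
        unfolding t_def by (simp del: of_real_minus of_real_divide add: of_real_mult[symmetric])
      also have "of_real (Im (s \<zeta> ^ m)) = (- \<i> / 2) * (s \<zeta> ^ m - cnj (s \<zeta> ^ m))"
        unfolding complex_diff_cnj by (simp add: complex_eq_iff)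
      finally have "t m \<zeta> = of_real (- (\<rho> ^ m / real m)) * ((- \<i> / 2) * (s \<zeta> ^ m - cnj (s \<zeta> ^ m)))" .
      also have "\<dots> = of_real (\<rho> ^ m / real m) * (\<i> / 2) * (s \<zeta> ^ m - cnj (s \<zeta> ^ m))"
        unfolding of_real_minus by simp
      finally show ?thesis by simp
    qed
    define A where "A = (\<lambda>\<zeta>. of_real (norm \<zeta> powr x) * (s \<zeta> ^ m * cnj (s \<zeta>) ^ 0) * kern (cnj z * \<zeta>))"
    define B where "B = (\<lambda>\<zeta>. of_real (norm \<zeta> powr x) * (s \<zeta> ^ 0 * cnj (s \<zeta>) ^ m) * kern (cnj z * \<zeta>))"
    have int: "integrable \<mu> (\<lambda>\<zeta>. of_real (norm \<zeta> powr x) * h \<zeta> * kern (cnj z * \<zeta>))" 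
      if h: "h \<in> borel_measurable borel" "\<And>\<zeta>. norm (h \<zeta>) \<le> 1" for h :: "complex \<Rightarrow> complex"
    proof (rule Bochner_Integration.integrable_bound[OF integrable_powr_proj[OF z(1) x]])
      note [measurable] = h(1)
      show "(\<lambda>\<zeta>. of_real (norm \<zeta> powr x) * h \<zeta> * kern (cnj z * \<zeta>)) \<in> borel_measurable \<mu>" by (rule borel_\<mu>) measurable
      show "AE \<zeta> in \<mu>. norm (of_real (norm \<zeta> powr x) * h \<zeta> * kern (cnj z * \<zeta>)) \<le> norm (norm \<zeta> powr x * norm (kern (cnj z * \<zeta>)))"
      proof (rule AE_I2)
        fix \<zeta>
        have "norm (of_real (norm \<zeta> powr x) * h \<zeta> * kern (cnj z * \<zeta>)) = norm (h \<zeta>) * (norm \<zeta> powr x * norm (kern (cnj z * \<zeta>)))"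
          by (simp add: norm_mult mult_ac)
        also have "\<dots> \<le> 1 * (norm \<zeta> powr x * norm (kern (cnj z * \<zeta>)))" using h(2) by (intro mult_right_mono) auto
        finally show "norm (of_real (norm \<zeta> powr x) * h \<zeta> * kern (cnj z * \<zeta>)) \<le> norm (norm \<zeta> powr x * norm (kern (cnj z * \<zeta>)))" by simp
      qed
    qed
    have "integrable \<mu> A" "integrable \<mu> B"
      unfolding A_def B_def s_def by (intro int norm_phase_le; measurable)+
    moreover have "f m \<zeta> = of_real (\<rho> ^ m / real m) * (\<i> / 2) * (A \<zeta> - B \<zeta>)" for \<zeta>
      unfolding f_def A_def B_def teq by (simp only: ring_distribs mult_ac)
    ultimately have "(LINT \<zeta>|\<mu>. f m \<zeta>) = of_real (\<rho> ^ m / real m) * (\<i> / 2) * ((LINT \<zeta>|\<mu>. A \<zeta>) - (LINT \<zeta>|\<mu>. B \<zeta>))"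
      by simp
    also have "(LINT \<zeta>|\<mu>. A \<zeta>) = 0" 
      using kern_phase_integral[OF z x, of m 0] False unfolding A_def s_def by simp
    also have "(LINT \<zeta>|\<mu>. B \<zeta>) = of_real (powr_coeff x z m)" 
      using kern_phase_integral[OF z x, of 0 m] unfolding B_def s_def powr_coeff_def by simp
    finally show ?thesis by (simp add: mult_ac)
  qed
  have "(LINT \<zeta>|\<mu>. of_real (norm \<zeta> powr x) * G \<zeta> * kern (cnj z * \<zeta>)) = (LINT \<zeta>|\<mu>. (\<Sum>m. f m \<zeta>))"
  proof (rule Bochner_Integration.integral_cong)
    fix \<zeta>
    have "(\<lambda>m. f m \<zeta>) sums (of_real (norm \<zeta> powr x) * G \<zeta> * kern (cnj z * \<zeta>))"
      unfolding f_def by (intro sums_mult sums_mult2 tsums)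
    then show "of_real (norm \<zeta> powr x) * G \<zeta> * kern (cnj z * \<zeta>) = (\<Sum>m. f m \<zeta>)" by (simp add: sums_iff)
  qed simp
  also have "\<dots> = (\<Sum>m. LINT \<zeta>|\<mu>. f m \<zeta>)"
    by (rule integral_suminf) (use fi sumsf sint in auto)
  also have "\<dots> = (\<Sum>m. - \<i> / 2 * of_real (\<rho> ^ m * powr_coeff x z m / real m))" by (simp only: If)
  finally have eq: "(LINT \<zeta>|\<mu>. of_real (norm \<zeta> powr x) * G \<zeta> * kern (cnj z * \<zeta>)) = (\<Sum>m. - \<i> / 2 * of_real (\<rho> ^ m * powr_coeff x z m / real m))" .
  have smI: "summable (\<lambda>m. \<rho> ^ m * powr_coeff x z m / real m)"
  proof -
    have "summable (\<lambda>m. LINT \<zeta>|\<mu>. f m \<zeta>)"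
      by (rule summable_integral) (use fi sumsf sint in auto)
    then have "summable (\<lambda>m. 2 * Im (- (LINT \<zeta>|\<mu>. f m \<zeta>)))" by (intro summable_mult summable_Im summable_minus)
    then show ?thesis unfolding If by simp
  qed
  have "(\<Sum>m. - \<i> / 2 * of_real (\<rho> ^ m * powr_coeff x z m / real m)) = - \<i> / 2 * of_real (\<Sum>m. \<rho> ^ m * powr_coeff x z m / real m)"
    using smI by (subst suminf_mult) (auto simp: suminf_of_real summable_of_real simp del: of_real_divide of_real_mult)
  then have "norm (- \<i> / 2 * of_real (\<Sum>m. \<rho> ^ m * powr_coeff x z m / real m)) \<le> pi / 2 * powr_proj x z"
    using powr_proj_ge_of_bounded[OF z(1) x Gm Gb] unfolding eq by simp
  then have 1: "(\<Sum>m. \<rho> ^ m * powr_coeff x z m / real m) \<le> pi * powr_proj x z" by (simp add: norm_mult norm_divide)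
  have "(1/2) * (\<Sum>m=1..M. powr_coeff x z m / real m) = (\<Sum>m=1..M. 1/2 * (powr_coeff x z m / real m))" by (rule sum_distrib_left)
  also have "\<dots> \<le> (\<Sum>m=1..M. \<rho> ^ m * (powr_coeff x z m / real m))"
  proof (intro sum_mono mult_right_mono)
    fix m assume m: "m \<in> {1..M}"
    have "1/2 \<le> 1 + real m * (- (1 / (2 * real (Suc M))))" using m by (simp add: field_simps)
    also have "\<dots> \<le> (1 + - (1 / (2 * real (Suc M)))) ^ m" by (rule Bernoulli_inequality) (simp add: field_simps)
    finally show "1/2 \<le> \<rho> ^ m" by (simp add: \<rho>_def)
  qed (use powr_coeff_nonneg[OF x] in auto)
  also have "\<dots> = (\<Sum>m=1..M. \<rho> ^ m * powr_coeff x z m / real m)" by simp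
  also have "\<dots> \<le> (\<Sum>m. \<rho> ^ m * powr_coeff x z m / real m)"
    using smI \<rho> powr_coeff_nonneg[OF x] by (intro sum_le_suminf) auto
  finally show ?thesis using 1 by simp
qed

end

lemma ln_le_sum_inverse:
  fixes N K :: nat assumes "1 \<le> N" "N \<le> K"
  shows "ln (real (Suc K) / real N) \<le> (\<Sum>m=N..K. 1 / real m)"
  using assms(2)
proof (induction K rule: dec_induct)
  case base
  have "real (Suc N) / real N = 1 + 1 / real N" using assms by (simp add: field_simps)
  then show ?case using ln_add_one_self_le_self[of "1 / real N"] by simp
next
  case (step K)
  have "real (Suc (Suc K)) / real N = (real (Suc K) / real N) * (1 + 1 / real (Suc K))"
  proof -
    have "real (Suc (Suc K)) = real (Suc K) * (1 + 1 / real (Suc K))"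
      unfolding distrib_left by simp
    then show ?thesis by (simp only: times_divide_eq_left)
  qed
  then have "ln (real (Suc (Suc K)) / real N) = ln (real (Suc K) / real N) + ln (1 + 1 / real (Suc K))"
    using assms by (simp only:) (subst ln_mult, auto intro: add_pos_nonneg)
  also have "\<dots> \<le> ln (real (Suc K) / real N) + 1 / real (Suc K)"
    using ln_add_one_self_le_self[of "1 / real (Suc K)"] by (intro add_left_mono) auto
  also have "\<dots> \<le> (\<Sum>m=N..Suc K. 1 / real m)" using step by simp
  finally show ?case .
qed

section \<open>Testing the bounds: from the operator to the moments\<close>

context radial
begin

text \<open>The analogue of \<open>weight_tail\<close> for area. The factor \<open>r\<close> in the
  lower bound of \<open>ann_bounds\<close> is the reason why small radii are treated apart
  later.\<close>

definition ann :: "real \<Rightarrow> real" where "ann r = measure \<mu> {z \<in> disk. r \<le> norm z}"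

lemma sets_\<mu>_borel: "A \<in> sets borel \<Longrightarrow> {z \<in> disk. z \<in> A} \<in> sets \<mu>"
proof -
  assume "A \<in> sets borel"
  then have "(\<lambda>z. z) -` A \<inter> space \<mu> \<in> sets \<mu>" by (intro measurable_sets[OF borel_\<mu>]) auto
  then show ?thesis by (simp add: Int_def conj_commute)
qed

lemma emeasure_ann: "emeasure \<mu> {z \<in> disk. r \<le> norm z} = (\<integral>\<^sup>+s. ennreal (2 * s) * indicator {r..} s \<partial>\<nu>)"
proof -
  have s: "{z \<in> disk. z \<in> {z. r \<le> norm z}} \<in> sets \<mu>" by (rule sets_\<mu>_borel) measurable
  have "emeasure \<mu> {z \<in> disk. r \<le> norm z} = (\<integral>\<^sup>+z. indicator {z \<in> disk. r \<le> norm z} z \<partial>\<mu>)"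
    using s by (intro nn_integral_indicator[symmetric]) simp
  also have "\<dots> = (\<integral>\<^sup>+z. indicator {r..} (norm z) \<partial>\<mu>)"
    by (intro nn_integral_cong) (auto simp: indicator_def)
  also have "\<dots> = (\<integral>\<^sup>+s. ennreal (2 * s) * indicator {r..} s \<partial>\<nu>)" by (rule nn_integral_radial) auto
  finally show ?thesis .
qed

lemma ann_bounds:
  assumes "0 \<le> r"
  shows "2 * r * hat r \<le> ann r" "ann r \<le> 2 * hat r"
proof -
  have h0: "hat r \<ge> 0" using assms by (simp add: hat_eq)
  have e: "emeasure \<mu> {z \<in> disk. r \<le> norm z} = ennreal (ann r)" by (simp add: ann_def M.emeasure_eq_measure)
  have "ennreal (2 * r * hat r) = ennreal (2 * r) * emeasure \<nu> {r..}"
    using assms h0 by (simp add: emeasure_hat ennreal_mult'')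
  also have "\<dots> = (\<integral>\<^sup>+s. ennreal (2 * r) * indicator {r..} s \<partial>\<nu>)"
    by (rule nn_integral_cmult_indicator[symmetric]) simp
  also have "\<dots> \<le> ennreal (ann r)" unfolding e[symmetric] emeasure_ann
    by (intro nn_integral_mono) (auto simp: indicator_def intro!: ennreal_leI)
  finally show "2 * r * hat r \<le> ann r" by (simp add: ann_def)
  have "ennreal (ann r) \<le> (\<integral>\<^sup>+s. 2 * indicator {r..} s \<partial>\<nu>)" unfolding e[symmetric] emeasure_ann
  proof (rule nn_integral_mono_AE)
    show "AE s in \<nu>. ennreal (2 * s) * indicator {r..} s \<le> 2 * indicator {r..} s"
      using AE_\<nu> by eventually_elim (auto simp: indicator_def simp flip: ennreal_numeral intro!: ennreal_leI)
  qed
  also have "\<dots> = 2 * emeasure \<nu> {r..}" by (rule nn_integral_cmult_indicator) simp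
  also have "\<dots> = ennreal (2 * hat r)" using assms h0 by (simp add: emeasure_hat ennreal_mult'')
  finally show "ann r \<le> 2 * hat r" using h0 by simp
qed

lemma powr_proj_nonneg: "0 \<le> powr_proj x z"
  unfolding powr_proj_def by (rule integral_nonneg_AE) auto

lemma powr_proj_lower_single:
  assumes "z \<in> disk" "x \<ge> 0"
  shows "mom (x + real m + 1) / mom (2 * real m + 1) * norm z powr real m \<le> powr_proj x z"
proof (cases "z = 0")
  case False
  then show ?thesis using powr_proj_ge_single[OF assms, of m] by (simp add: powr_coeff_def powr_realpow mult.commute)
qed (simp add: powr_proj_nonneg)

text \<open>By monotonicity of powers and moments, all coefficients of index from \<open>N\<close>
  to \<open>k * N\<close> are at least the common value \<open>c\<close>, and the harmonic sum over
  this range is at least \<open>ln k\<close>. Taking \<open>x = k * N\<close> keeps the exponents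
  \<open>x + m + 1\<close> at most \<open>2 * k * N + 1\<close>.\<close>

lemma powr_proj_lower_log:
  assumes z: "z \<in> disk" and N: "N \<ge> (1::nat)" and k: "k \<ge> (1::nat)"
  shows "ln (real k) / (2 * pi) * (mom (2 * real k * real N + 1) / mom (2 * real N + 1)) * norm z powr (real k * real N)
    \<le> powr_proj (real k * real N) z"
proof (cases "z = 0")
  case False
  let ?x = "real k * real N" and ?M = "k * N"
  define c where "c = norm z ^ ?M * mom (2 * real k * real N + 1) / mom (2 * real N + 1)"
  have c0: "c \<ge> 0" unfolding c_def using mom_pos[of "2 * real k * real N + 1"] mom_pos[of "2 * real N + 1"] by auto
  have NM: "N \<le> ?M" using k by simp
  have "real k \<le> real (Suc ?M) / real N" using N by (simp add: pos_le_divide_eq)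
  then have "ln (real k) \<le> ln (real (Suc ?M) / real N)"
    using k by (subst ln_le_cancel_iff) linarith+
  also have "\<dots> \<le> (\<Sum>m=N..?M. 1 / real m)" using N NM by (rule ln_le_sum_inverse)
  finally have "c * ln (real k) \<le> c * (\<Sum>m=N..?M. 1 / real m)" using c0 by (rule mult_left_mono)
  also have "\<dots> = (\<Sum>m=N..?M. c / real m)" by (simp add: sum_distrib_left)
  also have "\<dots> \<le> (\<Sum>m=N..?M. powr_coeff ?x z m / real m)"
  proof (intro sum_mono divide_right_mono)
    fix m assume m: "m \<in> {N..?M}"
    have "real m \<le> real ?M" using m by (simp only: of_nat_le_iff atLeastAtMost_iff)
    then have mM: "real m \<le> real k * real N" by simp
    show "c \<le> powr_coeff ?x z m" unfolding c_def powr_coeff_def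
      using m z mM mM[unfolded mult.commute[of "real k"]] mom_pos[of "2 * real m + 1"]
        mom_pos[of "2 * real k * real N + 1"] mom_pos[of "real k * real N + real m + 1"]
      by (intro frac_le mult_mono power_decreasing mom_mono) auto
  qed auto
  also have "\<dots> \<le> (\<Sum>m=1..?M. powr_coeff ?x z m / real m)"
    using N powr_coeff_nonneg[of ?x] by (intro sum_mono2) auto
  also have "\<dots> \<le> 2 * pi * powr_proj ?x z" using z False by (intro powr_proj_ge_sum) auto
  finally have "c * ln (real k) / (2 * pi) \<le> powr_proj ?x z" by (simp add: field_simps)
  moreover have "norm z powr (real k * real N) = norm z ^ ?M"
    using False powr_realpow[of "norm z" ?M] by simp
  ultimately show ?thesis by (simp add: c_def mult_ac)
qed (simp add: powr_proj_nonneg)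

lemma Lp_pow:
  assumes "p > 0" "x \<ge> 0"
  shows "(\<lambda>\<zeta>. of_real (norm \<zeta> powr x)) \<in> Lp_space \<omega> p"
    and "Lp_norm \<omega> p (\<lambda>\<zeta>. of_real (norm \<zeta> powr x)) = (2 * mom (p * x + 1)) powr (1 / p)"
proof -
  have eq: "(\<lambda>z. norm (complex_of_real (norm z powr x)) powr p) = (\<lambda>z::complex. norm z powr (p * x))"
    by (simp add: powr_powr mult.commute)
  have hb: "has_bochner_integral \<mu> (\<lambda>z. norm z powr (p * x)) (2 * mom (p * x + 1))"
    using assms by (intro has_bochner_integral_powr) auto
  show "(\<lambda>\<zeta>. of_real (norm \<zeta> powr x)) \<in> Lp_space \<omega> p"
    unfolding Lp_space_def mem_Collect_eq eq using hb by (auto simp: has_bochner_integral_iff intro!: borel_\<mu>)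
  show "Lp_norm \<omega> p (\<lambda>\<zeta>. of_real (norm \<zeta> powr x)) = (2 * mom (p * x + 1)) powr (1 / p)"
    unfolding Lp_norm_def eq using hb by (simp add: has_bochner_integral_iff)
qed

lemma proj_pow: "max_bergman_projection \<omega> (\<lambda>\<zeta>. of_real (norm \<zeta> powr x)) = (\<lambda>z. of_real (powr_proj x z))"
  by (rule ext) (rule max_bergman_projection_powr)

text \<open>Tests the image against \<open>norm z powr y\<close>. Division by \<open>a\<close> and
  \<open>d\<close> makes Hoelder's inequality out of Young's. The parameters stay free because
  doubling and the logarithmic estimate need different choices.\<close>

lemma Lp_pairing:
  assumes b: "bounded_Lp_Lp \<omega> p" and pq: "p > 1" "q > 1" "1 / p + 1 / q = 1"
  obtains C where "C > 0"
    "\<And>A Y x y. A \<ge> 0 \<Longrightarrow> Y \<ge> 0 \<Longrightarrow> x \<ge> 0 \<Longrightarrow> y \<ge> 0 \<Longrightarrow> (\<And>z. z \<in> disk \<Longrightarrow> A * norm z powr Y \<le> powr_proj x z) \<Longrightarrow>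
      A * mom (Y + y + 1) \<le> C * mom (p * x + 1) powr (1 / p) * mom (q * y + 1) powr (1 / q)"
proof -
  obtain C0 where C0: "\<And>f. f \<in> Lp_space \<omega> p \<Longrightarrow> max_bergman_projection \<omega> f \<in> Lp_space \<omega> p \<and>
      Lp_norm \<omega> p (max_bergman_projection \<omega> f) \<le> C0 * Lp_norm \<omega> p f"
    using b unfolding bounded_Lp_Lp_def bounded_operator_def by blast
  define C where "C = max C0 1"
  show thesis
  proof (rule that)
    show "C > 0" by (simp add: C_def)
    fix A Y x y :: real
    assume h: "A \<ge> 0" "Y \<ge> 0" "x \<ge> 0" "y \<ge> 0" and lower: "\<And>z. z \<in> disk \<Longrightarrow> A * norm z powr Y \<le> powr_proj x z"
    have p0: "p > 0" "q > 0" using pq by auto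
    define a where "a = C * (2 * mom (p * x + 1)) powr (1 / p)"
    define d where "d = (2 * mom (q * y + 1)) powr (1 / q)"
    have mp: "mom (p * x + 1) > 0" "mom (q * y + 1) > 0" using h p0 by (auto intro!: mom_pos)
    have pos: "a > 0" "d > 0" using mp by (auto simp: a_def d_def C_def)
    have dq: "d powr q = 2 * mom (q * y + 1)" using mp p0 by (simp add: d_def powr_powr)
    from C0[OF Lp_pow(1)[OF p0(1) h(3)]]
    have F: "integrable \<mu> (\<lambda>z. powr_proj x z powr p)"
      and Fn: "(LINT z|\<mu>. powr_proj x z powr p) powr (1 / p) \<le> C0 * (2 * mom (p * x + 1)) powr (1 / p)"
      unfolding proj_pow Lp_pow(2)[OF p0(1) h(3)]
      by (auto simp: Lp_space_def Lp_norm_def powr_proj_nonneg)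
    note Fn
    also have "C0 * (2 * mom (p * x + 1)) powr (1 / p) \<le> a" unfolding a_def by (intro mult_right_mono) (auto simp: C_def)
    finally have "((LINT z|\<mu>. powr_proj x z powr p) powr (1 / p)) powr p \<le> a powr p"
      using p0 by (intro powr_mono2) auto
    then have Fa: "(LINT z|\<mu>. powr_proj x z powr p) \<le> a powr p"
      using p0 by (simp add: powr_powr integral_nonneg_AE)
    have hY: "has_bochner_integral \<mu> (\<lambda>z. norm z powr (Y + y)) (2 * mom (Y + y + 1))"
      using h by (intro has_bochner_integral_powr) auto
    have hG: "has_bochner_integral \<mu> (\<lambda>z. norm z powr (q * y)) (2 * mom (q * y + 1))"
      using h p0 by (intro has_bochner_integral_powr) auto
    have "A * (2 * mom (Y + y + 1)) = (LINT z|\<mu>. A * norm z powr (Y + y))"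
      using hY by (simp add: has_bochner_integral_iff)
    also have "\<dots> \<le> (LINT z|\<mu>. a * d * (powr_proj x z powr p / a powr p / p + norm z powr (q * y) / d powr q / q))"
    proof (rule integral_mono)
      show "integrable \<mu> (\<lambda>z. A * norm z powr (Y + y))"
        using hY by (intro integrable_mult_right) (simp add: has_bochner_integral_iff)
      show "integrable \<mu> (\<lambda>z. a * d * (powr_proj x z powr p / a powr p / p + norm z powr (q * y) / d powr q / q))"
        using F hG by (intro integrable_mult_right Bochner_Integration.integrable_add integrable_divide) (auto simp: has_bochner_integral_iff)
      fix z assume "z \<in> space \<mu>"
      then have z: "z \<in> disk" by simp
      have "A * norm z powr (Y + y) = A * norm z powr Y * norm z powr y" by (simp add: powr_add)
      also have "\<dots> \<le> powr_proj x z * norm z powr y" using lower[OF z] by (intro mult_right_mono) auto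
      also have "\<dots> = a * d * ((powr_proj x z / a) * (norm z powr y / d))" using pos by simp
      also have "\<dots> \<le> a * d * ((powr_proj x z / a) powr p / p + (norm z powr y / d) powr q / q)"
        using pq pos powr_proj_nonneg by (intro mult_left_mono Youngs_inequality) auto
      also have "\<dots> = a * d * (powr_proj x z powr p / a powr p / p + norm z powr (q * y) / d powr q / q)"
        using pos powr_proj_nonneg by (simp add: powr_divide powr_powr mult.commute[of y q])
      finally show "A * norm z powr (Y + y) \<le> \<dots>" .
    qed
    also have "\<dots> = a * d * ((LINT z|\<mu>. powr_proj x z powr p) / a powr p / p + (2 * mom (q * y + 1)) / d powr q / q)"
      using F hG by (simp add: has_bochner_integral_iff)
    also have "\<dots> \<le> a * d * (1 / p + 1 / q)"
      unfolding dq using Fa pos p0 mp by (intro mult_left_mono add_mono divide_right_mono) (auto simp: divide_le_eq)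
    also have "\<dots> = C * (2 powr (1 / p) * 2 powr (1 / q)) * (mom (p * x + 1) powr (1 / p) * mom (q * y + 1) powr (1 / q))"
      unfolding pq(3) a_def d_def using mp by (simp add: powr_mult mult_ac)
    also have "2 powr (1 / p) * 2 powr (1 / q) = (2::real)" using pq(3) by (simp flip: powr_add)
    finally show "A * mom (Y + y + 1) \<le> C * mom (p * x + 1) powr (1 / p) * mom (q * y + 1) powr (1 / q)" by simp
  qed
qed

lemma Lp_bounded_imp_class_D:
  assumes b: "bounded_Lp_Lp \<omega> p" and p: "p > 1" "p \<noteq> 2"
  shows "\<omega> \<in> class_D"
proof -
  define q where "q = p / (p - 1)"
  have q: "q > 1" "1 / p + 1 / q = 1" using p by (auto simp: q_def field_simps)
  have qp: "p / q = p - 1" "q / p = q - 1" using p by (auto simp: q_def field_simps)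
  obtain C where C: "C > 0" and pair: "\<And>A Y x y. A \<ge> 0 \<Longrightarrow> Y \<ge> 0 \<Longrightarrow> x \<ge> 0 \<Longrightarrow> y \<ge> 0 \<Longrightarrow> (\<And>z. z \<in> disk \<Longrightarrow> A * norm z powr Y \<le> powr_proj x z) \<Longrightarrow>
      A * mom (Y + y + 1) \<le> C * mom (p * x + 1) powr (1 / p) * mom (q * y + 1) powr (1 / q)"
    using Lp_pairing[OF b p(1) q] by blast
  have "mom_doubling"
  proof -
    \<comment> \<open>\<open>s\<close> is the conjugate exponent above 2, be it \<open>p\<close> or
      \<open>q\<close>. For \<open>q > 2\<close> the projected power and the testing power exchange
      their roles.\<close>
    have core: "mom_doubling" if s: "s > 2" and st: "\<And>n t. n \<ge> (1::nat) \<Longrightarrow> 0 \<le> t \<Longrightarrow>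
        mom (real n + t + 1) / mom (2 * real n + 1) * mom (s * real n + 1)
          \<le> C * mom (s * t + 1) powr (1 / s) * mom (s * real n + 1) powr (1 - 1 / s)" for s
    proof (rule mom_doubling_from_convexity[OF s, where C="ln C"])
      fix n :: nat and t :: real assume n: "n \<ge> 1" and t: "0 \<le> t"
      have mp: "mom (real n + t + 1) > 0" "mom (2 * real n + 1) > 0" "mom (s * real n + 1) > 0" "mom (s * t + 1) > 0"
        using t s by (auto intro!: mom_pos)
      have "ln (mom (real n + t + 1) / mom (2 * real n + 1) * mom (s * real n + 1))
          \<le> ln (C * mom (s * t + 1) powr (1 / s) * mom (s * real n + 1) powr (1 - 1 / s))"
        using st[OF n t] mp C by (subst ln_le_cancel_iff) auto
      then have "ln (mom (real n + t + 1)) - ln (mom (2 * real n + 1)) + ln (mom (s * real n + 1))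
          \<le> ln C + ln (mom (s * t + 1)) / s + (1 - 1 / s) * ln (mom (s * real n + 1))"
        using mp C by (simp add: ln_mult ln_div ln_powr)
      then show "ln (mom (real n + t + 1)) - ln (mom (2 * real n + 1)) \<le> ln C + (ln (mom (s * t + 1)) - ln (mom (s * real n + 1))) / s"
        by (simp add: algebra_simps diff_divide_distrib)
    qed
    show ?thesis
    proof (cases "p > 2")
      case True
      show ?thesis
      proof (rule core[OF True])
        fix n :: nat and t :: real assume n: "n \<ge> 1" and t: "0 \<le> t"
        \<comment> \<open>The testing power \<open>y = (p / q) * n\<close> satisfies
          \<open>n + y = p * n = q * y\<close>, so that the same moment occurs on both sides of the
          inequality.\<close>
        have e: "q * (p / q * real n) = p * real n" "real n + p / q * real n = p * real n"
          using q by simp (simp add: qp algebra_simps)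
        have "mom (t + real n + 1) / mom (2 * real n + 1) * mom (real n + p / q * real n + 1)
          \<le> C * mom (p * t + 1) powr (1 / p) * mom (q * (p / q * real n) + 1) powr (1 / q)"
          using powr_proj_lower_single[OF _ t, of _ n] mom_pos[of "t + real n + 1"] mom_pos[of "2 * real n + 1"] t p q by (intro pair) auto
        moreover have "1 / q = 1 - 1 / p" using q by simp
        ultimately show "mom (real n + t + 1) / mom (2 * real n + 1) * mom (p * real n + 1)
          \<le> C * mom (p * t + 1) powr (1 / p) * mom (p * real n + 1) powr (1 - 1 / p)"
          unfolding e by (simp add: add.commute)
      qed
    next
      case False
      then have q2: "q > 2" using p by (auto simp: q_def field_simps)
      show ?thesis
      proof (rule core[OF q2])
        fix n :: nat and t :: real assume n: "n \<ge> 1" and t: "0 \<le> t"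
        have e: "p * (q / p * real n) = q * real n" "q / p * real n + real n = q * real n"
          using p by simp (simp add: qp algebra_simps)
        have x0: "q / p * real n \<ge> 0" using p q by auto
        have "mom (q / p * real n + real n + 1) / mom (2 * real n + 1) * mom (real n + t + 1)
          \<le> C * mom (p * (q / p * real n) + 1) powr (1 / p) * mom (q * t + 1) powr (1 / q)"
          using powr_proj_lower_single[OF _ x0, of _ n] mom_pos[of "q / p * real n + real n + 1"] mom_pos[of "2 * real n + 1"] t x0 by (intro pair) auto
        moreover have "1 / p = 1 - 1 / q" using q by simp
        ultimately show "mom (real n + t + 1) / mom (2 * real n + 1) * mom (q * real n + 1)
          \<le> C * mom (q * t + 1) powr (1 / q) * mom (q * real n + 1) powr (1 - 1 / q)"
          unfolding e by (simp add: mult_ac)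
      qed
    qed
  qed
  then show ?thesis
  proof (rule mom_log_imp_class_D[where C="2 * pi * C"])
    fix N k :: nat assume N: "N \<ge> 1" and k: "k \<ge> 2"
    let ?x = "real k * real N" and ?A = "ln (real k) / (2 * pi) * (mom (2 * real k * real N + 1) / mom (2 * real N + 1))"
    have mp: "mom (2 * real k * real N + 1) > 0" "mom (2 * real N + 1) > 0" "mom (p * ?x + 1) > 0" using p by (auto intro!: mom_pos)
    have A0: "?A \<ge> 0" using k mp by auto
    \<comment> \<open>With this testing power the three moments outside \<open>?A\<close> all have
      the exponent \<open>p * ?x + 1\<close>, and they cancel because
      \<open>1 / p + 1 / q = 1\<close>.\<close>
    have e: "q * (p / q * ?x) = p * ?x" "?x + p / q * ?x = p * ?x"
      using q by simp (simp add: qp algebra_simps)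
    have "?A * mom (?x + p / q * ?x + 1) \<le> C * mom (p * ?x + 1) powr (1 / p) * mom (q * (p / q * ?x) + 1) powr (1 / q)"
      using N k p q powr_proj_lower_log[OF _ N, of _ k] by (intro pair A0) auto
    then have "?A * mom (p * ?x + 1) \<le> C * (mom (p * ?x + 1) powr (1 / p) * mom (p * ?x + 1) powr (1 / q))"
      unfolding e by (simp only: mult_ac)
    also have "mom (p * ?x + 1) powr (1 / p) * mom (p * ?x + 1) powr (1 / q) = mom (p * ?x + 1)"
      using mp q by (simp flip: powr_add)
    finally have "?A \<le> C" using mp(3) by (rule mult_right_le_imp_le)
    then show "ln (real k) * mom (2 * real k * real N + 1) \<le> 2 * pi * C * mom (2 * real N + 1)"
      using mp by (simp add: field_simps)
  qed
qed

text \<open>The assumed lower bound increases with \<open>norm z\<close>, so the superlevel set at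
  half of its value at \<open>r\<close> contains the annulus beyond \<open>r\<close>, of measure at
  least \<open>2 * r * hat r\<close>. Taking half gives the strict inequality in the weak
  quasinorm.\<close>

lemma weak_pairing:
  assumes b: "bounded_L1_weak_L1 \<omega>"
  obtains C where "C > 0"
    "\<And>A Y x r. A \<ge> 0 \<Longrightarrow> Y \<ge> 0 \<Longrightarrow> x \<ge> 0 \<Longrightarrow> 0 \<le> r \<Longrightarrow> r < 1 \<Longrightarrow> (\<And>z. z \<in> disk \<Longrightarrow> A * norm z powr Y \<le> powr_proj x z) \<Longrightarrow>
      A * r powr Y * r * hat r \<le> C * mom (x + 1)"
proof -
  obtain C0 where C0: "\<And>f. f \<in> Lp_space \<omega> 1 \<Longrightarrow> max_bergman_projection \<omega> f \<in> weak_L1_space \<omega> \<and>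
      enn2real (weak_L1_quasinorm \<omega> (max_bergman_projection \<omega> f)) \<le> C0 * Lp_norm \<omega> 1 f"
    using b unfolding bounded_L1_weak_L1_def bounded_operator_def by blast
  define C where "C = 2 * max C0 1"
  show thesis
  proof (rule that)
    show "C > 0" by (simp add: C_def)
    fix A Y x r :: real
    assume h: "A \<ge> 0" "Y \<ge> 0" "x \<ge> 0" "0 \<le> r" "r < 1" and lower: "\<And>z. z \<in> disk \<Longrightarrow> A * norm z powr Y \<le> powr_proj x z"
    have m0: "mom (x + 1) > 0" using h by (auto intro!: mom_pos)
    have h0: "hat r > 0" using h by (intro hat_pos)
    show "A * r powr Y * r * hat r \<le> C * mom (x + 1)"
    proof (cases "A * r powr Y = 0")
      case True
      show ?thesis using m0 unfolding True by (simp add: C_def)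
    next
      case False
      define t where "t = A * r powr Y / 2"
      have t: "t > 0" "t < A * r powr Y" using False h by (auto simp: t_def less_le)
      let ?f = "\<lambda>\<zeta>::complex. complex_of_real (norm \<zeta> powr x)"
      let ?Q = "weak_L1_quasinorm \<omega> (max_bergman_projection \<omega> ?f)"
      have W: "?Q < \<infinity>" "enn2real ?Q \<le> C0 * Lp_norm \<omega> 1 ?f"
        using C0[OF Lp_pow(1)[of 1 x]] h by (auto simp: weak_L1_space_def)
      have "enn2real ?Q \<le> max C0 1 * (2 * mom (x + 1))"
      proof -
        have "Lp_norm \<omega> 1 ?f = 2 * mom (x + 1)" using Lp_pow(2)[of 1 x] h m0 by simp
        then show ?thesis using W(2) m0 by (smt (verit) mult_right_mono)
      qed
      then have "ennreal (enn2real ?Q) \<le> ennreal (C * mom (x + 1))"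
        by (intro ennreal_leI) (simp add: C_def)
      then have Q: "?Q \<le> ennreal (C * mom (x + 1))" using W(1) by simp
      have "ennreal (t * (2 * r * hat r)) \<le> ennreal t * ennreal (ann r)"
        using ann_bounds(1)[OF h(4)] t h h0 by (subst ennreal_mult[symmetric]) (auto simp: ann_def intro!: ennreal_leI mult_left_mono)
      also have "ennreal (ann r) = emeasure \<mu> {z \<in> disk. r \<le> norm z}" by (simp add: ann_def M.emeasure_eq_measure)
      also have "ennreal t * \<dots> \<le> ennreal t * emeasure \<mu> {z \<in> disk. norm (max_bergman_projection \<omega> ?f z) > t}"
      proof (intro mult_left_mono emeasure_mono)
        show "{z \<in> disk. r \<le> norm z} \<subseteq> {z \<in> disk. norm (max_bergman_projection \<omega> ?f z) > t}"
        proof safe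
          fix z assume z: "z \<in> disk" "r \<le> norm z"
          have "A * r powr Y \<le> A * norm z powr Y" using z h by (intro mult_left_mono powr_mono2) auto
          then show "norm (max_bergman_projection \<omega> ?f z) > t" using lower[OF z(1)] t by (simp add: proj_pow)
        qed
        have "max_bergman_projection \<omega> ?f \<in> borel_measurable \<mu>"
          using C0[OF Lp_pow(1)[of 1 x]] h by (auto simp: weak_L1_space_def)
        then have "(\<lambda>z. norm (max_bergman_projection \<omega> ?f z)) \<in> borel_measurable \<mu>" by (rule measurable_compose) simp
        from borel_measurable_less[OF _ this, of "\<lambda>_. t"]
        show "{z \<in> disk. norm (max_bergman_projection \<omega> ?f z) > t} \<in> sets \<mu>" by simp
      qed simp
      also have "\<dots> \<le> ?Q" unfolding weak_L1_quasinorm_def using t by (intro SUP_upper) auto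
      also note Q
      finally have "t * (2 * r * hat r) \<le> C * mom (x + 1)" using m0 by (subst (asm) ennreal_le_iff) (auto simp: C_def)
      then show ?thesis by (simp add: t_def mult_ac)
    qed
  qed
qed

text \<open>Otherwise the moments along multiples of \<open>n\<close> would decay at least like
  powers of 1/2. A radius with \<open>r ^ n \<ge> 3 / 4\<close> has a positive tail and excludes any
  decay faster than that of powers of 3/4.\<close>

lemma exists_mom_ratio:
  assumes n: "n \<ge> (1::nat)"
  shows "\<exists>x\<ge>0. mom (x + 1) \<le> 2 * mom (x + real n + 1)"
proof (rule ccontr)
  assume "\<not> ?thesis"
  then have *: "mom (x + 1) > 2 * mom (x + real n + 1)" if "x \<ge> 0" for x using that by force
  have it: "2 ^ j * mom (real (j * n) + 1) \<le> mom 1" for j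
  proof (induction j)
    case (Suc j)
    have "2 * mom (real (j * n) + real n + 1) \<le> mom (real (j * n) + 1)" using *[of "real (j * n)"] by simp
    then have "2 ^ j * (2 * mom (real (j * n) + real n + 1)) \<le> 2 ^ j * mom (real (j * n) + 1)" by (intro mult_left_mono) auto
    moreover have e: "real (Suc j * n) + 1 = real (j * n) + real n + 1" by simp
    have "2 ^ Suc j * mom (real (Suc j * n) + 1) = 2 ^ j * (2 * mom (real (j * n) + real n + 1))" unfolding e by (simp only: power_Suc mult_ac)
    ultimately show ?case using Suc by linarith
  qed simp
  define r where "r = 1 - 1 / (4 * real n)"
  have r: "0 < r" "r < 1" using n by (auto simp: r_def field_simps)
  have "3 / 4 = 1 + real n * (- (1 / (4 * real n)))" using n by simp
  also have "\<dots> \<le> (1 + - (1 / (4 * real n))) ^ n" using n by (intro Bernoulli_inequality) (simp add: field_simps)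
  finally have rn: "3 / 4 \<le> r ^ n" by (simp add: r_def)
  have hr: "hat r > 0" using r by (intro hat_pos) auto
  obtain j where j: "mom 1 / (r * hat r) < (3 / 2 :: real) ^ j" using real_arch_pow[of "3/2"] by auto
  have "(3 / 2) ^ j \<le> (2 * r ^ n) ^ j" using rn by (intro power_mono) auto
  then have "(3 / 2) ^ j * (r * hat r) \<le> (2 * r ^ n) ^ j * (r * hat r)" using r hr by (intro mult_right_mono) auto
  also have "\<dots> = 2 ^ j * (r ^ (j * n + 1) * hat r)" by (simp add: power_mult_distrib power_mult[symmetric] mult.commute[of n j])
  also have "r ^ (j * n + 1) = r powr (real (j * n) + 1)" using powr_realpow[OF r(1), of "j * n + 1"] by (simp add: add.commute)
  also have "2 ^ j * (r powr (real (j * n) + 1) * hat r) \<le> 2 ^ j * mom (real (j * n) + 1)"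
    using r by (intro mult_left_mono mom_ge_hat) auto
  also note it
  finally have "(3 / 2) ^ j \<le> mom 1 / (r * hat r)" using r hr by (simp add: field_simps)
  then show False using j by simp
qed

lemma weak_bounded_imp_class_D:
  assumes b: "bounded_L1_weak_L1 \<omega>"
  shows "\<omega> \<in> class_D"
proof -
  obtain C where C: "C > 0" and pair: "\<And>A Y x r. A \<ge> 0 \<Longrightarrow> Y \<ge> 0 \<Longrightarrow> x \<ge> 0 \<Longrightarrow> 0 \<le> r \<Longrightarrow> r < 1 \<Longrightarrow> (\<And>z. z \<in> disk \<Longrightarrow> A * norm z powr Y \<le> powr_proj x z) \<Longrightarrow>
      A * r powr Y * r * hat r \<le> C * mom (x + 1)"
    using weak_pairing[OF b] by blast
  have H: "r ^ n * r * hat r \<le> 2 * C * mom (2 * real n + 1)" if n: "n \<ge> 1" and r: "0 \<le> r" "r < 1" for n r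
  proof -
    \<comment> \<open>With this \<open>x\<close> the moments depending on \<open>x\<close> cancel up
      to the factor 2, and a bound in \<open>n\<close> and \<open>r\<close> alone remains.\<close>
    obtain x where x: "x \<ge> 0" "mom (x + 1) \<le> 2 * mom (x + real n + 1)" using exists_mom_ratio[OF n] by blast
    have mp: "mom (x + real n + 1) > 0" "mom (2 * real n + 1) > 0" using x by (auto intro!: mom_pos)
    have "mom (x + real n + 1) / mom (2 * real n + 1) * r powr real n * r * hat r \<le> C * mom (x + 1)"
      using powr_proj_lower_single[OF _ x(1), of _ n] mp x r by (intro pair) auto
    also have "\<dots> \<le> C * (2 * mom (x + real n + 1))" using x C by (intro mult_left_mono) auto
    finally have "mom (x + real n + 1) * (r powr real n * r * hat r) \<le> mom (x + real n + 1) * (2 * C * mom (2 * real n + 1))"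
      using mp by (simp add: field_simps)
    then have "r powr real n * r * hat r \<le> 2 * C * mom (2 * real n + 1)" using mp by simp
    then show ?thesis using r n by (simp add: powr_realpow')
  qed
  \<comment> \<open>The extra factor \<open>r\<close> in \<open>H\<close> is harmless for
    \<open>r \<ge> 1 / 2\<close>. Smaller radii are compared with 1/2, at the price
    \<open>hat 0 / hat (1/2)\<close>.\<close>
  define D where "D = 4 * C * max 1 (hat 0 / hat (1/2))"
  have hh: "hat (1/2) > 0" by (intro hat_pos) auto
  have dbl: "mom_doubling"
  proof (rule mom_doubling_from_hat[where C=D])
    fix n :: nat and r :: real assume n: "n \<ge> 1" and r: "0 \<le> r" "r < 1"
    have mp: "mom (2 * real n + 1) > 0" by (auto intro!: mom_pos)
    show "r ^ n * hat r \<le> D * mom (2 * real n + 1)"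
    proof (cases "r \<ge> 1/2")
      case True
      have "r ^ n * hat r * 1 \<le> r ^ n * hat r * (2 * r)" using True r hat_pos[OF r] by (intro mult_left_mono) auto
      also have "\<dots> = 2 * (r ^ n * r * hat r)" by simp
      also have "\<dots> \<le> 2 * (2 * C * mom (2 * real n + 1))" using H[OF n r] by linarith
      also have "\<dots> = 4 * C * 1 * mom (2 * real n + 1)" by simp
      also have "\<dots> \<le> D * mom (2 * real n + 1)" unfolding D_def using C mp by (intro mult_right_mono mult_left_mono) auto
      finally show ?thesis by simp
    next
      case False
      have "r ^ n * hat r \<le> (1/2) ^ n * hat 0" using False r hat_pos[OF r] by (intro mult_mono power_mono hat_mono) auto
      also have "\<dots> = 2 * (hat 0 / hat (1/2)) * ((1/2) ^ n * (1/2) * hat (1/2))" using hh by simp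
      also have "\<dots> \<le> 2 * (hat 0 / hat (1/2)) * (2 * C * mom (2 * real n + 1))"
        using H[OF n, of "1/2"] hh hat_pos[of 0] by (intro mult_left_mono) auto
      also have "\<dots> = 4 * C * (hat 0 / hat (1/2)) * mom (2 * real n + 1)" by simp
      also have "\<dots> \<le> D * mom (2 * real n + 1)" unfolding D_def using C mp by (intro mult_right_mono mult_left_mono) auto
      finally show ?thesis .
    qed
  qed
  obtain K where K: "K \<ge> 1" "\<And>x. x \<ge> 1 \<Longrightarrow> mom x \<le> K * hat (1 - 1 / (2 * x))"
    using mom_doubling_hat[OF dbl] by blast
  show ?thesis
  proof (rule mom_log_imp_class_D[OF dbl, where C="2 * pi * exp 2 * C * K"])
    fix N k :: nat assume N: "N \<ge> 1" and k: "k \<ge> 2"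
    let ?x = "real k * real N" and ?A = "ln (real k) / (2 * pi) * (mom (2 * real k * real N + 1) / mom (2 * real N + 1))"
    have mp: "mom (2 * real k * real N + 1) > 0" "mom (2 * real N + 1) > 0" by (auto intro!: mom_pos)
    have A0: "?A \<ge> 0" using k mp by auto
    have x1: "?x \<ge> 1" using mult_mono[of 1 "real k" 1 "real N"] N k by simp
    \<comment> \<open>At this radius \<open>r powr (?x + 1) \<ge> exp (-2)\<close>, and by doubling
      \<open>mom (?x + 1)\<close> is at most a multiple of the tail at \<open>r\<close>, so the tail
      cancels.\<close>
    define r where "r = 1 - 1 / (?x + 1)"
    have r: "0 < r" "r < 1" using x1 by (auto simp: r_def)
    have hr: "hat r > 0" using r by (intro hat_pos) auto
    have "?A * r powr ?x * r * hat r \<le> C * mom (?x + 1)"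
      using N k r powr_proj_lower_log[OF _ N, of _ k] x1 by (intro pair A0) auto
    also have "\<dots> \<le> C * (K * hat (1 - 1 / (2 * (?x + 1))))" using K(2)[of "?x + 1"] x1 C by (intro mult_left_mono) auto
    also have "\<dots> \<le> C * (K * hat r)"
      using C K x1 r unfolding r_def by (intro mult_left_mono hat_mono) (auto intro!: divide_left_mono)
    finally have 1: "?A * (r powr ?x * r) * hat r \<le> C * K * hat r" by (simp add: mult_ac)
    have "exp (-2) \<le> r powr (?x + 1)" unfolding r_def using x1 by (intro one_minus_inverse_powr_ge) auto
    also have "\<dots> = r powr ?x * r" using r by (simp add: powr_add)
    finally have "?A * exp (-2) \<le> ?A * (r powr ?x * r)" using A0 by (intro mult_left_mono)
    also have "\<dots> \<le> C * K" using 1 hr by (rule mult_right_le_imp_le)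
    finally have "?A * exp (-2) * exp 2 \<le> C * K * exp 2" by (intro mult_right_mono) auto
    moreover have "exp (-2) * exp (2::real) = 1" by (simp flip: exp_add)
    ultimately have "?A \<le> C * K * exp 2" by (simp only: mult.assoc[of ?A "exp (-2)" "exp 2"] mult_1_right)
    then show "ln (real k) * mom (2 * real k * real N + 1) \<le> 2 * pi * exp 2 * C * K * mom (2 * real N + 1)"
      using mp by (simp add: field_simps)
  qed
qed

end

section \<open>Pointwise kernel bound\<close>

text \<open>A discrete symbol class: each of the first \<open>k\<close> differences of \<open>a\<close> gains a factor \<open>1/n\<close> over \<open>G\<close>.\<close>

primrec symbol :: "nat \<Rightarrow> (nat \<Rightarrow> real) \<Rightarrow> (nat \<Rightarrow> real) \<Rightarrow> bool" where
  "symbol 0 G a \<longleftrightarrow> (\<exists>C. \<forall>n\<ge>1. \<bar>a n\<bar> \<le> C * G n)"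
| "symbol (Suc k) G a \<longleftrightarrow> (\<exists>C. \<forall>n\<ge>1. \<bar>a n\<bar> \<le> C * G n) \<and> symbol k (\<lambda>n. G n / real n) (\<lambda>n. a n - a (Suc n))"

lemma symbol_order: "symbol (Suc k) G a \<Longrightarrow> symbol k G a"
proof (induction k arbitrary: G a)
  case 0
  then show ?case by (simp only: symbol.simps)
next
  case (Suc k)
  from Suc.prems have *: "\<exists>C. \<forall>n\<ge>1. \<bar>a n\<bar> \<le> C * G n"
    "symbol (Suc k) (\<lambda>n. G n / real n) (\<lambda>n. a n - a (Suc n))"
    unfolding symbol.simps(2)[of "Suc k"] by (rule conjunct1, rule conjunct2)
  from Suc.IH[OF *(2)] *(1) show ?case by (simp only: symbol.simps)
qed

lemma symbol_shift:
  assumes "symbol k G a" "\<And>n. n \<ge> 1 \<Longrightarrow> G n \<ge> 0" "\<And>n. n \<ge> 1 \<Longrightarrow> G (Suc n) \<le> c * G n" "c \<ge> 0"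
  shows "symbol k G (\<lambda>n. a (Suc n))"
  using assms
proof (induction k arbitrary: G a)
  have bd: "\<exists>C. \<forall>n\<ge>1. \<bar>a (Suc n)\<bar> \<le> C * G n"
    if b: "\<exists>C. \<forall>n\<ge>1. \<bar>a n\<bar> \<le> C * G n" and G: "\<And>n. n \<ge> 1 \<Longrightarrow> G n \<ge> 0" "\<And>n. n \<ge> 1 \<Longrightarrow> G (Suc n) \<le> c * G n"
    for a G :: "nat \<Rightarrow> real"
  proof -
    obtain C where C: "\<And>n. n \<ge> 1 \<Longrightarrow> \<bar>a n\<bar> \<le> C * G n" using b by blast
    have "\<bar>a (Suc n)\<bar> \<le> \<bar>C\<bar> * c * G n" if n: "n \<ge> 1" for n
    proof -
      have "\<bar>a (Suc n)\<bar> \<le> C * G (Suc n)" by (rule C) simp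
      also have "\<dots> \<le> \<bar>C\<bar> * G (Suc n)" using G(1)[of "Suc n"] by (intro mult_right_mono) auto
      also have "\<dots> \<le> \<bar>C\<bar> * (c * G n)" using G(2)[OF n] by (intro mult_left_mono) auto
      finally show ?thesis by simp
    qed
    then show ?thesis by blast
  qed
  {
    case 0
    then show ?case using bd[of a G] by simp
  next
    case (Suc k)
    have "symbol k (\<lambda>n. G n / real n) (\<lambda>n. a (Suc n) - a (Suc (Suc n)))"
    proof (rule Suc.IH[where a="\<lambda>n. a n - a (Suc n)"])
      fix n :: nat assume n: "n \<ge> 1"
      have "G (Suc n) / real (Suc n) \<le> G (Suc n) / real n"
        using n Suc.prems(2)[of "Suc n"] by (intro divide_left_mono) auto
      also have "\<dots> \<le> c * G n / real n" using Suc.prems(3)[OF n] by (intro divide_right_mono) auto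
      finally show "G (Suc n) / real (Suc n) \<le> c * (G n / real n)" by simp
      show "0 \<le> G n / real n" using Suc.prems(2)[OF n] by simp
    qed (use Suc.prems in auto)
    then show ?case using bd[of a G] Suc.prems by simp
  }
qed

lemma symbol_add:
  assumes "symbol k G a" "symbol k G b"
  shows "symbol k G (\<lambda>n. a n + b n)"
  using assms
proof (induction k arbitrary: G a b)
  have bd: "\<exists>C. \<forall>n\<ge>1. \<bar>a n + b n\<bar> \<le> C * G n"
    if ab: "\<exists>C. \<forall>n\<ge>1. \<bar>a n\<bar> \<le> C * G n" "\<exists>C. \<forall>n\<ge>1. \<bar>b n\<bar> \<le> C * G n" for a b G :: "nat \<Rightarrow> real"
  proof -
    obtain C where C1: "\<And>n. n \<ge> 1 \<Longrightarrow> \<bar>a n\<bar> \<le> C * G n" using ab(1) by blast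
    obtain C' where C2: "\<And>n. n \<ge> 1 \<Longrightarrow> \<bar>b n\<bar> \<le> C' * G n" using ab(2) by blast
    note C = C1 C2
    have "\<bar>a n + b n\<bar> \<le> (C + C') * G n" if "n \<ge> 1" for n using C[OF that] by (simp add: distrib_right)
    then show ?thesis by blast
  qed
  {
    case 0
    then show ?case using bd[of a G b] by simp
  next
    case (Suc k)
    have "symbol k (\<lambda>n. G n / real n) (\<lambda>n. (a n - a (Suc n)) + (b n - b (Suc n)))"
      using Suc.prems by (intro Suc.IH) auto
    then show ?case using bd[of a G b] Suc.prems by (simp add: algebra_simps)
  }
qed

lemma symbol_minus:
  assumes "symbol k G a" shows "symbol k G (\<lambda>n. - a n)"
  using assms
proof (induction k arbitrary: G a)
  case (Suc k)
  have "symbol k (\<lambda>n. G n / real n) (\<lambda>n. - (a n - a (Suc n)))" using Suc.prems by (intro Suc.IH) auto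
  then show ?case using Suc.prems by simp
qed auto

text \<open>The discrete Leibniz rule: the difference of a product is the difference of
  \<open>a\<close> times \<open>b\<close> plus the shifted \<open>a\<close> times the difference of
  \<open>b\<close>. The growth condition on \<open>G\<close> pays for the shift.\<close>

lemma symbol_mult:
  assumes "symbol k G a" "symbol k H b"
    and "\<And>n. n \<ge> 1 \<Longrightarrow> G n \<ge> 0" "\<And>n. n \<ge> 1 \<Longrightarrow> G (Suc n) \<le> c * G n"
    and "\<And>n. n \<ge> 1 \<Longrightarrow> H n \<ge> 0" "c \<ge> 0"
  shows "symbol k (\<lambda>n. G n * H n) (\<lambda>n. a n * b n)"
  using assms
proof (induction k arbitrary: G H a b)
  have bd: "\<exists>C. \<forall>n\<ge>1. \<bar>a n * b n\<bar> \<le> C * (G n * H n)"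
    if ab: "\<exists>C. \<forall>n\<ge>1. \<bar>a n\<bar> \<le> C * G n" "\<exists>C. \<forall>n\<ge>1. \<bar>b n\<bar> \<le> C * H n" for a b G H :: "nat \<Rightarrow> real"
  proof -
    obtain C where C1: "\<And>n. n \<ge> 1 \<Longrightarrow> \<bar>a n\<bar> \<le> C * G n" using ab(1) by blast
    obtain C' where C2: "\<And>n. n \<ge> 1 \<Longrightarrow> \<bar>b n\<bar> \<le> C' * H n" using ab(2) by blast
    note C = C1 C2
    have "\<bar>a n * b n\<bar> \<le> (C * C') * (G n * H n)" if n: "n \<ge> 1" for n
    proof -
      have "\<bar>a n\<bar> * \<bar>b n\<bar> \<le> (C * G n) * (C' * H n)"
        using C(1)[OF n] C(2)[OF n] order_trans[OF abs_ge_zero C(1)[OF n]] by (intro mult_mono) auto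
      then show ?thesis by (simp add: abs_mult mult_ac)
    qed
    then show ?thesis by blast
  qed
  {
    case 0
    then show ?case using bd[of a G b H] by simp
  next
    case (Suc k)
    have Gn: "G (Suc n) / real (Suc n) \<le> c * (G n / real n)" if n: "n \<ge> 1" for n
    proof -
      have "G (Suc n) / real (Suc n) \<le> G (Suc n) / real n"
        using n Suc.prems(3)[of "Suc n"] by (intro divide_left_mono) auto
      also have "\<dots> \<le> c * G n / real n" using Suc.prems(4)[OF n] by (intro divide_right_mono) auto
      finally show ?thesis by simp
    qed
    have "symbol k (\<lambda>n. G n / real n * H n) (\<lambda>n. (a n - a (Suc n)) * b n)"
      using Suc.prems Gn symbol_order[OF Suc.prems(2)] by (intro Suc.IH) auto
    moreover have "symbol k (\<lambda>n. G n * (H n / real n)) (\<lambda>n. a (Suc n) * (b n - b (Suc n)))"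
      using Suc.prems symbol_shift[OF symbol_order[OF Suc.prems(1)], of c] by (intro Suc.IH) auto
    ultimately have "symbol k (\<lambda>n. G n * H n / real n) (\<lambda>n. (a n - a (Suc n)) * b n + a (Suc n) * (b n - b (Suc n)))"
      by (intro symbol_add) simp_all
    also have "(\<lambda>n. (a n - a (Suc n)) * b n + a (Suc n) * (b n - b (Suc n))) = (\<lambda>n. a n * b n - a (Suc n) * b (Suc n))"
      by (simp add: algebra_simps)
    finally show ?case using bd[of a G b H] Suc.prems by simp
  }
qed

lemma symbol_cong:
  assumes "symbol k G a" "\<And>n. n \<ge> 1 \<Longrightarrow> G n = H n" "\<And>n. n \<ge> 1 \<Longrightarrow> a n = b n"
  shows "symbol k H b"
  using assms
proof (induction k arbitrary: G H a b)
  case 0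
  then obtain C where "\<forall>n\<ge>1. \<bar>a n\<bar> \<le> C * G n" by auto
  then have "\<forall>n\<ge>1. \<bar>b n\<bar> \<le> C * H n" using 0(2,3) by simp
  then show ?case by auto
next
  case (Suc k)
  have "symbol k (\<lambda>n. H n / real n) (\<lambda>n. b n - b (Suc n))"
  proof (rule Suc.IH[of "\<lambda>n. G n / real n" "\<lambda>n. a n - a (Suc n)"])
    show "symbol k (\<lambda>n. G n / real n) (\<lambda>n. a n - a (Suc n))" using Suc.prems(1) by simp
    fix n :: nat assume "n \<ge> 1"
    then show "G n / real n = H n / real n" "a n - a (Suc n) = b n - b (Suc n)"
      using Suc.prems(2)[of n] Suc.prems(3)[of n] Suc.prems(3)[of "Suc n"] by simp_all
  qed
  moreover obtain C where "\<forall>n\<ge>1. \<bar>a n\<bar> \<le> C * G n" using Suc.prems(1) by auto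
  then have "\<forall>n\<ge>1. \<bar>b n\<bar> \<le> C * H n" using Suc.prems(2,3) by simp
  ultimately show ?case by auto
qed

text \<open>The difference of \<open>1 / m\<close> is minus the difference of \<open>m\<close> times
  \<open>1 / m\<close> times its shift. So order \<open>Suc k\<close> follows by the Leibniz rule
  from order \<open>k\<close> of \<open>1 / m\<close>; the condition with \<open>c\<close> controls
  the shift.\<close>

lemma symbol_inverse:
  fixes m :: "nat \<Rightarrow> real"
  assumes "symbol k m m" and m: "\<And>n. m n > 0" "\<And>n. m (Suc n) \<le> m n" "\<And>n. n \<ge> 1 \<Longrightarrow> m n \<le> c * m (Suc n)"
  shows "symbol k (\<lambda>n. 1 / m n) (\<lambda>n. 1 / m n)"
  using assms(1)
proof (induction k)
  have "1 * m (Suc 1) \<le> c * m (Suc 1)" using m(3)[of 1] m(2)[of 1] by simp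
  then have c: "c \<ge> 1" using m(1)[of "Suc 1"] by (rule mult_right_le_imp_le)
  have g: "1 / m (Suc n) \<le> c * (1 / m n)" if "n \<ge> 1" for n
    using m(3)[OF that] m(1)[of n] m(1)[of "Suc n"] by (simp add: field_simps)
  have triv: "\<exists>C. \<forall>n\<ge>1. \<bar>1 / m n\<bar> \<le> C * (1 / m n)"
    by (rule exI[of _ 1]) (use m(1) in \<open>auto simp: abs_of_pos less_imp_le\<close>)
  {
    case 0
    then show ?case using triv by simp
  next
    case (Suc k)
    have IH: "symbol k (\<lambda>n. 1 / m n) (\<lambda>n. 1 / m n)" using Suc.IH symbol_order[OF Suc.prems] by blast
    have sh: "symbol k (\<lambda>n. 1 / m n) (\<lambda>n. 1 / m (Suc n))"
      using symbol_shift[OF IH, of c] g c m(1) by (simp add: less_imp_le)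
    have gg: "symbol k (\<lambda>n. 1 / m n * (1 / m n)) (\<lambda>n. 1 / m n * (1 / m (Suc n)))"
      using symbol_mult[OF IH sh, of c] g c m(1) by (simp add: less_imp_le)
    have dm: "symbol k (\<lambda>n. m n / real n) (\<lambda>n. m n - m (Suc n))" using Suc.prems by simp
    have dmc: "m (Suc n) / real (Suc n) \<le> 1 * (m n / real n)" if "n \<ge> 1" for n
      using m that frac_le[of "m n" "m (Suc n)" "real n" "real (Suc n)"] by (simp add: less_imp_le)
    have "symbol k (\<lambda>n. m n / real n * (1 / m n * (1 / m n))) (\<lambda>n. (m n - m (Suc n)) * (1 / m n * (1 / m (Suc n))))"
      using symbol_mult[OF dm gg, of 1] dmc m(1) by (simp add: less_imp_le)
    then have "symbol k (\<lambda>n. m n / real n * (1 / m n * (1 / m n))) (\<lambda>n. - ((m n - m (Suc n)) * (1 / m n * (1 / m (Suc n)))))"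
      by (rule symbol_minus)
    then have "symbol k (\<lambda>n. (1 / m n) / real n) (\<lambda>n. 1 / m n - 1 / m (Suc n))"
    proof (rule symbol_cong)
      fix n :: nat assume "n \<ge> 1"
      show "m n / real n * (1 / m n * (1 / m n)) = 1 / m n / real n" using m(1)[of n] by simp
      show "- ((m n - m (Suc n)) * (1 / m n * (1 / m (Suc n)))) = 1 / m n - 1 / m (Suc n)"
        using m(1)[of n] m(1)[of "Suc n"] by (simp add: field_simps)
    qed
    then show ?case using triv by simp
  }
qed

text \<open>Summation by parts: \<open>1 - w\<close> times the tail is its first term minus
  \<open>w\<close> times the tail of the differences. Since \<open>norm (1 - w) \<ge> c / M\<close>,
  each step loses \<open>M / c\<close> and regains \<open>1 / M\<close> from the symbol class. After
  \<open>k\<close> steps the series is absolutely summable.\<close>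

lemma symbol_tail_bound:
  assumes "symbol k G a" "c > 0" "\<And>n. n \<ge> 1 \<Longrightarrow> G n \<ge> 0"
    and "\<And>x. 0 \<le> x \<Longrightarrow> x < 1 \<Longrightarrow> summable (\<lambda>n. G n * x ^ n)"
    and "\<And>M. M \<ge> 1 \<Longrightarrow> summable (\<lambda>n. G (n + M) / real (n + M) ^ k)"
    and "\<And>M. M \<ge> 1 \<Longrightarrow> (\<Sum>n. G (n + M) / real (n + M) ^ k) \<le> D * real M * (G M / real M ^ k)"
  shows "\<exists>C. \<forall>M\<ge>1. \<forall>w::complex. norm w < 1 \<longrightarrow> c / real M \<le> norm (1 - w) \<longrightarrow>
     norm (\<Sum>n. of_real (a (n + M)) * w ^ (n + M)) \<le> C * real M * G M"
  using assms
proof (induction k arbitrary: G a)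
  case 0
  obtain C where C: "\<And>n. n \<ge> 1 \<Longrightarrow> \<bar>a n\<bar> \<le> C * G n" using "0.prems"(1) by auto
  show ?case
  proof (intro exI allI impI)
    fix M :: nat and w :: complex assume M: "M \<ge> 1" and w: "norm w < 1"
    have s: "summable (\<lambda>n. \<bar>C\<bar> * G (n + M))" using "0.prems"(5)[OF M] by (intro summable_mult) simp
    have le: "norm (of_real (a (n + M)) * w ^ (n + M)) \<le> \<bar>C\<bar> * G (n + M)" for n
    proof -
      have "norm (of_real (a (n + M)) * w ^ (n + M)) = \<bar>a (n + M)\<bar> * norm w ^ (n + M)" by (simp add: norm_mult norm_power)
      also have "\<dots> \<le> \<bar>a (n + M)\<bar> * 1" using w by (intro mult_left_mono power_le_one) auto
      also have "\<dots> \<le> C * G (n + M)" using C[of "n + M"] M by simp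
      also have "\<dots> \<le> \<bar>C\<bar> * G (n + M)" using "0.prems"(3)[of "n + M"] M by (intro mult_right_mono) auto
      finally show ?thesis .
    qed
    have "norm (\<Sum>n. of_real (a (n + M)) * w ^ (n + M)) \<le> (\<Sum>n. \<bar>C\<bar> * G (n + M))"
      by (rule norm_suminf_le[OF le s])
    also have "\<dots> = \<bar>C\<bar> * (\<Sum>n. G (n + M))" using "0.prems"(5)[OF M] by (intro suminf_mult) simp
    also have "\<dots> \<le> \<bar>C\<bar> * (D * real M * G M)" using "0.prems"(6)[OF M] by (intro mult_left_mono) auto
    finally show "norm (\<Sum>n. of_real (a (n + M)) * w ^ (n + M)) \<le> (\<bar>C\<bar> * D) * real M * G M" by (simp add: mult_ac)
  qed
next
  case (Suc k)
  obtain C where C: "\<And>n. n \<ge> 1 \<Longrightarrow> \<bar>a n\<bar> \<le> C * G n" using Suc.prems(1) by auto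
  have eqk: "G n / real n / real n ^ k = G n / real n ^ Suc k" for n by simp
  have "\<exists>C'. \<forall>M\<ge>1. \<forall>w::complex. norm w < 1 \<longrightarrow> c / real M \<le> norm (1 - w) \<longrightarrow>
     norm (\<Sum>n. of_real (a (n + M) - a (Suc (n + M))) * w ^ (n + M)) \<le> C' * real M * (G M / real M)"
  proof (rule Suc.IH)
    show "symbol k (\<lambda>n. G n / real n) (\<lambda>n. a n - a (Suc n))" using Suc.prems(1) by simp
    show "summable (\<lambda>n. G n / real n * x ^ n)" if x: "0 \<le> x" "x < 1" for x
    proof (rule summable_comparison_test'[OF Suc.prems(4)[OF x], where N=1])
      fix n :: nat assume n: "1 \<le> n"
      have "G n / real n * x ^ n \<le> G n * x ^ n"
        using Suc.prems(3)[OF n] n x by (intro mult_right_mono) (auto simp: divide_le_eq mult_le_cancel_left1)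
      then show "norm (G n / real n * x ^ n) \<le> G n * x ^ n" using Suc.prems(3)[OF n] x by simp
    qed
    show "summable (\<lambda>n. G (n + M) / real (n + M) / real (n + M) ^ k)" if "M \<ge> 1" for M
      using Suc.prems(5)[OF that] unfolding eqk .
    show "(\<Sum>n. G (n + M) / real (n + M) / real (n + M) ^ k) \<le> D * real M * (G M / real M / real M ^ k)" if "M \<ge> 1" for M
      using Suc.prems(6)[OF that] unfolding eqk .
  qed (use Suc.prems in auto)
  then obtain C' where C': "\<And>M w::complex. M \<ge> 1 \<Longrightarrow> norm w < 1 \<Longrightarrow> c / real M \<le> norm (1 - w) \<Longrightarrow>
     norm (\<Sum>n. of_real (a (n + M) - a (Suc (n + M))) * w ^ (n + M)) \<le> C' * real M * (G M / real M)" by blast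
  show ?case
  proof (intro exI allI impI)
    fix M :: nat and w :: complex assume M: "M \<ge> 1" and w: "norm w < 1" "c / real M \<le> norm (1 - w)"
    have sa: "summable (\<lambda>n. of_real (a n) * w ^ n)"
    proof (rule summable_comparison_test'[where N=1])
      show "summable (\<lambda>n. \<bar>C\<bar> * (G n * norm w ^ n))" using w by (intro summable_mult Suc.prems(4)) auto
      fix n :: nat assume n: "n \<ge> 1"
      have "norm (of_real (a n) * w ^ n) = \<bar>a n\<bar> * norm w ^ n" by (simp add: norm_mult norm_power)
      also have "\<dots> \<le> (\<bar>C\<bar> * G n) * norm w ^ n"
        using C[OF n] Suc.prems(3)[OF n] by (intro mult_right_mono order_trans[OF C[OF n]]) auto
      finally show "norm (of_real (a n) * w ^ n) \<le> \<bar>C\<bar> * (G n * norm w ^ n)" by simp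
    qed
    define b where "b = (\<lambda>n. of_real (a (n + M)) * w ^ (n + M))"
    have sb: "summable b" unfolding b_def by (rule summable_ignore_initial_segment[OF sa])
    have sb': "summable (\<lambda>n. b (Suc n))" using sb by (subst summable_Suc_iff)
    define d where "d = (\<lambda>n. of_real (a (n + M) - a (Suc (n + M))) * w ^ (n + M))"
    have wd: "w * d n = w * b n - b (Suc n)" for n by (simp add: d_def b_def algebra_simps)
    have bound: "norm (\<Sum>n. d n) \<le> C' * G M" using C'[OF M w] M by (simp add: d_def)
    \<comment> \<open>The terms \<open>w * d n\<close> telescope against those of \<open>b\<close>,
      and summability of \<open>d\<close> is read off from them by dividing by \<open>w\<close>. At
      \<open>w = 0\<close> both sides vanish because \<open>M \<ge> 1\<close>.\<close>
    have key: "(1 - w) * suminf b = b 0 - w * suminf d"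
    proof (cases "w = 0")
      case True
      then show ?thesis using M by (simp add: b_def power_0_left)
    next
      case False
      have "summable (\<lambda>n. w * d n)" unfolding wd by (intro summable_diff summable_mult sb sb')
      then have sd: "summable d" using False by (simp add: summable_cmult_iff)
      have "w * suminf d = (\<Sum>n. w * d n)" by (rule suminf_mult[OF sd, symmetric])
      also have "\<dots> = w * suminf b - (\<Sum>n. b (Suc n))"
        unfolding wd using sb sb' by (simp add: suminf_diff[symmetric] summable_mult suminf_mult)
      also have "(\<Sum>n. b (Suc n)) = suminf b - b 0" by (rule suminf_split_head[OF sb])
      finally show ?thesis by (simp add: algebra_simps)
    qed
    have b0: "norm (b 0) \<le> \<bar>C\<bar> * G M"
    proof -
      have "norm (b 0) = \<bar>a M\<bar> * norm w ^ M" by (simp add: b_def norm_mult norm_power)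
      also have "\<dots> \<le> \<bar>a M\<bar> * 1" using w by (intro mult_left_mono power_le_one) auto
      also have "\<dots> \<le> C * G M" using C[OF M] by simp
      also have "\<dots> \<le> \<bar>C\<bar> * G M" using Suc.prems(3)[OF M] by (intro mult_right_mono) auto
      finally show ?thesis .
    qed
    have "c / real M * norm (suminf b) \<le> norm (1 - w) * norm (suminf b)" using w by (intro mult_right_mono) auto
    also have "\<dots> = norm (b 0 - w * suminf d)" by (simp add: key[symmetric] norm_mult)
    also have "\<dots> \<le> norm (b 0) + norm w * norm (suminf d)" by (metis norm_mult norm_triangle_ineq4)
    also have "norm w * norm (suminf d) \<le> 1 * norm (suminf d)" using w by (intro mult_right_mono) auto
    also have "norm (b 0) + 1 * norm (suminf d) \<le> (\<bar>C\<bar> + C') * G M" using b0 bound by (simp add: algebra_simps)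
    finally have "c / real M * norm (suminf b) \<le> (\<bar>C\<bar> + C') * G M" by simp
    then have "norm (suminf b) \<le> ((\<bar>C\<bar> + C') / c) * real M * G M" using M \<open>c > 0\<close> by (simp add: field_simps)
    then show "norm (\<Sum>n. of_real (a (n + M)) * w ^ (n + M)) \<le> ((\<bar>C\<bar> + C') / c) * real M * G M" by (simp add: b_def)
  qed
qed

lemma sum_inverse_squares_tail:
  assumes M: "M \<ge> (1::nat)"
  shows "summable (\<lambda>n. 1 / real (n + M) ^ 2)" "(\<Sum>n. 1 / real (n + M) ^ 2) \<le> 2 / real M"
proof -
  have "(\<lambda>n. 2 / real (n + M)) \<longlonglongrightarrow> 0"
    using LIMSEQ_ignore_initial_segment[OF tendsto_mult_right_zero[OF lim_inverse_n, of 2], of M] by (simp add: divide_inverse mult.commute)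
  from telescope_sums'[OF this]
  have t: "(\<lambda>n. 2 / real (n + M) - 2 / real (Suc n + M)) sums (2 / real M)" by simp
  have le: "1 / real (n + M) ^ 2 \<le> 2 / real (n + M) - 2 / real (Suc n + M)" for n
  proof -
    define y where "y = real (n + M)"
    have y: "y \<ge> 1" using M by (simp add: y_def)
    have "1 * y \<le> y * y" using y by (intro mult_right_mono) auto
    then have "2 / (2 * y\<^sup>2) \<le> 2 / (y * (y + 1))"
      using y by (intro frac_le) (auto simp: power2_eq_square algebra_simps intro: mult_pos_pos add_pos_pos)
    then have "1 / y\<^sup>2 \<le> 2 / (y * (y + 1))" by simp
    also have "\<dots> = 2 / y - 2 / (y + 1)" using y by (simp add: field_simps)
    finally show ?thesis by (simp add: y_def add.commute add.left_commute)
  qed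
  show s: "summable (\<lambda>n. 1 / real (n + M) ^ 2)"
    by (rule summable_comparison_test'[OF sums_summable[OF t], where N=0]) (use le in simp)
  show "(\<Sum>n. 1 / real (n + M) ^ 2) \<le> 2 / real M"
    using suminf_le[OF le s sums_summable[OF t]] t by (simp add: sums_iff)
qed

section \<open>The moments as a symbol, and the size of the kernel\<close>

context radial
begin

text \<open>A difference in \<open>n\<close> multiplies the integrand by
  \<open>1 - r\<^sup>2\<close>. Sacrificing \<open>r ^ n\<close>, half of the power, bounds
  \<open>(1 - r\<^sup>2) ^ i\<close> by a constant times \<open>1 / n ^ i\<close>, and doubling
  restores the exponent from \<open>n + 1\<close> to \<open>2 * n + 1\<close>. The induction raises
  \<open>i\<close>, so all \<open>i\<close> are treated at once.\<close>

lemma symbol_moments: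
  assumes K: "\<And>n::nat. mom (real n + 1) \<le> K * mom (2 * real n + 1)"
  shows "symbol k (\<lambda>n. mom (2 * real n + 1) / real n ^ i) (\<lambda>n. LINT r|\<nu>. r ^ (2 * n + 1) * (1 - r\<^sup>2) ^ i)"
proof (induction k arbitrary: i)
  have int: "integrable \<nu> (\<lambda>r. r ^ n * (1 - r\<^sup>2) ^ i)" for n i
  proof (rule integrable_\<nu>_bounded[where B="1 * 1"])
    fix r :: real assume r: "0 \<le> r" "r < 1"
    have "r\<^sup>2 \<le> 1" using r by (simp add: power_le_one)
    then show "\<bar>r ^ n * (1 - r\<^sup>2) ^ i\<bar> \<le> 1 * 1" unfolding abs_mult using r by (intro mult_mono) (auto simp: power_abs power_le_one)
  qed measurable
  have bd: "\<exists>C. \<forall>n\<ge>1. \<bar>LINT r|\<nu>. r ^ (2 * n + 1) * (1 - r\<^sup>2) ^ i\<bar> \<le> C * (mom (2 * real n + 1) / real n ^ i)" for i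
  proof (intro exI allI impI)
    fix n :: nat assume n: "n \<ge> 1"
    have pt: "r ^ (2 * n + 1) * (1 - r\<^sup>2) ^ i \<le> (2 * real i) ^ i / real n ^ i * r ^ (n + 1)" if r: "0 \<le> r" "r < 1" for r
    proof -
      define t where "t = 1 - r\<^sup>2"
      have t: "0 \<le> t" "t \<le> 1" using r by (auto simp: t_def power_le_one)
      have "r\<^sup>2 \<le> exp (- t)" using exp_ge_add_one_self[of "-t"] by (simp add: t_def)
      also have "exp (- t) = (exp (- t / 2))\<^sup>2" by (simp add: power2_eq_square flip: exp_add)
      finally have re: "r \<le> exp (- t / 2)" by (rule power2_le_imp_le) simp
      have rn: "r ^ n \<le> exp (- t / 2) ^ n" using re r by (intro power_mono)
      have ti: "t ^ i * exp (- t / 2) ^ n \<le> (2 * real i) ^ i / real n ^ i"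
      proof (cases "i = 0")
        case True
        then show ?thesis using t by (simp add: power_le_one)
      next
        case False
        define y where "y = real n * t / (2 * real i)"
        have y0: "y \<ge> 0" using t by (simp add: y_def)
        have "y \<le> exp y" using exp_ge_add_one_self[of y] by linarith
        then have "y ^ i \<le> exp y ^ i" using y0 by (intro power_mono)
        also have "exp y ^ i = exp (real i * y)" by (simp add: exp_of_nat_mult)
        also have "real i * y = real n * (t / 2)" using False by (simp add: y_def)
        also have "exp (real n * (t / 2)) = exp (t / 2) ^ n" by (rule exp_of_nat_mult)
        finally have "y ^ i * exp (- t / 2) ^ n \<le> exp (t / 2) ^ n * exp (- t / 2) ^ n" by (intro mult_right_mono) auto
        also have "\<dots> = 1" by (simp flip: power_mult_distrib exp_add)
        finally have "y ^ i * exp (- t / 2) ^ n \<le> 1" .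
        moreover have "y ^ i = real n ^ i * t ^ i / (2 * real i) ^ i" by (simp add: y_def power_divide power_mult_distrib)
        ultimately show ?thesis using n False by (simp add: field_simps)
      qed
      have "r ^ (2 * n + 1) * (1 - r\<^sup>2) ^ i = r ^ (n + 1) * (t ^ i * r ^ n)"
      proof -
        have "r ^ (2 * n + 1) = r ^ (n + 1) * r ^ n" by (simp add: mult_2 flip: power_add)
        then show ?thesis by (simp only: t_def mult_ac)
      qed
      also have "\<dots> \<le> r ^ (n + 1) * (t ^ i * exp (- t / 2) ^ n)" using rn r t by (intro mult_left_mono) auto
      also have "\<dots> \<le> r ^ (n + 1) * ((2 * real i) ^ i / real n ^ i)" using ti r by (intro mult_left_mono) auto
      finally show ?thesis by (simp only: mult.commute)
    qed
    have "(LINT r|\<nu>. r ^ (2 * n + 1) * (1 - r\<^sup>2) ^ i) \<le> (LINT r|\<nu>. (2 * real i) ^ i / real n ^ i * r ^ (n + 1))"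
    proof (rule integral_mono_AE[OF int])
      show "integrable \<nu> (\<lambda>r. (2 * real i) ^ i / real n ^ i * r ^ (n + 1))"
        using int[of "n + 1" 0] by (intro integrable_mult_right) simp
      show "AE r in \<nu>. r ^ (2 * n + 1) * (1 - r\<^sup>2) ^ i \<le> (2 * real i) ^ i / real n ^ i * r ^ (n + 1)"
        using AE_\<nu> by eventually_elim (use pt in auto)
    qed
    also have "\<dots> = (2 * real i) ^ i / real n ^ i * mom (real n + 1)"
      using mom_nat[of "n + 1"] by (simp add: add.commute)
    also have "\<dots> \<le> (2 * real i) ^ i / real n ^ i * (K * mom (2 * real n + 1))" using K by (intro mult_left_mono) auto
    also have "\<dots> = ((2 * real i) ^ i * K) * (mom (2 * real n + 1) / real n ^ i)" by simp
    finally have "(LINT r|\<nu>. r ^ (2 * n + 1) * (1 - r\<^sup>2) ^ i) \<le> ((2 * real i) ^ i * K) * (mom (2 * real n + 1) / real n ^ i)" .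
    moreover have "0 \<le> (LINT r|\<nu>. r ^ (2 * n + 1) * (1 - r\<^sup>2) ^ i)"
    proof (rule integral_nonneg_AE)
      show "AE r in \<nu>. 0 \<le> r ^ (2 * n + 1) * (1 - r\<^sup>2) ^ i"
        using AE_\<nu> by eventually_elim (auto simp: power_le_one)
    qed
    ultimately show "\<bar>LINT r|\<nu>. r ^ (2 * n + 1) * (1 - r\<^sup>2) ^ i\<bar> \<le> ((2 * real i) ^ i * K) * (mom (2 * real n + 1) / real n ^ i)" by simp
  qed
  {
    case 0
    then show ?case using bd[of i] by simp
  next
    case (Suc k)
    have "symbol k (\<lambda>n. mom (2 * real n + 1) / real n ^ i / real n)
       (\<lambda>n. (LINT r|\<nu>. r ^ (2 * n + 1) * (1 - r\<^sup>2) ^ i) - (LINT r|\<nu>. r ^ (2 * Suc n + 1) * (1 - r\<^sup>2) ^ i))"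
    proof (rule symbol_cong[OF Suc.IH[of "Suc i"]])
      fix n :: nat
      have "(LINT r|\<nu>. r ^ (2 * n + 1) * (1 - r\<^sup>2) ^ i) - (LINT r|\<nu>. r ^ (2 * Suc n + 1) * (1 - r\<^sup>2) ^ i)
        = (LINT r|\<nu>. r ^ (2 * n + 1) * (1 - r\<^sup>2) ^ i - r ^ (2 * Suc n + 1) * (1 - r\<^sup>2) ^ i)"
        by (rule Bochner_Integration.integral_diff[symmetric]; rule int)
      also have "(\<lambda>r::real. r ^ (2 * n + 1) * (1 - r\<^sup>2) ^ i - r ^ (2 * Suc n + 1) * (1 - r\<^sup>2) ^ i) = (\<lambda>r. r ^ (2 * n + 1) * (1 - r\<^sup>2) ^ Suc i)"
        by (simp add: fun_eq_iff algebra_simps power2_eq_square)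
      finally show "(LINT r|\<nu>. r ^ (2 * n + 1) * (1 - r\<^sup>2) ^ Suc i) = (LINT r|\<nu>. r ^ (2 * n + 1) * (1 - r\<^sup>2) ^ i) - (LINT r|\<nu>. r ^ (2 * Suc n + 1) * (1 - r\<^sup>2) ^ i)" by simp
    qed simp
    then show ?case using bd[of i] by simp
  }
qed

text \<open>By doubling the reciprocal moments \<open>g\<close> grow at most like the power \<gamma>
  of \<open>n\<close>, so \<open>\<gamma> + 2\<close> summations by parts leave a tail like that of
  the inverse squares. The first \<open>M\<close> terms are each at most \<open>g M\<close>, since
  \<open>g\<close> increases.\<close>

lemma kern_bound:
  assumes K: "\<And>n::nat. mom (real n + 1) \<le> K * mom (2 * real n + 1)" and c: "c > 0"
  obtains C where "C > 0" "\<And>M w. M \<ge> 1 \<Longrightarrow> norm w < 1 \<Longrightarrow> c / real M \<le> norm (1 - w) \<Longrightarrow>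
     norm (kern w) \<le> C * real M / mom (2 * real M + 1)"
proof -
  define m where "m = (\<lambda>n::nat. mom (2 * real n + 1))"
  define g where "g = (\<lambda>n. 1 / m n)"
  have mp: "m n > 0" for n unfolding m_def by (rule mom_pos) simp
  have gp: "g n > 0" for n using mp by (simp add: g_def)
  have mdec: "m n' \<le> m n" if "n \<le> n'" for n n' unfolding m_def using that by (intro mom_mono) auto
  have ginc: "g n \<le> g n'" if "n \<le> n'" for n n' unfolding g_def using mdec[OF that] mp by (intro divide_left_mono) auto
  have K1: "K \<ge> 1"
    using K[of 0] mom_pos[of 1] by simp
  have mdbl: "m n \<le> K * m (2 * n)" for n using K[of "2 * n"] by (simp add: m_def)
  have mS: "m n \<le> K * m (Suc n)" if "n \<ge> 1" for n
  proof -
    have "m n \<le> K * m (2 * n)" by (rule mdbl)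
    also have "\<dots> \<le> K * m (Suc n)" using K1 that by (intro mult_left_mono mdec) auto
    finally show ?thesis .
  qed
  have gdbl: "g (2 ^ j * n) \<le> K ^ j * g n" for j n
  proof (induction j)
    case (Suc j)
    have "g (2 * (2 ^ j * n)) \<le> K * g (2 ^ j * n)"
      using mdbl[of "2 ^ j * n"] mp[of "2 * (2 ^ j * n)"] mp[of "2 ^ j * n"] by (simp add: g_def field_simps)
    also have "\<dots> \<le> K * (K ^ j * g n)" using Suc K1 by (intro mult_left_mono) auto
    finally show ?case by (simp add: mult_ac)
  qed simp
  obtain \<gamma> :: nat where \<gamma>: "K < 2 ^ \<gamma>" using real_arch_pow[of 2 K] by auto
  have growth: "g n \<le> 2 ^ \<gamma> * (real n / real M) ^ \<gamma> * g M" if M: "M \<ge> 1" and n: "n \<ge> M" for M n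
  proof -
    \<comment> \<open>Dyadic rounding: \<open>2 ^ j * M \<le> n < 2 ^ Suc j * M\<close>. Hence
      \<open>Suc j\<close> doublings reach \<open>n\<close>, and \<open>K < 2 ^ \<gamma>\<close>
      turns their cost into a power of \<open>n / M\<close>.\<close>
    define j where "j = (LEAST j. n < 2 ^ Suc j * M)"
    have ex: "\<exists>j. n < 2 ^ Suc j * M"
    proof (rule exI)
      have "n < 2 ^ n" by (rule less_exp)
      also have "\<dots> \<le> 2 ^ Suc n * M" using M by simp
      finally show "n < 2 ^ Suc n * M" .
    qed
    have j1: "n < 2 ^ Suc j * M" unfolding j_def by (rule LeastI_ex[OF ex])
    have j2: "2 ^ j * M \<le> n"
    proof (cases j)
      case (Suc i)
      then have "\<not> n < 2 ^ Suc i * M" using not_less_Least[of i "\<lambda>j. n < 2 ^ Suc j * M"] by (simp add: j_def)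
      then show ?thesis using Suc by simp
    qed (use n in simp)
    have "real (2 ^ j * M) \<le> real n" using j2 by (simp only: of_nat_le_iff)
    then have j3: "2 ^ j \<le> real n / real M" using M by (simp add: pos_le_divide_eq)
    have "g n \<le> g (2 ^ Suc j * M)" using j1 by (intro ginc) auto
    also have "\<dots> \<le> K ^ Suc j * g M" by (rule gdbl)
    also have "\<dots> \<le> (2 ^ \<gamma>) ^ Suc j * g M" using \<gamma> K1 gp[of M] by (intro mult_right_mono power_mono) auto
    also have "(2 ^ \<gamma>) ^ Suc j = 2 ^ \<gamma> * ((2::real) ^ j) ^ \<gamma>" by (simp flip: power_mult add: mult.commute)
    also have "2 ^ \<gamma> * ((2::real) ^ j) ^ \<gamma> * g M \<le> 2 ^ \<gamma> * (real n / real M) ^ \<gamma> * g M"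
      using j3 gp[of M] by (intro mult_right_mono mult_left_mono power_mono) auto
    finally show ?thesis .
  qed
  have term_le: "g (n + M) / real (n + M) ^ (\<gamma> + 2) \<le> (2 ^ \<gamma> * g M / real M ^ \<gamma>) * (1 / real (n + M) ^ 2)" if M: "M \<ge> 1" for n M
  proof -
    have "g (n + M) / real (n + M) ^ (\<gamma> + 2) \<le> 2 ^ \<gamma> * (real (n + M) / real M) ^ \<gamma> * g M / real (n + M) ^ (\<gamma> + 2)"
      using M by (intro divide_right_mono growth) auto
    also have "\<dots> = (2 ^ \<gamma> * g M / real M ^ \<gamma>) * (1 / real (n + M) ^ 2)"
      using M by (simp add: power_divide power_add power2_eq_square del: of_nat_add)
    finally show ?thesis .
  qed
  have ts: "summable (\<lambda>n. g (n + M) / real (n + M) ^ (\<gamma> + 2))" if M: "M \<ge> 1" for M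
    by (rule summable_comparison_test'[OF summable_mult[OF sum_inverse_squares_tail(1)[OF M], of "2 ^ \<gamma> * g M / real M ^ \<gamma>"], where N=0])
       (use term_le[OF M] gp in \<open>simp add: less_imp_le\<close>)
  have tb: "(\<Sum>n. g (n + M) / real (n + M) ^ (\<gamma> + 2)) \<le> (2 ^ \<gamma> * 2) * real M * (g M / real M ^ (\<gamma> + 2))" if M: "M \<ge> 1" for M
  proof -
    have "(\<Sum>n. g (n + M) / real (n + M) ^ (\<gamma> + 2)) \<le> (\<Sum>n. (2 ^ \<gamma> * g M / real M ^ \<gamma>) * (1 / real (n + M) ^ 2))"
      by (rule suminf_le[OF term_le[OF M] ts[OF M] summable_mult[OF sum_inverse_squares_tail(1)[OF M]]])
    also have "\<dots> = (2 ^ \<gamma> * g M / real M ^ \<gamma>) * (\<Sum>n. 1 / real (n + M) ^ 2)"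
      by (rule suminf_mult[OF sum_inverse_squares_tail(1)[OF M]])
    also have "\<dots> \<le> (2 ^ \<gamma> * g M / real M ^ \<gamma>) * (2 / real M)"
      using sum_inverse_squares_tail(2)[OF M] gp[of M] by (intro mult_left_mono) auto
    also have "\<dots> = (2 ^ \<gamma> * 2) * real M * (g M / real M ^ (\<gamma> + 2))"
      using M by (simp add: power_add power2_eq_square mult_ac)
    finally show ?thesis .
  qed
  have "symbol (\<gamma> + 2) (\<lambda>n. mom (2 * real n + 1) / real n ^ 0) (\<lambda>n. LINT r|\<nu>. r ^ (2 * n + 1) * (1 - r\<^sup>2) ^ 0)"
    by (rule symbol_moments[OF K])
  then have "symbol (\<gamma> + 2) m m"
  proof (rule symbol_cong)
    fix n :: nat
    show "(LINT r|\<nu>. r ^ (2 * n + 1) * (1 - r\<^sup>2) ^ 0) = m n" using mom_nat[of "2 * n + 1"] by (simp add: m_def add.commute)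
  qed (simp add: m_def)
  then have sym: "symbol (\<gamma> + 2) g g" unfolding g_def
    by (rule symbol_inverse[where c=K]) (use mp mdec mS in auto)
  have sg: "summable (\<lambda>n. g n * x ^ n)" if "0 \<le> x" "x < 1" for x
    using summable_mult[OF summable_kern_coeff[OF that], of 2] by (simp add: kern_coeff_def g_def m_def mult.assoc[symmetric])
  obtain C where C: "\<And>M w::complex. M \<ge> 1 \<Longrightarrow> norm w < 1 \<Longrightarrow> c / real M \<le> norm (1 - w) \<Longrightarrow>
     norm (\<Sum>n. of_real (g (n + M)) * w ^ (n + M)) \<le> C * real M * g M"
    using symbol_tail_bound[OF sym c less_imp_le[OF gp] sg ts tb] by blast
  show thesis
  proof (rule that)
    show "(\<bar>C\<bar> + 1) > 0" by simp
    fix M :: nat and w :: complex assume M: "M \<ge> 1" and w: "norm w < 1" "c / real M \<le> norm (1 - w)"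
    have cfg: "kern_coeff n = g n / 2" for n by (simp add: kern_coeff_def g_def m_def)
    have sk: "summable (\<lambda>n. of_real (kern_coeff n) * w ^ n)" by (rule summable_norm_cancel[OF summable_kern[OF w(1)]])
    have "kern w = (\<Sum>n. of_real (kern_coeff (n + M)) * w ^ (n + M)) + (\<Sum>n<M. of_real (kern_coeff n) * w ^ n)"
      unfolding kern_def by (rule suminf_split_initial_segment[OF sk])
    also have "(\<Sum>n. of_real (kern_coeff (n + M)) * w ^ (n + M)) = (\<Sum>n. of_real (g (n + M)) * w ^ (n + M)) / 2"
    proof -
      have "summable (\<lambda>n. 2 * (of_real (kern_coeff (n + M)) * w ^ (n + M)))"
        by (intro summable_mult summable_ignore_initial_segment[OF sk])
      then have "summable (\<lambda>n. of_real (g (n + M)) * w ^ (n + M))" by (simp add: cfg)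
      from suminf_divide[OF this, of 2] show ?thesis by (simp add: cfg)
    qed
    finally have "norm (kern w) \<le> norm ((\<Sum>n. of_real (g (n + M)) * w ^ (n + M)) / 2) + norm (\<Sum>n<M. of_real (kern_coeff n) * w ^ n)"
      by (simp only: norm_triangle_ineq)
    also have "\<dots> \<le> \<bar>C\<bar> * real M * g M + real M * g M"
    proof (rule add_mono)
      have "norm ((\<Sum>n. of_real (g (n + M)) * w ^ (n + M)) / 2) \<le> norm (\<Sum>n. of_real (g (n + M)) * w ^ (n + M))"
        by (simp add: norm_divide)
      also have "\<dots> \<le> C * real M * g M" by (rule C[OF M w])
      also have "\<dots> \<le> \<bar>C\<bar> * real M * g M" using gp[of M] by (intro mult_right_mono) auto
      finally show "norm ((\<Sum>n. of_real (g (n + M)) * w ^ (n + M)) / 2) \<le> \<bar>C\<bar> * real M * g M" .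
      have "norm (\<Sum>n<M. of_real (kern_coeff n) * w ^ n) \<le> (\<Sum>n<M. g M)"
      proof (rule sum_norm_le)
        fix n assume n: "n \<in> {..<M}"
        have "norm (of_real (kern_coeff n) * w ^ n) = kern_coeff n * norm w ^ n" using kern_coeff_pos[of n] by (simp add: norm_mult norm_power)
        also have "\<dots> \<le> g n * 1" using w gp[of n] unfolding cfg by (intro mult_mono power_le_one) auto
        also have "\<dots> \<le> g M" using n by (simp add: ginc)
        finally show "norm (of_real (kern_coeff n) * w ^ n) \<le> g M" .
      qed
      then show "norm (\<Sum>n<M. of_real (kern_coeff n) * w ^ n) \<le> real M * g M" by simp
    qed
    also have "\<dots> = (\<bar>C\<bar> + 1) * real M / mom (2 * real M + 1)" by (simp add: g_def m_def distrib_right add_divide_distrib)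
    finally show "norm (kern w) \<le> (\<bar>C\<bar> + 1) * real M / mom (2 * real M + 1)" .
  qed
qed

end

section \<open>The tree kernel\<close>

text \<open>Recovers Hoelder's inequality from a family of Young inequalities by the
  \<open>c\<close> that balances the two summands. For \<open>x = 0\<close> there is no such
  \<open>c\<close>; there, if \<open>R\<close> were positive, the \<open>c\<close> whose second
  summand is \<open>R / 2\<close> would give a contradiction.\<close>

lemma young_optimal:
  fixes p q :: real
  assumes pq: "p > 1" "q > 1" "1 / p + 1 / q = 1" and y: "y > 0" and x: "x \<ge> 0" and R: "R \<ge> 0"
    and le: "\<And>c. c > 0 \<Longrightarrow> R \<le> c powr p * x / p + c powr (- q) * y / q"
  shows "R powr p \<le> y powr (p / q) * x"
proof (cases "x = 0")
  case True
  have "R = 0"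
  proof (rule ccontr)
    assume "R \<noteq> 0"
    then have R: "R > 0" using R by simp
    define c where "c = (2 * y / (q * R)) powr (1 / q)"
    have c: "c > 0" using y R pq by (simp add: c_def)
    have "c powr (- q) = (2 * y / (q * R)) powr (- 1)" using pq by (simp add: c_def powr_powr)
    also have "\<dots> = q * R / (2 * y)" using y R pq by (simp add: powr_minus)
    finally have "c powr (- q) * y / q = R / 2" using y pq by simp
    then show False using le[OF c] True R by simp
  qed
  then show ?thesis using True by simp
next
  case False
  then have x: "x > 0" using x by simp
  define c where "c = (y / x) powr (1 / (p * q))"
  have c: "c > 0" using x y by (simp add: c_def)
  have eq1: "1 - 1 / q = 1 / p" and eq2: "1 - 1 / p = 1 / q" using pq by auto
  have "c powr p = (y / x) powr (1 / q)" using pq by (simp add: c_def powr_powr)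
  also have "\<dots> = y powr (1 / q) / x powr (1 / q)" by (rule powr_divide)
  finally have "c powr p = y powr (1 / q) * x powr (- (1 / q))" unfolding powr_minus divide_inverse .
  then have "c powr p * x = y powr (1 / q) * (x powr 1 * x powr (- (1 / q)))" using x by simp
  also have "x powr 1 * x powr (- (1 / q)) = x powr (1 / p)" unfolding powr_add[symmetric] using eq1 by simp
  finally have 1: "c powr p * x = y powr (1 / q) * x powr (1 / p)" .
  have "c powr (- q) = (y / x) powr (- (1 / p))" using pq by (simp add: c_def powr_powr)
  also have "\<dots> = y powr (- (1 / p)) / x powr (- (1 / p))" by (rule powr_divide)
  also have "\<dots> = y powr (- (1 / p)) * x powr (1 / p)" by (simp only: powr_minus[of x] divide_inverse inverse_inverse_eq)
  finally have "c powr (- q) * y = (y powr 1 * y powr (- (1 / p))) * x powr (1 / p)" using y by simp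
  also have "y powr 1 * y powr (- (1 / p)) = y powr (1 / q)" unfolding powr_add[symmetric] using eq2 by simp
  finally have 2: "c powr (- q) * y = y powr (1 / q) * x powr (1 / p)" .
  have "R \<le> (y powr (1 / q) * x powr (1 / p)) / p + (y powr (1 / q) * x powr (1 / p)) / q"
    using le[OF c] unfolding 1 2 .
  also have "\<dots> = (y powr (1 / q) * x powr (1 / p)) * (1 / p + 1 / q)" by (simp add: distrib_left)
  finally have "R \<le> y powr (1 / q) * x powr (1 / p)" using pq by simp
  then have "R powr p \<le> (y powr (1 / q) * x powr (1 / p)) powr p" using R pq by (intro powr_mono2) auto
  also have "\<dots> = y powr (p / q) * x" using x y pq by (simp add: powr_mult powr_powr)
  finally show ?thesis .
qed

text \<open>Hoelder's inequality against the weight \<open>h\<close> at each point, followed by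
  Tonelli. \<open>R\<close> is any function below the integral operator, so that the lemma serves
  the projection as well as a multiple of an indicator in the weak estimate.\<close>

lemma schur_test:
  fixes M :: "'a measure" and k :: "'a \<Rightarrow> 'a \<Rightarrow> ennreal" and h F R :: "'a \<Rightarrow> real"
  assumes sf: "sigma_finite_measure M"
    and k [measurable]: "(\<lambda>x. k (fst x) (snd x)) \<in> borel_measurable (M \<Otimes>\<^sub>M M)"
    and h [measurable]: "h \<in> borel_measurable M" and h0: "\<And>z. h z > 0"
    and pq: "p > 1" "q > 1" "1 / p + 1 / q = 1" and C: "C > 0"
    and H1: "\<And>z. z \<in> space M \<Longrightarrow> (\<integral>\<^sup>+y. k z y * ennreal (h y powr q) \<partial>M) \<le> ennreal (C * h z powr q)"
    and H2: "\<And>y. y \<in> space M \<Longrightarrow> (\<integral>\<^sup>+z. k z y * ennreal (h z powr p) \<partial>M) \<le> ennreal (C * h y powr p)"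
    and F [measurable]: "F \<in> borel_measurable M" and F0: "\<And>y. F y \<ge> 0" and R0: "\<And>z. R z \<ge> 0"
    and R: "\<And>z. z \<in> space M \<Longrightarrow> ennreal (R z) \<le> (\<integral>\<^sup>+y. k z y * ennreal (F y) \<partial>M)"
  shows "(\<integral>\<^sup>+z. ennreal (R z powr p) \<partial>M) \<le> ennreal (C powr p) * (\<integral>\<^sup>+y. ennreal (F y powr p) \<partial>M)"
proof -
  interpret sigma_finite_measure M by (rule sf)
  interpret P: pair_sigma_finite M M ..
  define G where "G = (\<lambda>y. ennreal ((F y / h y) powr p))"
  have G [measurable]: "G \<in> borel_measurable M" unfolding G_def by measurable
  define X where "X = (\<lambda>z. \<integral>\<^sup>+y. k z y * G y \<partial>M)"
  have kz [measurable]: "(\<lambda>y. k z y) \<in> borel_measurable M" if "z \<in> space M" for z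
    using measurable_compose[OF measurable_Pair1'[OF that] k] by simp
  have [measurable]: "X \<in> borel_measurable M" unfolding X_def by measurable
  have pt: "ennreal (R z powr p) \<le> ennreal (C powr (p / q) * h z powr p) * X z" if z: "z \<in> space M" for z
  proof (cases "X z = \<infinity>")
    case True
    then show ?thesis using C h0[of z] by (simp add: ennreal_mult_top)
  next
    case False
    then obtain x where x: "X z = ennreal x" "x \<ge> 0" by (cases "X z") auto
    have "R z powr p \<le> (C * h z powr q) powr (p / q) * x"
    proof (rule young_optimal[OF pq _ x(2) R0])
      show "C * h z powr q > 0" using C h0[of z] by simp
      fix c :: real assume c: "c > 0"
      have yg: "F y \<le> c powr p / p * (F y / h y) powr p + c powr (- q) / q * h y powr q" for y
      proof -
        have "F y = (c * (F y / h y)) * (h y / c)" using c h0[of y] by simp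
        also have "\<dots> \<le> (c * (F y / h y)) powr p / p + (h y / c) powr q / q"
          using pq c h0[of y] F0[of y] by (intro Youngs_inequality) auto
        also have "(c * (F y / h y)) powr p = c powr p * (F y / h y) powr p" by (rule powr_mult)
        also have "(h y / c) powr q = c powr (- q) * h y powr q"
          by (rule trans[OF powr_divide]) (simp add: powr_minus divide_inverse mult.commute)
        finally show ?thesis by simp
      qed
      have "ennreal (R z) \<le> (\<integral>\<^sup>+y. k z y * ennreal (F y) \<partial>M)" by (rule R[OF z])
      also have "\<dots> \<le> (\<integral>\<^sup>+y. ennreal (c powr p / p) * (k z y * G y) + ennreal (c powr (- q) / q) * (k z y * ennreal (h y powr q)) \<partial>M)"
      proof (rule nn_integral_mono)
        fix y
        have "ennreal (F y) \<le> ennreal (c powr p / p * (F y / h y) powr p + c powr (- q) / q * h y powr q)" by (rule ennreal_leI[OF yg])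
        also have "\<dots> = ennreal (c powr p / p) * G y + ennreal (c powr (- q) / q) * ennreal (h y powr q)"
          using pq unfolding G_def by (subst ennreal_plus) (auto simp flip: ennreal_mult)
        finally have "k z y * ennreal (F y) \<le> k z y * (ennreal (c powr p / p) * G y + ennreal (c powr (- q) / q) * ennreal (h y powr q))"
          by (intro mult_left_mono) auto
        then show "k z y * ennreal (F y) \<le> ennreal (c powr p / p) * (k z y * G y) + ennreal (c powr (- q) / q) * (k z y * ennreal (h y powr q))"
          by (simp add: distrib_left mult_ac)
      qed
      also have "\<dots> = ennreal (c powr p / p) * X z + ennreal (c powr (- q) / q) * (\<integral>\<^sup>+y. k z y * ennreal (h y powr q) \<partial>M)"
        unfolding X_def using kz[OF z] by (subst nn_integral_add) (auto simp: nn_integral_cmult)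
      also have "\<dots> \<le> ennreal (c powr p / p) * ennreal x + ennreal (c powr (- q) / q) * ennreal (C * h z powr q)"
        unfolding x(1) by (intro add_mono mult_left_mono H1[OF z]) auto
      also have "\<dots> = ennreal (c powr p * x / p + c powr (- q) * (C * h z powr q) / q)"
        using pq x(2) C by (subst ennreal_plus) (auto simp flip: ennreal_mult)
      finally show "R z \<le> c powr p * x / p + c powr (- q) * (C * h z powr q) / q"
        using pq x(2) C by (subst (asm) ennreal_le_iff) auto
    qed
    also have "(C * h z powr q) powr (p / q) = C powr (p / q) * h z powr p"
      using pq C h0[of z] by (simp add: powr_mult powr_powr)
    finally show ?thesis unfolding x(1) using x(2) C h0[of z] by (simp add: ennreal_leI flip: ennreal_mult)
  qed
  have "(\<integral>\<^sup>+z. ennreal (R z powr p) \<partial>M) \<le> (\<integral>\<^sup>+z. ennreal (C powr (p / q) * h z powr p) * X z \<partial>M)"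
    by (rule nn_integral_mono) (rule pt)
  also have "\<dots> = (\<integral>\<^sup>+z. (\<integral>\<^sup>+y. ennreal (C powr (p / q)) * (G y * (k z y * ennreal (h z powr p))) \<partial>M) \<partial>M)"
  proof (rule nn_integral_cong)
    fix z assume z: "z \<in> space M"
    show "ennreal (C powr (p / q) * h z powr p) * X z = (\<integral>\<^sup>+y. ennreal (C powr (p / q)) * (G y * (k z y * ennreal (h z powr p))) \<partial>M)"
      unfolding X_def using kz[OF z] by (subst nn_integral_cmult[symmetric]) (auto simp: ennreal_mult mult_ac intro!: nn_integral_cong)
  qed
  also have "\<dots> = (\<integral>\<^sup>+y. (\<integral>\<^sup>+z. ennreal (C powr (p / q)) * (G y * (k z y * ennreal (h z powr p))) \<partial>M) \<partial>M)"
    by (rule P.Fubini'[symmetric]) (simp add: split_beta')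
  also have "\<dots> \<le> (\<integral>\<^sup>+y. ennreal (C powr p) * ennreal (F y powr p) \<partial>M)"
  proof (rule nn_integral_mono)
    fix y assume y: "y \<in> space M"
    have ky [measurable]: "(\<lambda>z. k z y) \<in> borel_measurable M"
      using measurable_compose[OF measurable_Pair2'[OF y] k] by simp
    have "(\<integral>\<^sup>+z. ennreal (C powr (p / q)) * (G y * (k z y * ennreal (h z powr p))) \<partial>M)
      = ennreal (C powr (p / q)) * (G y * (\<integral>\<^sup>+z. k z y * ennreal (h z powr p) \<partial>M))"
      by (simp add: nn_integral_cmult)
    also have "\<dots> \<le> ennreal (C powr (p / q)) * (G y * ennreal (C * h y powr p))"
      by (intro mult_left_mono H2[OF y]) auto
    also have "\<dots> = ennreal (C powr (p / q) * ((F y / h y) powr p * (C * h y powr p)))"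
      unfolding G_def using C by (simp add: ennreal_mult)
    also have "C powr (p / q) * ((F y / h y) powr p * (C * h y powr p)) = C powr (p / q) * C powr 1 * F y powr p"
      using C h0[of y] F0[of y] by (simp add: powr_divide)
    also have "C powr (p / q) * C powr 1 = C powr p"
    proof -
      have "p / q + 1 = p" using pq by (simp add: field_simps)
      then show ?thesis by (simp only: powr_add[symmetric])
    qed
    also have "ennreal (C powr p * F y powr p) = ennreal (C powr p) * ennreal (F y powr p)" by (rule ennreal_mult) auto
    finally show "(\<integral>\<^sup>+z. ennreal (C powr (p / q)) * (G y * (k z y * ennreal (h z powr p))) \<partial>M) \<le> ennreal (C powr p) * ennreal (F y powr p)" .
  qed
  also have "\<dots> = ennreal (C powr p) * (\<integral>\<^sup>+y. ennreal (F y powr p) \<partial>M)" by (rule nn_integral_cmult) measurable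
  finally show ?thesis .
qed

section \<open>Angles, neighbouring arcs and the distance to 1\<close>

definition turn :: "complex \<Rightarrow> real" where "turn z = Arg2pi z / (2 * pi)"

lemma turn_bounds: "0 \<le> turn z" "turn z < 1"
  using Arg2pi_ge_0[of z] Arg2pi_lt_2pi[of z] by (auto simp: turn_def)

lemma turn_eq: "z = of_real (norm z) * cis (2 * pi * turn z)"
  using Arg2pi_eq[of z] by (simp add: turn_def cis_conv_exp)

lemma turn_measurable [measurable]: "turn \<in> borel_measurable borel"
proof -
  have "Arg2pi \<in> borel_measurable borel"
  proof (rule measurable_cong[THEN iffD1])
    show "(\<lambda>z. if z \<in> \<real>\<^sub>\<ge>\<^sub>0 then 0 else Arg2pi z) \<in> borel_measurable borel"
    proof (rule borel_measurable_continuous_on_if)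
      show "\<real>\<^sub>\<ge>\<^sub>0 \<in> sets (borel :: complex measure)" by (intro borel_closed closed_nonneg_Reals_complex)
      show "continuous_on (- \<real>\<^sub>\<ge>\<^sub>0) Arg2pi"
        by (intro continuous_at_imp_continuous_on ballI continuous_at_Arg2pi) auto
    qed auto
    show "(if z \<in> \<real>\<^sub>\<ge>\<^sub>0 then 0 else Arg2pi z) = Arg2pi z" for z
      by (auto simp: nonneg_Reals_def Arg2pi_of_real)
  qed
  then show ?thesis unfolding turn_def by measurable
qed

lemma turn_rotate:
  assumes "z \<noteq> 0" "0 \<le> turn z + \<theta>" "turn z + \<theta> < 1"
  shows "turn (cis (2 * pi * \<theta>) * z) = turn z + \<theta>"
proof -
  have "Arg2pi (cis (2 * pi * \<theta>) * z) = 2 * pi * (turn z + \<theta>)"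
  proof (rule Arg2pi_unique)
    have "cis (2 * pi * \<theta>) * z = of_real (norm z) * (cis (2 * pi * \<theta>) * cis (2 * pi * turn z))"
      using turn_eq[of z] by (metis mult.left_commute)
    also have "\<dots> = of_real (norm z) * cis (2 * pi * (turn z + \<theta>))" by (simp add: cis_mult algebra_simps)
    finally show "of_real (norm z) * exp (\<i> * of_real (2 * pi * (turn z + \<theta>))) = cis (2 * pi * \<theta>) * z" by (simp only: cis_conv_exp)
  qed (use assms in auto)
  then show ?thesis by (simp add: turn_def)
qed

text \<open>Equality or adjacency of arcs when the circle is divided into \<open>N\<close> arcs; the
  last two cases wrap around.\<close>

definition cyc :: "nat \<Rightarrow> nat \<Rightarrow> nat \<Rightarrow> bool" where
  "cyc N i j \<longleftrightarrow> i = j \<or> i = Suc j \<or> j = Suc i \<or> (i = 0 \<and> Suc j = N) \<or> (j = 0 \<and> Suc i = N)"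

lemma cyc_sym: "cyc N i j \<longleftrightarrow> cyc N j i"
  by (auto simp: cyc_def)

text \<open>Parents of neighbouring arcs coincide or are neighbours: \<open>Suc k div b\<close>
  exceeds \<open>k div b\<close> by at most 1, and the last arc lies in the last parent, which
  settles the wrap-around.\<close>

lemma cyc_div: 
  assumes "cyc (b * N) i j" "b > 0" "N > 0"
  shows "cyc N (i div b) (j div b)"
proof -
  have S: "Suc k div b = k div b \<or> Suc k div b = Suc (k div b)" for k by (simp add: div_Suc)
  have last: "k div b = N - 1" if "Suc k = b * N" for k
  proof -
    have k: "k = (b - 1) + b * (N - 1)" using that assms by (cases N; cases b) auto
    have "((b - 1) + b * (N - 1)) div b = (N - 1) + (b - 1) div b" using assms by (intro div_mult_self2) auto
    then show ?thesis using assms unfolding k by simp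
  qed
  show ?thesis
    using assms(1) S[of i] S[of j] last[of i] last[of j] assms(3) unfolding cyc_def by auto
qed

lemma finite_cyc: "finite {j. cyc N i j}" "card {j. cyc N i j} \<le> 4"
proof -
  have *: "{j. cyc N i j} \<subseteq> {i, i - 1, Suc i, (if i = 0 then N - 1 else 0)}" by (auto simp: cyc_def)
  show "finite {j. cyc N i j}" by (rule finite_subset[OF *]) auto
  have "card {j. cyc N i j} \<le> card {i, i - 1, Suc i, (if i = 0 then N - 1 else 0)}" by (rule card_mono[OF _ *]) auto
  also have "\<dots> \<le> 4" by (simp add: card_insert_if)
  finally show "card {j. cyc N i j} \<le> 4" .
qed

lemma sin_ge_half:
  assumes "0 \<le> x" "x \<le> pi / 2" shows "x / 2 \<le> sin x"
proof (cases "x \<le> pi / 3")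
  case True
  have "(\<lambda>x. sin x - x / 2) 0 \<le> (\<lambda>x. sin x - x / 2) x"
  proof (rule DERIV_nonneg_imp_nondecreasing[OF assms(1)])
    fix t assume t: "0 \<le> t" "t \<le> x"
    have "cos (pi / 3) \<le> cos t" using t True pi_gt_zero by (intro cos_monotone_0_pi_le) auto
    then show "\<exists>y. ((\<lambda>x. sin x - x / 2) has_real_derivative y) (at t) \<and> 0 \<le> y"
      by (intro exI[of _ "cos t - 1/2"]) (auto intro!: derivative_eq_intros simp: cos_60)
  qed
  then show ?thesis by simp
next
  case False
  have "sin (pi / 3) \<le> sin x" using False assms pi_gt_zero by (intro sin_monotone_2pi_le) auto
  moreover have "sin (pi / 3) = sqrt 3 / 2" by (rule sin_60)
  moreover have "sqrt 3 \<ge> 17 / 10" by (rule real_le_rsqrt) (simp add: power2_eq_square)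
  moreover have "x / 2 \<le> pi / 4" using assms by simp
  moreover have "pi < 33 / 10" using pi_approx by simp
  ultimately show ?thesis by linarith
qed

lemma sin_ge_half_middle: 
  assumes "0 \<le> y" "y \<le> x" "x \<le> pi - y" "y \<le> pi / 2" shows "y / 2 \<le> sin x"
proof (cases "x \<le> pi / 2")
  case True
  then show ?thesis using sin_ge_half[of x] assms by linarith
next
  case False
  have "(pi - x) / 2 \<le> sin (pi - x)" using False assms by (intro sin_ge_half) auto
  then show ?thesis using assms by simp
qed

text \<open>The squared distance is
  \<open>(1 - \<rho>)\<^sup>2 + 4 * \<rho> * (sin \<beta>)\<^sup>2\<close> with the half angle
  \<beta>, which the bounds on \<open>t\<close> keep away from 0 and pi. For small \<rho> the second
  summand is of no help, but the point is far from 1 anyway.\<close>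

lemma norm_one_minus_cis:
  assumes \<rho>: "0 \<le> \<rho>" "\<rho> < 1" and N: "N \<ge> 2" and t: "1 / N \<le> \<bar>t\<bar>" "\<bar>t\<bar> \<le> 1 - 1 / N"
  shows "1 / (2 * N) \<le> norm (1 - of_real \<rho> * cis (2 * pi * t))"
proof (cases "\<rho> \<le> 1 / 4")
  case True
  have "norm (of_real \<rho> * cis (2 * pi * t)) \<le> 1 / 4" using True \<rho> by (simp add: norm_mult)
  moreover have "1 - norm (of_real \<rho> * cis (2 * pi * t)) \<le> norm (1 - of_real \<rho> * cis (2 * pi * t))"
    using norm_triangle_ineq2[of 1 "of_real \<rho> * cis (2 * pi * t)"] by simp
  moreover have "1 / (2 * N) \<le> 1 / 4" using N by simp
  ultimately show ?thesis by linarith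
next
  case False
  define \<beta> where "\<beta> = pi * \<bar>t\<bar>"
  have "pi * (1 / N) \<le> \<beta>" "\<beta> \<le> pi * (1 - 1 / N)" unfolding \<beta>_def using t by (auto intro!: mult_left_mono simp del: times_divide_eq_right)
  then have "(pi / N) / 2 \<le> sin \<beta>"
    using N pi_gt_zero by (intro sin_ge_half_middle) (auto simp: right_diff_distrib field_simps)
  moreover have "1 / N \<le> (pi / N) / 2" using N pi_gt3 by (simp add: field_simps)
  ultimately have s: "1 / N \<le> sin \<beta>" by linarith
  have sq: "(norm (1 - of_real \<rho> * cis (2 * pi * t)))\<^sup>2 = (1 - \<rho>)\<^sup>2 + 4 * \<rho> * (sin \<beta>)\<^sup>2"
  proof -
    have "cos (2 * pi * t) = cos (2 * \<beta>)" unfolding \<beta>_def by (cases "t \<ge> 0") (auto simp: mult.assoc[symmetric])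
    then have c: "cos (2 * pi * t) = 1 - 2 * (sin \<beta>)\<^sup>2" by (simp add: cos_double_sin)
    have "(norm (1 - of_real \<rho> * cis (2 * pi * t)))\<^sup>2 = (1 - \<rho> * cos (2 * pi * t))\<^sup>2 + (\<rho> * sin (2 * pi * t))\<^sup>2"
      by (simp add: cmod_power2)
    also have "\<dots> = 1 - 2 * \<rho> * cos (2 * pi * t) + \<rho>\<^sup>2 * ((cos (2 * pi * t))\<^sup>2 + (sin (2 * pi * t))\<^sup>2)"
      by (simp add: power2_eq_square algebra_simps del: sin_cos_squared_add sin_cos_squared_add2 sin_cos_squared_add3)
    also have "\<dots> = 1 - 2 * \<rho> * (1 - 2 * (sin \<beta>)\<^sup>2) + \<rho>\<^sup>2" by (simp only: sin_cos_squared_add2 mult_1_right, simp only: c)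
    also have "\<dots> = (1 - \<rho>)\<^sup>2 + 4 * \<rho> * (sin \<beta>)\<^sup>2" by (simp add: power2_eq_square algebra_simps)
    finally show ?thesis .
  qed
  have "(1 / N)\<^sup>2 \<le> (sin \<beta>)\<^sup>2" using s N by (intro power_mono) auto
  also have "\<dots> = 1 * (sin \<beta>)\<^sup>2" by simp
  also have "\<dots> \<le> (4 * \<rho>) * (sin \<beta>)\<^sup>2" using False by (intro mult_right_mono) auto
  also have "\<dots> \<le> (norm (1 - of_real \<rho> * cis (2 * pi * t)))\<^sup>2" unfolding sq by simp
  finally have "1 / N \<le> norm (1 - of_real \<rho> * cis (2 * pi * t))" by (rule power2_le_imp_le) simp
  moreover have "1 / (2 * N) \<le> 1 / N" using N by (simp add: field_simps)
  ultimately show ?thesis by linarith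
qed

lemma power_powr_commute: "(x ^ j) powr t = (x powr t) ^ j" for x t :: real
  by (induction j) (auto simp: powr_mult)

lemma pred_nat_pair:
  fixes f g :: "'a \<Rightarrow> nat"
  assumes f: "f \<in> measurable M (count_space UNIV)" and g: "g \<in> measurable M (count_space UNIV)"
  shows "Measurable.pred M (\<lambda>x. P (f x) (g x))"
  by (rule measurable_compose_countable[where f="\<lambda>n x. P n (g x)" and g=f, OF _ f])
     (rule measurable_compose[OF g], simp)

lemma (in radial) id_\<mu>: "(\<lambda>x. x) \<in> measurable \<mu> borel"
  by (rule borel_\<mu>) simp

lemma (in radial) borel_\<mu>': "f \<in> measurable borel N \<Longrightarrow> f \<in> measurable \<mu> N"
  using measurable_compose[OF id_\<mu>] .

text \<open>
  Generations are indexed by powers of a base \<open>B\<close> that depends on the weight instead of \<open>2\<close>, so that the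
  reverse doubling condition makes the mass of the annuli decay geometrically along generations.
\<close>

locale tree = radial +
  fixes B :: nat and Cd :: real
  assumes B2: "B \<ge> 2"
    and decay: "\<And>k. ann (1 - 1 / real B ^ Suc k) \<le> ann (1 - 1 / real B ^ k) / 2"
    and dbl: "\<And>k. ann (1 - 1 / real B ^ k) \<le> Cd * ann (1 - 1 / real B ^ Suc k)"
begin

definition lev :: "nat \<Rightarrow> real" where "lev k = 1 - 1 / real B ^ k"
definition a :: "nat \<Rightarrow> real" where "a k = ann (lev k)"
definition cel :: "nat \<Rightarrow> complex \<Rightarrow> nat" where "cel k z = nat \<lfloor>real B ^ k * turn z\<rfloor>"
text \<open>The mass of one cell of generation \<open>k\<close> (\<open>cellset_measure\<close>):
  rotation makes all \<open>B ^ k\<close> of them equal.\<close>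

definition v :: "nat \<Rightarrow> real" where "v k = a k / real B ^ k"
definition near :: "nat \<Rightarrow> complex \<Rightarrow> complex \<Rightarrow> bool" where
  "near k z y \<longleftrightarrow> lev k \<le> norm z \<and> lev k \<le> norm y \<and> cyc (B ^ k) (cel k z) (cel k y)"
text \<open>The last generation with \<open>near\<close> would already dominate the Bergman kernel
  (\<open>kern_le_ker\<close>). The sum over all of them is larger but easier to integrate.\<close>

definition ker :: "complex \<Rightarrow> complex \<Rightarrow> ennreal" where
  "ker z y = (\<Sum>k. if near k z y then ennreal (1 / v k) else 0)"
text \<open>On the disk this is the last generation whose cells contain \<open>z\<close>
  (\<open>le_depth_iff\<close>).\<close>

definition depth :: "complex \<Rightarrow> nat" where "depth z = (LEAST k. norm z < lev (Suc k))"

lemma Bpos: "real B ^ k > 0" "B ^ k > 0" "real B ^ k \<ge> 1"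
  using B2 by auto

lemma lev_0: "lev 0 = 0" by (simp add: lev_def)

lemma lev_mono: "i \<le> j \<Longrightarrow> lev i \<le> lev j"
  using B2 by (auto simp: lev_def intro!: divide_left_mono power_increasing)

lemma lev_bounds: "0 \<le> lev k" "lev k < 1"
  using lev_mono[of 0 k] Bpos[of k] by (auto simp: lev_0) (auto simp: lev_def)

lemma lev_half: assumes "k \<ge> 1" shows "lev k \<ge> 1 / 2"
proof -
  have "1 / real B \<le> 1 / 2" using B2 by (intro divide_left_mono) auto
  then have "lev 1 \<ge> 1 / 2" by (simp add: lev_def)
  then show ?thesis using lev_mono[OF assms] by linarith
qed

lemma ann_mono: "r \<le> s \<Longrightarrow> ann s \<le> ann r"
  unfolding ann_def by (intro M.finite_measure_mono) (auto intro!: sets_\<mu>_borel[of "{z. r \<le> norm z}", simplified])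

lemma a_pos: "a k > 0"
proof -
  have "0 < 2 * lev (Suc k) * hat (lev (Suc k))"
    using lev_half[of "Suc k"] lev_bounds[of "Suc k"] by (intro mult_pos_pos hat_pos) auto
  also have "\<dots> \<le> ann (lev (Suc k))" by (rule ann_bounds) (rule lev_bounds)
  also have "\<dots> \<le> ann (lev k)" by (intro ann_mono lev_mono) auto
  finally show ?thesis by (simp add: a_def)
qed

lemma v_pos: "v k > 0" using a_pos Bpos by (simp add: v_def)

lemma a_Suc: "a (Suc k) \<le> a k / 2" "a k \<le> Cd * a (Suc k)"
  using decay[of k] dbl[of k] by (auto simp: a_def lev_def)

lemma a_decay: "a (k + j) \<le> (1 / 2) ^ j * a k"
proof (induction j)
  case (Suc j)
  then show ?case using a_Suc(1)[of "k + j"] by simp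
qed simp

lemma cel_lt: "cel k z < B ^ k"
proof -
  have "real B ^ k * turn z < real B ^ k * 1" using turn_bounds[of z] Bpos by (intro mult_strict_left_mono) auto
  moreover have "0 \<le> real B ^ k * turn z" using turn_bounds[of z] by simp
  ultimately have "\<lfloor>real B ^ k * turn z\<rfloor> < int (B ^ k)" "0 \<le> \<lfloor>real B ^ k * turn z\<rfloor>" by (auto simp: floor_less_iff)
  then show ?thesis unfolding cel_def by linarith
qed

lemma cel_iff: "cel k z = j \<longleftrightarrow> real j \<le> real B ^ k * turn z \<and> real B ^ k * turn z < real j + 1"
proof -
  have "0 \<le> real B ^ k * turn z" using turn_bounds[of z] by simp
  then have "cel k z = j \<longleftrightarrow> \<lfloor>real B ^ k * turn z\<rfloor> = int j" by (auto simp: cel_def)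
  then show ?thesis by (simp add: floor_eq_iff)
qed

lemma cel_div: "cel k z = cel (k + j) z div B ^ j"
proof -
  define x where "x = real B ^ (k + j) * turn z"
  have "\<lfloor>x / of_int (int (B ^ j))\<rfloor> = \<lfloor>x\<rfloor> div int (B ^ j)" by (rule floor_divide_real_eq_div) simp
  then have "\<lfloor>x / real (B ^ j)\<rfloor> = \<lfloor>x\<rfloor> div int (B ^ j)" by (simp only: of_int_of_nat_eq)
  moreover have "x / real (B ^ j) = real B ^ k * turn z" using Bpos[of j] B2 by (simp add: x_def power_add)
  ultimately have "\<lfloor>real B ^ k * turn z\<rfloor> = \<lfloor>x\<rfloor> div int (B ^ j)" by simp
  moreover have "0 \<le> \<lfloor>x\<rfloor>" using turn_bounds[of z] by (simp add: x_def)
  then have "nat (\<lfloor>x\<rfloor> div int (B ^ j)) = nat \<lfloor>x\<rfloor> div nat (int (B ^ j))" by (rule nat_div_distrib)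
  ultimately show ?thesis unfolding cel_def x_def[symmetric] by (simp only: nat_int)
qed

lemma cel_measurable [measurable]: "cel k \<in> measurable borel (count_space UNIV)"
  unfolding cel_def by measurable

lemma near_measurable [measurable]: "Measurable.pred (borel \<Otimes>\<^sub>M borel) (\<lambda>x. near k (fst x) (snd x))"
proof -
  have [measurable]: "Measurable.pred (borel \<Otimes>\<^sub>M borel) (\<lambda>x. cyc (B ^ k) (cel k (fst x)) (cel k (snd x)))"
    by (rule pred_nat_pair) measurable
  show ?thesis unfolding near_def by measurable
qed

lemma depth_measurable [measurable]: "depth \<in> measurable borel (count_space UNIV)"
  unfolding depth_def by measurable

lemma le_depth_iff:
  assumes "z \<in> disk" shows "lev k \<le> norm z \<longleftrightarrow> k \<le> depth z"
proof -
  have "\<exists>k. norm z < lev (Suc k)"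
  proof -
    obtain n where n: "1 / (1 - norm z) < real B ^ n" using real_arch_pow[of "real B"] B2 by auto
    have "real B ^ n \<le> real B ^ Suc n" using B2 by (intro power_increasing) auto
    then have "1 / (1 - norm z) < real B ^ Suc n" using n by linarith
    then have "1 / real B ^ Suc n < 1 - norm z" using assms Bpos[of "Suc n"] by (simp add: field_simps)
    then show ?thesis by (intro exI[of _ n]) (simp add: lev_def)
  qed
  then have 1: "norm z < lev (Suc (depth z))" unfolding depth_def by (rule LeastI_ex)
  show ?thesis
  proof
    assume "lev k \<le> norm z"
    then have "lev k < lev (Suc (depth z))" using 1 by simp
    then show "k \<le> depth z" using lev_mono[of "Suc (depth z)" k] by (meson not_less not_less_eq_eq)
  next
    assume k: "k \<le> depth z"
    show "lev k \<le> norm z"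
    proof (cases k)
      case 0 then show ?thesis by (simp add: lev_0)
    next
      case (Suc i)
      then have "\<not> norm z < lev (Suc i)" using k not_less_Least[of i "\<lambda>k. norm z < lev (Suc k)"] by (simp add: depth_def)
      then show ?thesis using Suc by simp
    qed
  qed
qed

lemma cell_sets [measurable]: "{z \<in> disk. \<rho> \<le> norm z \<and> cel k z = j} \<in> sets \<mu>"
proof -
  have "{z. \<rho> \<le> norm z \<and> cel k z = j} \<in> sets borel" by measurable
  from sets_\<mu>_borel[OF this] show ?thesis by simp
qed

text \<open>Rotation by \<open>i / B ^ k\<close> of a turn carries cell 0 to cell \<open>i\<close>,
  and the cells partition the annulus. The origin, whose angle does not rotate, lies outside for
  \<open>k > 0\<close>; generation 0 has a single cell.\<close>

lemma cell_measure:
  assumes \<rho>: "lev k \<le> \<rho>" and j: "j < B ^ k"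
  shows "emeasure \<mu> {z \<in> disk. \<rho> \<le> norm z \<and> cel k z = j} = ennreal (ann \<rho> / real B ^ k)"
proof (cases "k = 0")
  case True
  have "cel 0 z = 0" for z using cel_lt[of 0 z] by simp
  then show ?thesis using True j by (simp add: ann_def M.emeasure_eq_measure)
next
  case False
  have \<rho>0: "\<rho> > 0" using lev_half[of k] False \<rho> by simp
  define E where "E = (\<lambda>j. {z \<in> disk. \<rho> \<le> norm z \<and> cel k z = j})"
  have rot: "emeasure \<mu> (E i) = emeasure \<mu> (E 0)" if i: "i < B ^ k" for i
  proof -
    define \<theta> where "\<theta> = real i / real B ^ k"
    define c where "c = cis (2 * pi * \<theta>)"
    have "real (Suc i) \<le> real (B ^ k)" using i by (simp only: of_nat_le_iff Suc_le_eq)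
    then have iB: "real i + 1 \<le> real B ^ k" by simp
    have \<theta>: "real B ^ k * \<theta> = real i" using Bpos[of k] by (simp add: \<theta>_def)
    have eq: "cel k (c * z) = i \<longleftrightarrow> cel k z = 0" if z: "z \<noteq> 0" for z
    proof
      assume "cel k z = 0"
      then have t: "real B ^ k * turn z < 1" by (simp add: cel_iff)
      have "real B ^ k * (turn z + \<theta>) < real B ^ k * 1" using t iB by (simp add: distrib_left \<theta>)
      then have lt: "turn z + \<theta> < 1" using Bpos(1)[of k] by (simp only: mult_less_cancel_left_pos)
      have "turn (c * z) = turn z + \<theta>" unfolding c_def
        using lt turn_bounds[of z] Bpos(1)[of k] by (intro turn_rotate z) (auto simp: \<theta>_def)
      then show "cel k (c * z) = i" using t turn_bounds[of z] unfolding cel_iff by (simp add: distrib_left \<theta>)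
    next
      assume "cel k (c * z) = i"
      then have t: "real i \<le> real B ^ k * turn (c * z)" "real B ^ k * turn (c * z) < real i + 1" by (auto simp: cel_iff)
      have ge: "0 \<le> turn (c * z) + - \<theta>"
      proof -
        have "real B ^ k * \<theta> \<le> real B ^ k * turn (c * z)" using t by (simp add: \<theta>)
        then have "\<theta> \<le> turn (c * z)" using Bpos(1)[of k] by (simp only: mult_le_cancel_left_pos)
        then show ?thesis by simp
      qed
      have zc: "cis (2 * pi * (- \<theta>)) * (c * z) = z" by (simp add: c_def mult.assoc[symmetric] cis_mult)
      have "turn (cis (2 * pi * (- \<theta>)) * (c * z)) = turn (c * z) + - \<theta>"
      proof (rule turn_rotate)
        show "c * z \<noteq> 0" using z by (simp add: c_def)
        have "\<theta> \<ge> 0" by (simp add: \<theta>_def)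
        then show "turn (c * z) + - \<theta> < 1" using turn_bounds(2)[of "c * z"] by linarith
      qed (rule ge)
      then have tz: "turn z = turn (c * z) - \<theta>" unfolding zc by simp
      show "cel k z = 0" using t unfolding cel_iff tz by (simp add: right_diff_distrib \<theta>)
    qed
    have nc: "norm c = 1" by (simp add: c_def)
    have S: "{z. \<rho> \<le> norm z \<and> cel k z = i} \<in> sets borel" by measurable
    have "E 0 = {z \<in> disk. c * z \<in> {z. \<rho> \<le> norm z \<and> cel k z = i}}"
    proof -
      have "z \<noteq> 0" if "\<rho> \<le> norm z" for z :: complex using that \<rho>0 by auto
      then show ?thesis unfolding E_def using eq by (auto simp: norm_mult nc)
    qed
    then show ?thesis using emeasure_\<mu>_rotation[OF nc S] by (simp add: E_def)
  qed
  have un: "{z \<in> disk. \<rho> \<le> norm z} = (\<Union>i<B ^ k. E i)" using cel_lt by (auto simp: E_def)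
  have "ennreal (ann \<rho>) = emeasure \<mu> (\<Union>i<B ^ k. E i)" unfolding un[symmetric] by (simp add: ann_def M.emeasure_eq_measure)
  also have "\<dots> = (\<Sum>i<B ^ k. emeasure \<mu> (E i))"
  proof (rule sum_emeasure[symmetric])
    show "E ` {..<B ^ k} \<subseteq> sets \<mu>" unfolding E_def using cell_sets by blast
    show "disjoint_family_on E {..<B ^ k}" by (auto simp: E_def disjoint_family_on_def)
  qed simp
  also have "\<dots> = of_nat (B ^ k) * emeasure \<mu> (E 0)" using rot by simp
  also have "\<dots> = ennreal (real (B ^ k) * measure \<mu> (E 0))"
    by (simp add: M.emeasure_eq_measure ennreal_mult ennreal_of_nat_eq_real_of_nat)
  finally have "ann \<rho> = real B ^ k * measure \<mu> (E 0)" by (simp add: ann_def)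
  then have "measure \<mu> (E 0) = ann \<rho> / real B ^ k" using Bpos[of k] by (simp add: field_simps)
  then show ?thesis using rot[OF j] by (simp add: E_def M.emeasure_eq_measure)
qed

lemma nbd_measure:
  assumes \<rho>: "lev k \<le> \<rho>"
  shows "emeasure \<mu> {y \<in> disk. \<rho> \<le> norm y \<and> cyc (B ^ k) i (cel k y)} \<le> ennreal (4 * (ann \<rho> / real B ^ k))"
proof -
  let ?J = "{j. cyc (B ^ k) i j} \<inter> {..<B ^ k}"
  have fin: "finite ?J" by simp
  have card: "card ?J \<le> 4" using card_mono[OF finite_cyc(1), of ?J "B ^ k" i] finite_cyc(2)[of "B ^ k" i] by simp
  have "emeasure \<mu> {y \<in> disk. \<rho> \<le> norm y \<and> cyc (B ^ k) i (cel k y)}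
     \<le> emeasure \<mu> (\<Union>j\<in>?J. {y \<in> disk. \<rho> \<le> norm y \<and> cel k y = j})"
  proof (rule emeasure_mono)
    show "(\<Union>j\<in>?J. {y \<in> disk. \<rho> \<le> norm y \<and> cel k y = j}) \<in> sets \<mu>"
      by (intro sets.finite_UN fin cell_sets)
  qed (use cel_lt in auto)
  also have "\<dots> \<le> (\<Sum>j\<in>?J. emeasure \<mu> {y \<in> disk. \<rho> \<le> norm y \<and> cel k y = j})"
    using fin cell_sets by (intro emeasure_subadditive_finite) blast+
  also have "\<dots> = (\<Sum>j\<in>?J. ennreal (ann \<rho> / real B ^ k))" by (intro sum.cong refl cell_measure[OF \<rho>]) simp
  also have "\<dots> = of_nat (card ?J) * ennreal (ann \<rho> / real B ^ k)" by simp
  also have "\<dots> \<le> of_nat 4 * ennreal (ann \<rho> / real B ^ k)" using card by (intro mult_right_mono) (auto simp del: of_nat_numeral)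
  also have "\<dots> = ennreal (4 * (ann \<rho> / real B ^ k))" using ennreal_mult'[of 4 "ann \<rho> / real B ^ k"] by simp
  finally show ?thesis .
qed

lemma nbd_sets [measurable]: "{y \<in> disk. \<rho> \<le> norm y \<and> cyc (B ^ k) i (cel k y)} \<in> sets \<mu>"
proof -
  have "{y. \<rho> \<le> norm y \<and> cyc (B ^ k) i (cel k y)} \<in> sets borel" unfolding cyc_def by measurable
  from sets_\<mu>_borel[OF this] show ?thesis by simp
qed

lemma near_sym: "near k z y \<longleftrightarrow> near k y z"
  by (auto simp: near_def cyc_sym)

lemma ker_sym: "ker z y = ker y z"
  by (simp add: ker_def near_sym)

lemma ker_measurable: "(\<lambda>x. ker (fst x) (snd x)) \<in> borel_measurable (\<mu> \<Otimes>\<^sub>M \<mu>)"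
proof -
  have "(\<lambda>x. ker (fst x) (snd x)) \<in> borel_measurable (borel \<Otimes>\<^sub>M borel)"
    unfolding ker_def by measurable
  moreover have "(\<lambda>x. (fst x, snd x)) \<in> measurable (\<mu> \<Otimes>\<^sub>M \<mu>) (borel \<Otimes>\<^sub>M borel)"
    by (intro measurable_Pair measurable_compose[OF measurable_fst id_\<mu>] measurable_compose[OF measurable_snd id_\<mu>])
  ultimately show ?thesis using measurable_compose by fastforce
qed

text \<open>For a common generation \<open>k\<close>, the neighbours of depth \<open>k + j\<close>
  contribute a multiple of \<open>a (k + j) powr (1 - s) / a k\<close>, which is geometric in
  \<open>j\<close> with ratio \<open>q1\<close> because \<open>s < 1\<close>. What remains, the sum
  of \<open>a k powr (- s)\<close> over \<open>k \<le> depth z\<close>, is comparable to its last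
  term, with ratio \<open>q2\<close> because \<open>s > 0\<close>.\<close>

lemma schur_weight:
  assumes s: "0 < s" "s < 1"
  obtains C where "C > 0" "\<And>z. z \<in> disk \<Longrightarrow>
    (\<integral>\<^sup>+y. ker z y * ennreal (a (depth y) powr (- s)) \<partial>\<mu>) \<le> ennreal (C * a (depth z) powr (- s))"
proof -
  define q1 where "q1 = (1 / 2 :: real) powr (1 - s)"
  define q2 where "q2 = (1 / 2 :: real) powr s"
  have q: "0 < q1" "q1 < 1" "0 < q2" "q2 < 1" using s by (auto simp: q1_def q2_def powr_def intro!: mult_pos_neg)
  define D1 where "D1 = 4 * (1 / (1 - q1))"
  have D: "D1 > 0" using q by (simp add: D1_def)
  show thesis
  proof (rule that)
    show "D1 * (1 / (1 - q2)) > 0" using q D by simp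
    fix z assume z: "z \<in> disk"
    define N where "N = (\<lambda>k j. {y \<in> disk. lev (k + j) \<le> norm y \<and> cyc (B ^ k) (cel k z) (cel k y)})"
    have Ns [measurable]: "N k j \<in> sets \<mu>" for k j unfolding N_def by (rule nbd_sets)
    \<comment> \<open>The neighbours of depth exactly \<open>k + j\<close> are enlarged to those of
      depth at least \<open>k + j\<close>, whose measure \<open>nbd_measure\<close>
      provides.\<close>
    define T where "T = (\<lambda>k j y. ennreal (1 / v k) * (ennreal (a (k + j) powr (- s)) * indicator (N k j) y))"
    have Tm [measurable]: "T k j \<in> borel_measurable \<mu>" for k j unfolding T_def by measurable
    have pt: "ker z y * ennreal (a (depth y) powr (- s)) \<le> (\<Sum>k. if k \<le> depth z then (\<Sum>j. T k j y) else 0)" if y: "y \<in> disk" for y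
    proof -
      have "ker z y * ennreal (a (depth y) powr (- s)) = (\<Sum>k. (if near k z y then ennreal (1 / v k) else 0) * ennreal (a (depth y) powr (- s)))"
        unfolding ker_def by (rule ennreal_suminf_multc[symmetric])
      also have "\<dots> \<le> (\<Sum>k. if k \<le> depth z then (\<Sum>j. T k j y) else 0)"
      proof (rule suminf_le)
        fix k
        show "(if near k z y then ennreal (1 / v k) else 0) * ennreal (a (depth y) powr (- s)) \<le> (if k \<le> depth z then (\<Sum>j. T k j y) else 0)"
        proof (cases "near k z y")
          case True
          then have k: "k \<le> depth z" "k \<le> depth y" using le_depth_iff z y by (auto simp: near_def)
          define j where "j = depth y - k"
          have kj: "k + j = depth y" using k by (simp add: j_def)
          have "lev (k + j) \<le> norm y" unfolding kj using le_depth_iff[OF y] by simp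
          then have "y \<in> N k j" using True y by (simp add: N_def near_def)
          then have "ennreal (1 / v k) * ennreal (a (depth y) powr (- s)) = T k j y" by (simp add: T_def kj)
          also have "\<dots> \<le> (\<Sum>j. T k j y)" using sum_le_suminf[of "\<lambda>j. T k j y" "{j}"] by simp
          finally show ?thesis using True k by simp
        qed simp
      qed auto
      finally show ?thesis .
    qed
    have Tint: "(\<Sum>j. \<integral>\<^sup>+y. T k j y \<partial>\<mu>) \<le> ennreal (D1 * a k powr (- s))" for k
    proof -
      have "(\<Sum>j. \<integral>\<^sup>+y. T k j y \<partial>\<mu>) \<le> (\<Sum>j. ennreal (4 * a k powr (- s) * q1 ^ j))"
      proof (rule suminf_le)
        fix j
        have "(\<integral>\<^sup>+y. T k j y \<partial>\<mu>) = ennreal (1 / v k) * (ennreal (a (k + j) powr (- s)) * emeasure \<mu> (N k j))"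
          unfolding T_def by (simp add: nn_integral_cmult)
        also have "\<dots> \<le> ennreal (1 / v k) * (ennreal (a (k + j) powr (- s)) * ennreal (4 * (a (k + j) / real B ^ k)))"
          unfolding N_def a_def[of "k + j"] by (intro mult_left_mono nbd_measure lev_mono) auto
        also have "\<dots> = ennreal (1 / v k * (a (k + j) powr (- s) * (4 * (a (k + j) / real B ^ k))))"
        proof -
          have nn: "0 \<le> 1 / v k" "0 \<le> a (k + j) powr (- s)" using v_pos[of k] by auto
          show ?thesis by (simp only: ennreal_mult'[OF nn(1)] ennreal_mult'[OF nn(2)])
        qed
        also have "\<dots> \<le> ennreal (4 * a k powr (- s) * q1 ^ j)"
        proof (rule ennreal_leI)
          have "a (k + j) powr (1 - s) \<le> ((1 / 2) ^ j * a k) powr (1 - s)" using s a_pos[of "k + j"] a_decay[of k j] by (intro powr_mono2) auto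
          also have "\<dots> = q1 ^ j * a k powr (1 - s)"
            by (simp add: powr_mult q1_def power_powr_commute)
          finally have le: "a (k + j) powr (1 - s) \<le> q1 ^ j * a k powr (1 - s)" .
          have "1 / v k * (a (k + j) powr (- s) * (4 * (a (k + j) / real B ^ k))) = 4 / a k * (a (k + j) powr 1 * a (k + j) powr (- s))"
            using Bpos(1)[of k] a_pos[of "k + j"] by (simp add: v_def)
          also have "\<dots> = 4 / a k * a (k + j) powr (1 - s)"
            by (simp only: powr_add[symmetric] add_uminus_conv_diff)
          also have "\<dots> \<le> 4 / a k * (q1 ^ j * a k powr (1 - s))"
            using a_pos[of k] by (intro mult_left_mono le) auto
          also have "\<dots> = 4 * a k powr (- s) * q1 ^ j"
            using a_pos[of k] by (simp add: powr_diff powr_minus field_simps)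
          finally show "1 / v k * (a (k + j) powr (- s) * (4 * (a (k + j) / real B ^ k))) \<le> 4 * a k powr (- s) * q1 ^ j" .
        qed
        finally show "(\<integral>\<^sup>+y. T k j y \<partial>\<mu>) \<le> ennreal (4 * a k powr (- s) * q1 ^ j)" .
      qed auto
      also have "\<dots> = ennreal (4 * a k powr (- s) * (1 / (1 - q1)))"
        using q by (intro suminf_ennreal_eq sums_mult geometric_sums) auto
      finally show ?thesis by (simp add: D1_def mult_ac)
    qed
    have "(\<integral>\<^sup>+y. ker z y * ennreal (a (depth y) powr (- s)) \<partial>\<mu>)
      \<le> (\<integral>\<^sup>+y. (\<Sum>k. if k \<le> depth z then (\<Sum>j. T k j y) else 0) \<partial>\<mu>)"
      by (rule nn_integral_mono) (use pt in simp)
    also have "\<dots> = (\<Sum>k. \<integral>\<^sup>+y. (if k \<le> depth z then (\<Sum>j. T k j y) else 0) \<partial>\<mu>)"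
      by (rule nn_integral_suminf) measurable
    also have "\<dots> \<le> (\<Sum>k. if k \<le> depth z then ennreal (D1 * a k powr (- s)) else 0)"
    proof (rule suminf_le)
      fix k
      show "(\<integral>\<^sup>+y. (if k \<le> depth z then (\<Sum>j. T k j y) else 0) \<partial>\<mu>) \<le> (if k \<le> depth z then ennreal (D1 * a k powr (- s)) else 0)"
        using Tint[of k] by (simp add: nn_integral_suminf)
    qed auto
    also have "\<dots> = (\<Sum>k\<le>depth z. ennreal (D1 * a k powr (- s)))"
      by (subst suminf_finite[of "{..depth z}"]) auto
    also have "\<dots> = ennreal (\<Sum>k\<le>depth z. D1 * a k powr (- s))" using D by (intro sum_ennreal) auto
    also have "\<dots> \<le> ennreal (D1 * (1 / (1 - q2)) * a (depth z) powr (- s))"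
    proof (rule ennreal_leI)
      have "(\<Sum>k\<le>depth z. D1 * a k powr (- s)) \<le> (\<Sum>k\<le>depth z. D1 * (q2 ^ (depth z - k) * a (depth z) powr (- s)))"
      proof (intro sum_mono mult_left_mono)
        fix k assume k: "k \<in> {..depth z}"
        define j where "j = depth z - k"
        have kj: "depth z = k + j" using k by (simp add: j_def)
        have "a (depth z) powr s \<le> ((1 / 2) ^ j * a k) powr s" unfolding kj using s a_pos[of "k + j"] a_decay[of k j] by (intro powr_mono2) auto
        also have "\<dots> = q2 ^ j * a k powr s"
          by (simp add: powr_mult q2_def power_powr_commute)
        finally have "a (depth z) powr s \<le> q2 ^ j * a k powr s" .
        then show "a k powr (- s) \<le> q2 ^ (depth z - k) * a (depth z) powr (- s)"
          using a_pos[of k] a_pos[of "depth z"] by (simp add: powr_minus j_def[symmetric] field_simps)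
      qed (use D in auto)
      also have "\<dots> = D1 * a (depth z) powr (- s) * (\<Sum>k\<le>depth z. q2 ^ (depth z - k))"
        by (simp add: sum_distrib_left mult_ac)
      also have "\<dots> \<le> D1 * a (depth z) powr (- s) * (1 / (1 - q2))"
      proof (rule mult_left_mono)
        have "(\<Sum>k\<le>depth z. q2 ^ (depth z - k)) = (\<Sum>k\<le>depth z. q2 ^ k)"
          by (rule sum.reindex_bij_witness[of _ "\<lambda>k. depth z - k" "\<lambda>k. depth z - k"]) auto
        also have "\<dots> \<le> (\<Sum>k. q2 ^ k)" using q by (intro sum_le_suminf summable_geometric) auto
        also have "\<dots> = 1 / (1 - q2)" using q by (simp add: suminf_geometric)
        finally show "(\<Sum>k\<le>depth z. q2 ^ (depth z - k)) \<le> 1 / (1 - q2)" .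
      qed (use D in auto)
      finally show "(\<Sum>k\<le>depth z. D1 * a k powr (- s)) \<le> D1 * (1 / (1 - q2)) * a (depth z) powr (- s)"
        by (simp only: mult_ac)
    qed
    finally show "(\<integral>\<^sup>+y. ker z y * ennreal (a (depth y) powr (- s)) \<partial>\<mu>) \<le> ennreal (D1 * (1 / (1 - q2)) * a (depth z) powr (- s))" .
  qed
qed

lemma tree_Lp:
  assumes p: "p > 1"
  obtains C where "C > 0" "\<And>F R :: complex \<Rightarrow> real. F \<in> borel_measurable \<mu> \<Longrightarrow> (\<And>y. F y \<ge> 0) \<Longrightarrow> (\<And>z. R z \<ge> 0) \<Longrightarrow>
    (\<And>z. z \<in> disk \<Longrightarrow> ennreal (R z) \<le> (\<integral>\<^sup>+y. ker z y * ennreal (F y) \<partial>\<mu>)) \<Longrightarrow>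
    (\<integral>\<^sup>+z. ennreal (R z powr p) \<partial>\<mu>) \<le> ennreal C * (\<integral>\<^sup>+y. ennreal (F y powr p) \<partial>\<mu>)"
proof -
  define q where "q = p / (p - 1)"
  have q: "q > 1" "1 / p + 1 / q = 1" using p by (auto simp: q_def field_simps)
  have inv: "0 < 1 / p" "1 / p < 1" "0 < 1 / q" "1 / q < 1" using p q by auto
  obtain C1 where C1: "C1 > 0" "\<And>z. z \<in> disk \<Longrightarrow>
    (\<integral>\<^sup>+y. ker z y * ennreal (a (depth y) powr (- (1 / p))) \<partial>\<mu>) \<le> ennreal (C1 * a (depth z) powr (- (1 / p)))"
    using schur_weight[OF inv(1,2)] by blast
  obtain C2 where C2: "C2 > 0" "\<And>z. z \<in> disk \<Longrightarrow>
    (\<integral>\<^sup>+y. ker z y * ennreal (a (depth y) powr (- (1 / q))) \<partial>\<mu>) \<le> ennreal (C2 * a (depth z) powr (- (1 / q)))"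
    using schur_weight[OF inv(3,4)] by blast
  define C where "C = max C1 C2"
  have C: "C > 0" using C1 by (simp add: C_def)
  \<comment> \<open>The exponent makes \<open>h powr q\<close> and \<open>h powr p\<close> the
    weights of \<open>schur_weight\<close> for \<open>s = 1 / p\<close> and
    \<open>s = 1 / q\<close>, both strictly between 0 and 1.\<close>
  define h where "h = (\<lambda>z. a (depth z) powr (- (1 / (p * q))))"
  have hq: "h y powr q = a (depth y) powr (- (1 / p))" and hp: "h y powr p = a (depth y) powr (- (1 / q))" for y
    using p q by (auto simp: h_def powr_powr)
  have hm: "h \<in> borel_measurable \<mu>" unfolding h_def by (rule borel_\<mu>) measurable
  show thesis
  proof (rule that)
    show "C powr p > 0" using C by simp
    fix F R :: "complex \<Rightarrow> real"
    assume F: "F \<in> borel_measurable \<mu>" "\<And>y. F y \<ge> 0" "\<And>z. R z \<ge> 0"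
      and R: "\<And>z. z \<in> disk \<Longrightarrow> ennreal (R z) \<le> (\<integral>\<^sup>+y. ker z y * ennreal (F y) \<partial>\<mu>)"
    show "(\<integral>\<^sup>+z. ennreal (R z powr p) \<partial>\<mu>) \<le> ennreal (C powr p) * (\<integral>\<^sup>+y. ennreal (F y powr p) \<partial>\<mu>)"
    proof (rule schur_test[OF M.sigma_finite_measure_axioms ker_measurable hm _ p q C])
      fix z assume "z \<in> space \<mu>"
      then have z: "z \<in> disk" by simp
      have "(\<integral>\<^sup>+y. ker z y * ennreal (h y powr q) \<partial>\<mu>) \<le> ennreal (C1 * h z powr q)" unfolding hq by (rule C1(2)[OF z])
      also have "\<dots> \<le> ennreal (C * h z powr q)" by (intro ennreal_leI mult_right_mono) (auto simp: C_def)
      finally show "(\<integral>\<^sup>+y. ker z y * ennreal (h y powr q) \<partial>\<mu>) \<le> ennreal (C * h z powr q)" .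
      have "(\<integral>\<^sup>+y. ker y z * ennreal (h y powr p) \<partial>\<mu>) \<le> ennreal (C2 * h z powr p)" unfolding hp ker_sym[of _ z] by (rule C2(2)[OF z])
      also have "\<dots> \<le> ennreal (C * h z powr p)" by (intro ennreal_leI mult_right_mono) (auto simp: C_def)
      finally show "(\<integral>\<^sup>+y. ker y z * ennreal (h y powr p) \<partial>\<mu>) \<le> ennreal (C * h z powr p)" .
    next
      show "h z > 0" for z using a_pos[of "depth z"] by (simp add: h_def)
    qed (use F R in auto)
  qed
qed

text \<open>Let \<open>k\<close> be the last generation at which the points are near. Failure at
  \<open>Suc k\<close> puts one of them below \<open>lev (Suc k)\<close> or separates their angles
  by a whole arc, so \<open>cnj z * y\<close> keeps the distance \<open>1 / (2 * B ^ Suc k)\<close>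
  from 1. Now \<open>kern_bound\<close> applies with \<open>M = B ^ k\<close>, and its bound is a
  multiple of \<open>1 / v k\<close>.\<close>

lemma kern_le_ker:
  assumes D: "\<omega> \<in> class_D_hat"
  obtains C where "C > 0" "\<And>z y. z \<in> disk \<Longrightarrow> y \<in> disk \<Longrightarrow> ennreal (norm (kern (cnj z * y))) \<le> ennreal C * ker z y"
proof -
  obtain C0 where C0: "C0 \<ge> 1" "\<And>r. 0 \<le> r \<Longrightarrow> r < 1 \<Longrightarrow> hat r \<le> C0 * hat ((1 + r) / 2)"
    using D unfolding class_D_hat_def by blast
  have c: "1 / (2 * real B) > 0" using B2 by simp
  have K: "mom (real n + 1) \<le> (2 * C0) * mom (2 * real n + 1)" for n :: nat
    using C0 by (intro D_hat_moment) auto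
  obtain C1 where C1: "C1 > 0" "\<And>M w. M \<ge> 1 \<Longrightarrow> norm w < 1 \<Longrightarrow> (1 / (2 * real B)) / real M \<le> norm (1 - w) \<Longrightarrow>
     norm (kern w) \<le> C1 * real M / mom (2 * real M + 1)"
    using kern_bound[OF K c] by blast
  define E where "E = 2 * exp 2 * C0\<^sup>2"
  have E: "E > 0" using C0 by (simp add: E_def)
  \<comment> \<open>Two doublings lead from radius \<open>1 - 1 / M\<close> to
    \<open>1 - 1 / (4 * M)\<close>, which is beyond \<open>1 - 1 / (2 * M + 1)\<close>, where the
    moment controls the tail.\<close>
  have mom_a: "a k \<le> E * mom (2 * real (B ^ k) + 1)" for k
  proof -
    define M where "M = real (B ^ k)"
    have M: "M \<ge> 1" using Bpos(3)[of k] by (simp add: M_def)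
    have l: "lev k = 1 - 1 / M" by (simp add: lev_def M_def)
    have r: "0 \<le> 1 - 1 / M" "1 - 1 / M < 1" "0 \<le> 1 - 1 / (2 * M)" "1 - 1 / (2 * M) < 1" using M by auto
    have e: "(1 + (1 - 1 / M)) / 2 = 1 - 1 / (2 * M)" "(1 + (1 - 1 / (2 * M))) / 2 = 1 - 1 / (4 * M)"
      using M by (auto simp: field_simps)
    have "a k \<le> 2 * hat (1 - 1 / M)" unfolding a_def l by (rule ann_bounds(2)[OF r(1)])
    also have "\<dots> \<le> 2 * (C0 * hat (1 - 1 / (2 * M)))" using C0(2)[OF r(1,2)] unfolding e by simp
    also have "\<dots> \<le> 2 * (C0 * (C0 * hat (1 - 1 / (4 * M))))" using C0(2)[OF r(3,4)] C0(1) unfolding e by (intro mult_left_mono) auto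
    also have "\<dots> \<le> 2 * (C0 * (C0 * hat (1 - 1 / (2 * M + 1))))"
      using C0(1) M by (intro mult_left_mono hat_mono) (auto simp: field_simps)
    also have "\<dots> = E * (exp (-2) * hat (1 - 1 / (2 * M + 1)))" by (simp add: E_def power2_eq_square exp_minus)
    also have "\<dots> \<le> E * mom (2 * M + 1)" using E M by (intro mult_left_mono mom_ge_hat_exp) auto
    finally show ?thesis by (simp add: M_def)
  qed
  show thesis
  proof (rule that)
    show CE: "C1 * E > 0" using C1 E by simp
    fix z y assume z: "z \<in> disk" and y: "y \<in> disk"
    define S where "S = {k. near k z y}"
    have S0: "0 \<in> S" using cel_lt[of 0 z] cel_lt[of 0 y] by (auto simp: S_def near_def lev_0 cyc_def)
    have fin: "finite S"
      by (rule finite_subset[of _ "{..depth z}"]) (use le_depth_iff[OF z] in \<open>auto simp: S_def near_def\<close>)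
    define k where "k = Max S"
    have kS: "near k z y" using Max_in[OF fin] S0 by (auto simp: k_def S_def)
    have nS: "\<not> near (Suc k) z y" using Max_ge[OF fin, of "Suc k"] by (auto simp: k_def S_def)
    define w where "w = cnj z * y"
    define N where "N = real B ^ Suc k"
    have N: "N \<ge> 2"
    proof -
      have "2 * 1 \<le> real B * real B ^ k" using B2 Bpos(3)[of k] by (intro mult_mono) auto
      then show ?thesis by (simp add: N_def)
    qed
    have wlt: "norm w < 1" unfolding w_def using z y norm_cnj_mult_le[OF y, of z] by simp
    have dist: "1 / (2 * N) \<le> norm (1 - w)"
    proof (cases "norm z < lev (Suc k) \<or> norm y < lev (Suc k)")
      case True
      have "norm w \<le> norm z" "norm w \<le> norm y" unfolding w_def
        using z y norm_cnj_mult_le[OF y, of z] by (auto simp: norm_mult mult_right_le_one_le mult_left_le_one_le)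
      then have "norm w < 1 - 1 / N" using True by (auto simp: lev_def N_def)
      moreover have "1 - norm w \<le> norm (1 - w)" using norm_triangle_ineq2[of 1 w] by simp
      moreover have "1 / (2 * N) \<le> 1 / N" using N by (simp add: field_simps)
      ultimately show ?thesis by linarith
    next
      case False
      then have nc: "\<not> cyc (B ^ Suc k) (cel (Suc k) z) (cel (Suc k) y)" using nS by (auto simp: near_def)
      define i where "i = cel (Suc k) z"
      define j where "j = cel (Suc k) y"
      have ij: "real i \<le> N * turn z" "N * turn z < real i + 1" "real j \<le> N * turn y" "N * turn y < real j + 1"
        using cel_iff[of "Suc k" z i] cel_iff[of "Suc k" y j] by (auto simp: i_def j_def N_def)
      have lt: "i < B ^ Suc k" "j < B ^ Suc k" using cel_lt[of "Suc k" z] cel_lt[of "Suc k" y] unfolding i_def j_def by blast+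
      have NB: "N = real (B ^ Suc k)" by (simp add: N_def)
      define t where "t = turn y - turn z"
      \<comment> \<open>Arc indices at least 2 apart, also around the circle, leave a full arc
        between the two angles on either side; this gives both bounds.\<close>
      have Nt: "1 \<le> N * \<bar>t\<bar> \<and> N * \<bar>t\<bar> \<le> N - 1"
      proof -
        have "i + 2 \<le> j \<or> j + 2 \<le> i" using nc unfolding cyc_def i_def[symmetric] j_def[symmetric] by linarith
        then show ?thesis
        proof
          assume h: "i + 2 \<le> j"
          have "\<not> (i = 0 \<and> Suc j = B ^ Suc k)" using nc by (auto simp: cyc_def i_def j_def)
          then have "j + 2 \<le> B ^ Suc k + i" using lt by linarith
          then have "real (j + 2) \<le> real (B ^ Suc k + i)" by (simp only: of_nat_le_iff)
          moreover have "real (i + 2) \<le> real j" using h by (simp only: of_nat_le_iff)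
          moreover have "N * t = N * turn y - N * turn z" by (simp add: t_def right_diff_distrib)
          ultimately have "1 \<le> N * t" "N * t \<le> N - 1" using ij NB by auto
          moreover have "t \<ge> 0" using \<open>1 \<le> N * t\<close> N by (smt (verit) mult_nonneg_nonpos)
          ultimately show ?thesis by simp
        next
          assume h: "j + 2 \<le> i"
          have "\<not> (j = 0 \<and> Suc i = B ^ Suc k)" using nc by (auto simp: cyc_def i_def j_def)
          then have "i + 2 \<le> B ^ Suc k + j" using lt by linarith
          then have "real (i + 2) \<le> real (B ^ Suc k + j)" by (simp only: of_nat_le_iff)
          moreover have "real (j + 2) \<le> real i" using h by (simp only: of_nat_le_iff)
          moreover have "N * (- t) = N * turn z - N * turn y" by (simp add: t_def right_diff_distrib)
          ultimately have "1 \<le> N * (- t)" "N * (- t) \<le> N - 1" using ij NB by auto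
          moreover have "- t \<ge> 0" using \<open>1 \<le> N * (- t)\<close> N by (smt (verit) mult_nonneg_nonpos)
          ultimately show ?thesis by simp
        qed
      qed
      have t: "1 / N \<le> \<bar>t\<bar>" "\<bar>t\<bar> \<le> 1 - 1 / N" using Nt N by (auto simp: field_simps)
      have "w = of_real (norm z * norm y) * cis (2 * pi * t)"
      proof -
        have "w = cnj (of_real (norm z) * cis (2 * pi * turn z)) * (of_real (norm y) * cis (2 * pi * turn y))"
          unfolding w_def using turn_eq[of z] turn_eq[of y] by simp
        also have "\<dots> = of_real (norm z * norm y) * (cis (- (2 * pi * turn z)) * cis (2 * pi * turn y))"
          by (simp add: cis_cnj)
        also have "cis (- (2 * pi * turn z)) * cis (2 * pi * turn y) = cis (2 * pi * t)"
          by (simp add: cis_mult t_def algebra_simps)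
        finally show ?thesis .
      qed
      moreover have "norm z * norm y < 1" using wlt by (simp add: w_def norm_mult)
      ultimately show ?thesis using norm_one_minus_cis[of "norm z * norm y" N t] N t by simp
    qed
    have "norm (kern w) \<le> C1 * real (B ^ k) / mom (2 * real (B ^ k) + 1)"
    proof (rule C1(2)[OF _ wlt])
      show "1 \<le> B ^ k" using Bpos(2)[of k] by linarith
      show "1 / (2 * real B) / real (B ^ k) \<le> norm (1 - w)" using dist by (simp add: N_def mult_ac)
    qed
    also have "\<dots> \<le> (C1 * E) * (1 / v k)"
      using mom_a[of k] mom_pos[of "2 * real (B ^ k) + 1"] a_pos[of k] C1(1) E Bpos(1)[of k]
      by (simp add: v_def field_simps)
    finally have "ennreal (norm (kern w)) \<le> ennreal (C1 * E) * ennreal (1 / v k)"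
      using CE v_pos[of k] by (simp add: ennreal_leI flip: ennreal_mult)
    also have "ennreal (1 / v k) \<le> ker z y"
      unfolding ker_def using sum_le_suminf[of "\<lambda>k. if near k z y then ennreal (1 / v k) else 0" "{k}"] kS by simp
    then have "ennreal (C1 * E) * ennreal (1 / v k) \<le> ennreal (C1 * E) * ker z y" by (intro mult_left_mono) auto
    finally show "ennreal (norm (kern (cnj z * y))) \<le> ennreal (C1 * E) * ker z y" by (simp add: w_def)
  qed
qed

end

section \<open>Weak type estimate\<close>

text \<open>The function on the right is the conditional expectation of \<open>F\<close> given
  \<pi>, computed by summing over the countably many fibres. On a fibre of measure zero its value is
  irrelevant, as \<open>w c\<close> vanishes too.\<close>

lemma nn_integral_fibre_average:
  fixes \<pi> :: "'a \<Rightarrow> 'c :: countable" and F :: "'a \<Rightarrow> ennreal"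
  assumes fin: "finite_measure M" and \<pi> [measurable]: "\<pi> \<in> measurable M (count_space UNIV)" and F [measurable]: "F \<in> borel_measurable M"
  defines "w \<equiv> \<lambda>c. \<integral>\<^sup>+x. F x * indicator {c} (\<pi> x) \<partial>M"
    and "m \<equiv> \<lambda>c. emeasure M {x \<in> space M. \<pi> x = c}"
  shows "(\<integral>\<^sup>+x. F x * indicator S (\<pi> x) \<partial>M) = (\<integral>\<^sup>+x. w (\<pi> x) / m (\<pi> x) * indicator S (\<pi> x) \<partial>M)"
proof -
  interpret finite_measure M by (rule fin)
  have split: "(\<integral>\<^sup>+x. G x * indicator S (\<pi> x) \<partial>M)
     = (\<Sum>n. \<integral>\<^sup>+x. (G x * indicator S (\<pi> x)) * (if to_nat (\<pi> x) = n then 1 else 0) \<partial>M)"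
    if G [measurable]: "G \<in> borel_measurable M" for G :: "'a \<Rightarrow> ennreal"
  proof -
    have "(\<integral>\<^sup>+x. G x * indicator S (\<pi> x) \<partial>M) = (\<integral>\<^sup>+x. (\<Sum>n. (G x * indicator S (\<pi> x)) * (if to_nat (\<pi> x) = n then 1 else 0)) \<partial>M)"
    proof (rule nn_integral_cong)
      fix x
      show "G x * indicator S (\<pi> x) = (\<Sum>n. (G x * indicator S (\<pi> x)) * (if to_nat (\<pi> x) = n then 1 else 0))"
        by (subst suminf_finite[of "{to_nat (\<pi> x)}"]) auto
    qed
    also have "\<dots> = (\<Sum>n. \<integral>\<^sup>+x. (G x * indicator S (\<pi> x)) * (if to_nat (\<pi> x) = n then 1 else 0) \<partial>M)"
      by (rule nn_integral_suminf) measurable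
    finally show ?thesis .
  qed
  have gm: "(\<lambda>x. w (\<pi> x) / m (\<pi> x)) \<in> borel_measurable M"
    by (rule measurable_compose[OF \<pi>]) simp
  have "(\<integral>\<^sup>+x. (F x * indicator S (\<pi> x)) * (if to_nat (\<pi> x) = n then 1 else 0) \<partial>M)
      = (\<integral>\<^sup>+x. (w (\<pi> x) / m (\<pi> x) * indicator S (\<pi> x)) * (if to_nat (\<pi> x) = n then 1 else 0) \<partial>M)" for n
  proof (cases "n \<in> range (to_nat :: 'c \<Rightarrow> nat)")
    case False
    then have "\<not> to_nat (\<pi> x) = n" for x by auto
    then show ?thesis by simp
  next
    case True
    then obtain c :: 'c where c: "n = to_nat c" by auto
    have e: "(G x * indicator S (\<pi> x)) * (if to_nat (\<pi> x) = n then 1 else 0) = indicator S c * (G x * indicator {c} (\<pi> x))" for G :: "'a \<Rightarrow> ennreal" and x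
      by (auto simp: c indicator_def)
    have sets: "{x \<in> space M. \<pi> x = c} \<in> sets M" by measurable
    have "w c / m c * m c = w c"
    proof (cases "m c = 0")
      case True
      have "AE x in M. \<not> (\<pi> x = c)"
        using True sets unfolding m_def by (subst AE_iff_measurable[of "{x \<in> space M. \<pi> x = c}"]) auto
      then have "w c = (\<integral>\<^sup>+x. 0 \<partial>M)" unfolding w_def
        by (intro nn_integral_cong_AE) (auto elim!: eventually_mono simp: indicator_def)
      then show ?thesis by simp
    next
      case False
      have "m c \<noteq> top" unfolding m_def by simp
      have "w c / m c * m c = w c * m c / m c" by (simp only: mult.commute[of _ "m c"] ennreal_times_divide)
      then show ?thesis using False \<open>m c \<noteq> top\<close> by (simp add: mult_divide_eq_ennreal)
    qed
    moreover have "(\<integral>\<^sup>+x. w (\<pi> x) / m (\<pi> x) * indicator {c} (\<pi> x) \<partial>M) = w c / m c * m c"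
    proof -
      have "(\<integral>\<^sup>+x. w (\<pi> x) / m (\<pi> x) * indicator {c} (\<pi> x) \<partial>M) = (\<integral>\<^sup>+x. w c / m c * indicator {x \<in> space M. \<pi> x = c} x \<partial>M)"
        by (rule nn_integral_cong) (auto simp: indicator_def)
      also have "\<dots> = w c / m c * m c" unfolding m_def by (rule nn_integral_cmult_indicator[OF sets])
      finally show ?thesis .
    qed
    moreover have "(\<integral>\<^sup>+x. F x * indicator {c} (\<pi> x) \<partial>M) = w c" by (simp add: w_def)
    ultimately show ?thesis unfolding e[of F] e[of "\<lambda>x. w (\<pi> x) / m (\<pi> x)"] using gm by (simp add: nn_integral_cmult)
  qed
  then show ?thesis unfolding split[OF F] split[OF gm] by simp
qed

context tree
begin

definition cellset :: "nat \<Rightarrow> nat \<Rightarrow> complex set" where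
  "cellset k j = {y \<in> disk. lev k \<le> norm y \<and> cel k y = j}"

lemma cellset_sets: "cellset k j \<in> sets \<mu>"
  unfolding cellset_def by (rule cell_sets)

lemma cel_anc: "i \<le> l \<Longrightarrow> cel i z = cel l z div B ^ (l - i)"
  using cel_div[of i z "l - i"] by simp

lemma cellset_measure: "j < B ^ k \<Longrightarrow> emeasure \<mu> (cellset k j) = ennreal (v k)"
  unfolding cellset_def v_def a_def by (rule cell_measure) auto

lemma level_measurable: "g \<in> measurable borel (count_space UNIV) \<Longrightarrow> (\<lambda>z. cel (g z) z) \<in> measurable borel (count_space UNIV)"
  by (rule measurable_compose_countable[where f="\<lambda>k z. cel k z"]) (rule cel_measurable)

lemma ennreal_divide_le:
  assumes "w \<le> ennreal (c * m)" "m > 0" "c \<ge> 0" shows "w / ennreal m \<le> ennreal c"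
proof -
  have "w / ennreal m \<le> ennreal (c * m) / ennreal m" using assms(1) by (rule divide_right_mono_ennreal)
  also have "\<dots> = ennreal c" using assms by (simp add: divide_ennreal)
  finally show ?thesis .
qed

lemma tree_weak:
  obtains C where "C > 0" "\<And>F t. F \<in> borel_measurable \<mu> \<Longrightarrow> (\<And>y. F y \<ge> (0::real)) \<Longrightarrow> t > 0 \<Longrightarrow>
    ennreal t * emeasure \<mu> {z \<in> disk. ennreal t < (\<integral>\<^sup>+y. ker z y * ennreal (F y) \<partial>\<mu>)} \<le> ennreal C * (\<integral>\<^sup>+y. ennreal (F y) \<partial>\<mu>)"
proof -
  have "(1::real) < 2" by simp
  from tree_Lp[OF this] obtain C2 where C2: "C2 > 0" "\<And>F R :: complex \<Rightarrow> real. F \<in> borel_measurable \<mu> \<Longrightarrow> (\<And>y. F y \<ge> 0) \<Longrightarrow> (\<And>z. R z \<ge> 0) \<Longrightarrow>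
    (\<And>z. z \<in> disk \<Longrightarrow> ennreal (R z) \<le> (\<integral>\<^sup>+y. ker z y * ennreal (F y) \<partial>\<mu>)) \<Longrightarrow>
    (\<integral>\<^sup>+z. ennreal (R z powr 2) \<partial>\<mu>) \<le> ennreal C2 * (\<integral>\<^sup>+y. ennreal (F y powr 2) \<partial>\<mu>)"
    by blast
  \<comment> \<open>The 2 serves cells from which the next generation, at most half of the mass, has
    been removed; \<open>B * Cd\<close> bounds the ratio of the masses of a parent and a child
    cell.\<close>
  define C' where "C' = max 2 (real B * Cd)"
  have C': "C' \<ge> 2" "C' \<ge> real B * Cd" by (auto simp: C'_def)
  show thesis
  proof (rule that)
    show "4 + C2 * C' > 0" using C2 C' by (intro add_pos_pos mult_pos_pos) auto
    fix F :: "complex \<Rightarrow> real" and t :: real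
    assume F: "F \<in> borel_measurable \<mu>" and "\<And>y. F y \<ge> 0" and t: "t > 0"
    have Fe [measurable]: "(\<lambda>y. ennreal (F y)) \<in> borel_measurable \<mu>" using F by measurable
    define I where "I = (\<integral>\<^sup>+y. ennreal (F y) \<partial>\<mu>)"
    define mass where "mass = (\<lambda>k j. \<integral>\<^sup>+y. ennreal (F y) * indicator (cellset k j) y \<partial>\<mu>)"
    define bad where "bad = (\<lambda>k j. ennreal (t * v k) < mass k j)"
    define AF where "AF = (\<lambda>z. \<integral>\<^sup>+y. ker z y * ennreal (F y) \<partial>\<mu>)"
    note [measurable] = cellset_sets
    have mass_le: "mass k j \<le> I" for k j unfolding mass_def I_def
      by (intro nn_integral_mono) (auto simp: indicator_def)
    have AFm: "(\<lambda>z. \<integral>\<^sup>+y. ker z y * H y \<partial>\<mu>) \<in> borel_measurable \<mu>" if "H \<in> borel_measurable \<mu>" for H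
    proof -
      note [measurable] = ker_measurable that
      show ?thesis by (rule M.borel_measurable_nn_integral) (simp add: split_beta')
    qed
    have AFset: "{z \<in> disk. ennreal t < (\<integral>\<^sup>+y. ker z y * H y \<partial>\<mu>)} \<in> sets \<mu>" if "H \<in> borel_measurable \<mu>" for H
      using borel_measurable_less[OF _ AFm[OF that], of "\<lambda>_. ennreal t"] by simp
    show "ennreal t * emeasure \<mu> {z \<in> disk. ennreal t < (\<integral>\<^sup>+y. ker z y * ennreal (F y) \<partial>\<mu>)} \<le> ennreal (4 + C2 * C') * (\<integral>\<^sup>+y. ennreal (F y) \<partial>\<mu>)"
    proof (cases "bad 0 0")
      \<comment> \<open>If the only cell of generation 0 is bad, the measure of the whole disk is
        already small enough. Otherwise every maximal bad cell has a parent, and the parent is not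
        bad.\<close>
      case True
      have "cellset 0 0 = disk" using cel_lt[of 0] by (auto simp: cellset_def lev_0)
      then have d: "emeasure \<mu> disk = ennreal (v 0)" using cellset_measure[of 0 0] by simp
      have "ennreal t * emeasure \<mu> {z \<in> disk. ennreal t < (\<integral>\<^sup>+y. ker z y * ennreal (F y) \<partial>\<mu>)} \<le> ennreal t * emeasure \<mu> disk"
        using sets.top[of \<mu>] by (intro mult_left_mono emeasure_mono) auto
      also have "\<dots> = ennreal (t * v 0)" unfolding d using t v_pos[of 0] by (simp add: ennreal_mult)
      also have "\<dots> \<le> I" using True mass_le[of 0 0] by (simp add: bad_def)
      also have "I = ennreal 1 * I" by simp
      also have "\<dots> \<le> ennreal (4 + C2 * C') * I" using C2 C' by (intro mult_right_mono ennreal_leI) auto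
      finally show ?thesis by (simp add: I_def)
    next
      case nb0: False
      \<comment> \<open>The fibres of \<open>\<pi>\<close> are the maximal bad cells and, off their union, the cells cut down to points of
        equal depth. The kernel does not see below these fibres, so averaging \<open>F\<close> over them leaves no
        error term that would need smoothness of the kernel.\<close>
      define isb where "isb = (\<lambda>z l. lev l \<le> norm z \<and> bad l (cel l z))"
      define hb where "hb = (\<lambda>z. \<exists>l. isb z l)"
      define bl where "bl = (\<lambda>z. LEAST l. isb z l)"
      define lv where "lv = (\<lambda>z. if hb z then bl z else depth z)"
      define \<pi> where "\<pi> = (\<lambda>z. (hb z, lv z, cel (lv z) z))"
      have isbm [measurable]: "Measurable.pred borel (\<lambda>z. isb z l)" for l
        unfolding isb_def by measurable
      have hbm [measurable]: "Measurable.pred borel hb" unfolding hb_def by measurable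
      have lvm [measurable]: "lv \<in> measurable borel (count_space UNIV)"
        unfolding lv_def bl_def by measurable
      have \<pi>m: "\<pi> \<in> measurable \<mu> (count_space UNIV)"
      proof (rule borel_\<mu>')
        have cl: "(\<lambda>z. cel (lv z) z) \<in> measurable borel (count_space UNIV)" by (rule level_measurable[OF lvm])
        have inner: "(\<lambda>z. (b, l, cel (lv z) z)) \<in> measurable borel (count_space UNIV)" for b :: bool and l :: nat
          by (rule measurable_compose[OF cl]) simp
        have mid: "(\<lambda>z. (b, lv z, cel (lv z) z)) \<in> measurable borel (count_space UNIV)" for b :: bool
          by (rule measurable_compose_countable[where f="\<lambda>l z. (b, l, cel (lv z) z)", OF inner lvm])
        show "\<pi> \<in> measurable borel (count_space UNIV)" unfolding \<pi>_def
          by (rule measurable_compose_countable[where f="\<lambda>b z. (b, lv z, cel (lv z) z)", OF mid hbm])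
      qed
      have bl: "isb z (bl z)" "i < bl z \<Longrightarrow> \<not> isb z i" if "hb z" for z i
        using that LeastI_ex[of "isb z"] not_less_Least[of i "isb z"] by (auto simp: hb_def bl_def)
      have bl_eq: "bl z = l" if "isb z l" "\<And>i. i < l \<Longrightarrow> \<not> isb z i" for z l
        unfolding bl_def using that by (intro Least_equality) (auto simp: not_less[symmetric])
      \<comment> \<open>Whether a point lies in a bad cell of generation \<open>i \<le> l\<close>
        depends only on its cell of generation \<open>l\<close>. This is why the fibres over bad
        points are entire cells.\<close>
      have isb_anc: "isb z i \<longleftrightarrow> isb y i" if "cel l z = cel l y" "lev l \<le> norm z" "lev l \<le> norm y" "i \<le> l" for z y l i
        using that cel_anc[of i l z] cel_anc[of i l y] lev_mono[of i l] by (auto simp: isb_def)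
      have bl_pos: "bl z > 0" if "hb z" for z
      proof (rule ccontr)
        assume "\<not> bl z > 0"
        then have "bad 0 (cel 0 z)" using bl(1)[OF that] by (simp add: isb_def)
        then show False using nb0 cel_lt[of 0 z] by simp
      qed
      have \<pi>D: "hb y = hb z" "lv y = lv z" "cel (lv z) y = cel (lv z) z" if "\<pi> y = \<pi> z" for y z
      proof -
        have "hb y = hb z \<and> lv y = lv z \<and> cel (lv y) y = cel (lv z) z" using that unfolding \<pi>_def prod.inject .
        then show "hb y = hb z" "lv y = lv z" "cel (lv z) y = cel (lv z) z" by metis+
      qed
      have fib_bad: "{y \<in> disk. \<pi> y = \<pi> z} = cellset (bl z) (cel (bl z) z)" if z: "z \<in> disk" "hb z" for z
      proof -
        let ?l = "bl z"
        have lz: "lev ?l \<le> norm z" using bl(1)[OF z(2)] by (simp add: isb_def)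
        have "\<pi> y = \<pi> z" if y: "lev ?l \<le> norm y" "cel ?l y = cel ?l z" for y
        proof -
          have an: "isb y i \<longleftrightarrow> isb z i" if "i \<le> ?l" for i by (rule isb_anc[OF y(2) y(1) lz that])
          have "isb y ?l" using an[of ?l] bl(1)[OF z(2)] by simp
          moreover have "bl y = ?l" by (rule bl_eq[OF \<open>isb y ?l\<close>]) (use an bl(2)[OF z(2)] in auto)
          ultimately show ?thesis using z y by (auto simp: \<pi>_def lv_def hb_def)
        qed
        moreover have "lev ?l \<le> norm y \<and> cel ?l y = cel ?l z" if "\<pi> y = \<pi> z" for y
        proof -
          have "hb y" "bl y = ?l" "cel (bl y) y = cel ?l z" using \<pi>D[OF that] z by (simp_all add: lv_def)
          then show ?thesis using bl(1)[of y] by (simp add: isb_def)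
        qed
        ultimately show ?thesis unfolding cellset_def by blast
      qed
      have fib_good: "{y \<in> disk. \<pi> y = \<pi> z} = cellset (depth z) (cel (depth z) z) - {y \<in> disk. lev (Suc (depth z)) \<le> norm y \<and> cel (depth z) y = cel (depth z) z}"
        if z: "z \<in> disk" "\<not> hb z" for z
      proof -
        let ?d = "depth z"
        have eq: "\<pi> y = \<pi> z \<longleftrightarrow> depth y = ?d \<and> cel ?d y = cel ?d z" if y: "y \<in> disk" for y
        proof
          assume "\<pi> y = \<pi> z"
          note h = \<pi>D[OF this]
          have lz: "lv z = ?d" using z(2) by (simp add: lv_def)
          have ly: "lv y = depth y" using z(2) unfolding h(1)[symmetric] by (simp add: lv_def)
          show "depth y = ?d \<and> cel ?d y = cel ?d z" using h(2,3) unfolding lz ly by blast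
        next
          assume h: "depth y = ?d \<and> cel ?d y = cel ?d z"
          have ly: "lev ?d \<le> norm y" using le_depth_iff[OF y, of ?d] h by simp
          have lz: "lev ?d \<le> norm z" using le_depth_iff[OF z(1), of ?d] by simp
          have "\<not> isb y l" for l
          proof
            assume l: "isb y l"
            then have "l \<le> ?d" using le_depth_iff[OF y, of l] h by (simp add: isb_def)
            then have "isb z l" using isb_anc[of ?d y z l] l h ly lz by auto
            then show False using z by (auto simp: hb_def)
          qed
          then have "\<not> hb y" by (simp add: hb_def)
          then show "\<pi> y = \<pi> z" using z h by (simp add: \<pi>_def lv_def)
        qed
        show ?thesis
        proof (rule set_eqI)
          fix y
          show "y \<in> {y \<in> disk. \<pi> y = \<pi> z} \<longleftrightarrow> y \<in> cellset ?d (cel ?d z) - {y \<in> disk. lev (Suc ?d) \<le> norm y \<and> cel ?d y = cel ?d z}"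
          proof (cases "y \<in> disk")
            case True
            have "depth y = ?d \<longleftrightarrow> lev ?d \<le> norm y \<and> \<not> lev (Suc ?d) \<le> norm y"
              unfolding le_depth_iff[OF True] by linarith
            then show ?thesis using True eq[OF True] unfolding cellset_def by blast
          qed (simp add: cellset_def)
        qed
      qed
      define w where "w = (\<lambda>c. \<integral>\<^sup>+y. ennreal (F y) * indicator {c} (\<pi> y) \<partial>\<mu>)"
      define m where "m = (\<lambda>c. emeasure \<mu> {y \<in> space \<mu>. \<pi> y = c})"
      define g where "g = (\<lambda>y. w (\<pi> y) / m (\<pi> y))"
      have avg: "(\<integral>\<^sup>+y. ennreal (F y) * indicator S (\<pi> y) \<partial>\<mu>) = (\<integral>\<^sup>+y. g y * indicator S (\<pi> y) \<partial>\<mu>)" for S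
        unfolding g_def w_def m_def by (rule nn_integral_fibre_average[OF finite_\<mu> \<pi>m Fe])
      have gm [measurable]: "g \<in> borel_measurable \<mu>" unfolding g_def by (rule measurable_compose[OF \<pi>m]) simp
      have w_le: "w (\<pi> z) \<le> mass k j" if "{y \<in> disk. \<pi> y = \<pi> z} \<subseteq> cellset k j" for z k j
        unfolding w_def mass_def using that by (intro nn_integral_mono) (auto simp: indicator_def)
      \<comment> \<open>A maximal bad cell is compared with its parent, and a good cell without its
        next generation is compared with the full cell. Neither of the larger cells is bad, so the
        mass of \<open>F\<close> on it is at most \<open>t\<close> times its measure.\<close>
      have gb: "g z \<le> ennreal (C' * t)" if z: "z \<in> disk" for z
      proof (cases "hb z")
        case True
        define l where "l = bl z - 1"
        have l: "bl z = Suc l" using bl_pos[OF True] by (simp add: l_def)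
        have lz: "lev (Suc l) \<le> norm z" using bl(1)[OF True] by (simp add: isb_def l)
        have "\<not> isb z l" using bl(2)[OF True] l by simp
        then have nb: "\<not> bad l (cel l z)" using lz lev_mono[of l "Suc l"] by (auto simp: isb_def)
        have "{y \<in> disk. \<pi> y = \<pi> z} \<subseteq> cellset l (cel l z)"
          unfolding fib_bad[OF z True] l using cel_anc[of l "Suc l"] lev_mono[of l "Suc l"] by (auto simp: cellset_def)
        then have "w (\<pi> z) \<le> mass l (cel l z)" by (rule w_le)
        also have "\<dots> \<le> ennreal (t * v l)" using nb by (simp add: bad_def)
        also have "\<dots> \<le> ennreal ((C' * t) * v (Suc l))"
        proof (rule ennreal_leI)
          have "v l \<le> Cd * a (Suc l) / real B ^ l" unfolding v_def using a_Suc(2)[of l] by (intro divide_right_mono) auto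
          also have "\<dots> = (real B * Cd) * v (Suc l)" using B2 by (simp add: v_def)
          also have "\<dots> \<le> C' * v (Suc l)" using C' v_pos[of "Suc l"] by (intro mult_right_mono) auto
          finally have "t * v l \<le> t * (C' * v (Suc l))" using t by (intro mult_left_mono) auto
          then show "t * v l \<le> (C' * t) * v (Suc l)" by (simp only: mult_ac)
        qed
        finally have "w (\<pi> z) / ennreal (v (Suc l)) \<le> ennreal (C' * t)"
          using v_pos[of "Suc l"] C' t by (intro ennreal_divide_le) auto
        moreover have "m (\<pi> z) = ennreal (v (Suc l))"
          unfolding m_def space_\<mu> fib_bad[OF z True] l by (rule cellset_measure[OF cel_lt])
        ultimately show ?thesis by (simp add: g_def)
      next
        case False
        let ?d = "depth z" and ?j = "cel (depth z) z"
        have lz: "lev ?d \<le> norm z" using le_depth_iff[OF z, of ?d] by simp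
        have "\<not> isb z ?d" using False by (auto simp: hb_def)
        then have nb: "\<not> bad ?d ?j" using lz by (simp add: isb_def)
        let ?D = "{y \<in> disk. lev (Suc ?d) \<le> norm y \<and> cel ?d y = ?j}"
        have mD: "emeasure \<mu> ?D = ennreal (a (Suc ?d) / real B ^ ?d)"
          unfolding a_def using lev_mono[of ?d "Suc ?d"] cel_lt by (intro cell_measure) auto
        have sub: "?D \<subseteq> cellset ?d ?j" using lev_mono[of ?d "Suc ?d"] by (auto simp: cellset_def)
        have "m (\<pi> z) = emeasure \<mu> (cellset ?d ?j) - emeasure \<mu> ?D"
          unfolding m_def space_\<mu> fib_good[OF z False] using sub mD
          by (intro emeasure_Diff cellset_sets cell_sets) auto
        also have "\<dots> = ennreal (v ?d - a (Suc ?d) / real B ^ ?d)"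
          unfolding mD cellset_measure[OF cel_lt] using a_pos[of "Suc ?d"] by (intro ennreal_minus) auto
        finally have m: "m (\<pi> z) = ennreal (v ?d - a (Suc ?d) / real B ^ ?d)" .
        have half: "v ?d / 2 \<le> v ?d - a (Suc ?d) / real B ^ ?d"
        proof -
          have "a (Suc ?d) / real B ^ ?d \<le> (a ?d / 2) / real B ^ ?d" using a_Suc(1)[of ?d] by (intro divide_right_mono) auto
          then show ?thesis by (simp add: v_def)
        qed
        then have mp: "v ?d - a (Suc ?d) / real B ^ ?d > 0" using v_pos[of ?d] by linarith
        have "w (\<pi> z) \<le> mass ?d ?j" by (rule w_le) (use fib_good[OF z False] in auto)
        also have "\<dots> \<le> ennreal (t * v ?d)" using nb by (simp add: bad_def)
        also have "\<dots> \<le> ennreal ((C' * t) * (v ?d - a (Suc ?d) / real B ^ ?d))"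
        proof (rule ennreal_leI)
          have "t * v ?d = (2 * t) * (v ?d / 2)" by simp
          also have "\<dots> \<le> (C' * t) * (v ?d - a (Suc ?d) / real B ^ ?d)"
            using half C' t v_pos[of ?d] by (intro mult_mono) auto
          finally show "t * v ?d \<le> (C' * t) * (v ?d - a (Suc ?d) / real B ^ ?d)" .
        qed
        finally have "w (\<pi> z) / m (\<pi> z) \<le> ennreal (C' * t)" unfolding m using mp C' t by (intro ennreal_divide_le) auto
        then show ?thesis by (simp add: g_def)
      qed
      define G where "G = (\<lambda>y. enn2real (g y))"
      have Gg: "ennreal (G y) = g y" if "y \<in> disk" for y
      proof -
        have "g y < top" using gb[OF that] by (rule le_less_trans) simp
        then show ?thesis unfolding G_def by (rule ennreal_enn2real)
      qed
      have Gb: "G y \<le> C' * t" if "y \<in> disk" for y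
        using gb[OF that] C' t unfolding G_def by (intro enn2real_leI) auto
      have GI: "(\<integral>\<^sup>+y. ennreal (G y) \<partial>\<mu>) = I"
      proof -
        have "(\<integral>\<^sup>+y. ennreal (G y) \<partial>\<mu>) = (\<integral>\<^sup>+y. g y * indicator UNIV (\<pi> y) \<partial>\<mu>)" by (intro nn_integral_cong) (simp add: Gg)
        also have "\<dots> = I" unfolding avg[symmetric] by (simp add: I_def)
        finally show ?thesis .
      qed
      \<comment> \<open>The points in or next to some bad cell. For \<open>z\<close> outside,
        \<open>near k z\<close> does not distinguish the points of a fibre (\<open>sat\<close>), and
        therefore averaging is exact there.\<close>
      define Om where "Om = {z \<in> disk. \<exists>k j. lev k \<le> norm z \<and> cyc (B ^ k) (cel k z) j \<and> bad k j}"
      have cyc_anc: "cyc (B ^ l) (i div B ^ (k - l)) (j div B ^ (k - l))" if "cyc (B ^ k) i j" "l \<le> k" for i j k l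
      proof (rule cyc_div)
        show "cyc (B ^ (k - l) * B ^ l) i j" using that by (simp flip: power_add)
      qed (use B2 in auto)
      have sat: "near k z y'" if z: "z \<in> disk" "z \<notin> Om" and y: "y \<in> disk" "y' \<in> disk" and n: "near k z y" and e: "\<pi> y' = \<pi> y" for k z y y'
      proof -
        have n': "lev k \<le> norm z" "lev k \<le> norm y" "cyc (B ^ k) (cel k z) (cel k y)" using n by (auto simp: near_def)
        obtain l where l: "k \<le> l" "lev l \<le> norm y'" "cel l y' = cel l y"
        proof (cases "hb y")
          case True
          then have h: "hb y'" "bl y' = bl y" "cel (bl y) y' = cel (bl y) y" using \<pi>D[OF e] by (simp_all add: lv_def)
          \<comment> \<open>If the maximal bad cell containing \<open>y\<close> had generation at
            most \<open>k\<close>, the cell of \<open>z\<close> in that generation would be its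
            neighbour and \<open>z\<close> would belong to \<open>Om\<close>.\<close>
          have "k < bl y"
          proof (rule ccontr)
            assume "\<not> k < bl y"
            then have lk: "bl y \<le> k" by simp
            have "cyc (B ^ bl y) (cel (bl y) z) (cel (bl y) y)"
              using cyc_anc[OF n'(3) lk] cel_anc[OF lk] by simp
            moreover have "bad (bl y) (cel (bl y) y)" using bl(1)[OF True] by (simp add: isb_def)
            moreover have "lev (bl y) \<le> norm z" using lev_mono[OF lk] n' by simp
            ultimately show False using z by (auto simp: Om_def)
          qed
          then show thesis using that[of "bl y"] bl(1)[OF h(1)] h by (simp add: isb_def)
        next
          case False
          then have h: "depth y' = depth y" "cel (depth y) y' = cel (depth y) y" using \<pi>D[OF e] by (simp_all add: lv_def)
          have "k \<le> depth y" using le_depth_iff[OF y(1)] n' by simp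
          moreover have "lev (depth y) \<le> norm y'" using le_depth_iff[OF y(2)] h by simp
          ultimately show thesis using that[of "depth y"] h by simp
        qed
        have "cel k y' = cel k y" using cel_anc[OF l(1)] l(3) by simp
        moreover have "lev k \<le> norm y'" using lev_mono[OF l(1)] l(2) by simp
        ultimately show ?thesis using n' by (simp add: near_def)
      qed
      have AFG: "AF z = (\<integral>\<^sup>+y. ker z y * ennreal (G y) \<partial>\<mu>)" if z: "z \<in> disk" "z \<notin> Om" for z
      proof -
        define c where "c = (\<lambda>k y. (if near k z y then ennreal (1 / v k) else 0))"
        have cm [measurable]: "c k \<in> borel_measurable \<mu>" for k unfolding c_def
          by (rule borel_\<mu>) (use measurable_compose[OF measurable_Pair1'[of z borel borel] near_measurable[of k]] in simp)
        have ex: "(\<integral>\<^sup>+y. ker z y * H y \<partial>\<mu>) = (\<Sum>k. \<integral>\<^sup>+y. c k y * H y \<partial>\<mu>)" if [measurable]: "H \<in> borel_measurable \<mu>" for H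
        proof -
          have "(\<integral>\<^sup>+y. ker z y * H y \<partial>\<mu>) = (\<integral>\<^sup>+y. (\<Sum>k. c k y * H y) \<partial>\<mu>)" by (simp add: ker_def c_def)
          also have "\<dots> = (\<Sum>k. \<integral>\<^sup>+y. c k y * H y \<partial>\<mu>)" by (rule nn_integral_suminf) measurable
          finally show ?thesis .
        qed
        have "(\<integral>\<^sup>+y. c k y * ennreal (F y) \<partial>\<mu>) = (\<integral>\<^sup>+y. c k y * g y \<partial>\<mu>)" for k
        proof -
          define S where "S = \<pi> ` {y \<in> disk. near k z y}"
          have iS: "c k y = ennreal (1 / v k) * indicator S (\<pi> y)" if y: "y \<in> disk" for y
            using y sat[OF z _ y] by (auto simp: c_def S_def indicator_def)
          have ind [measurable]: "(\<lambda>y. indicator S (\<pi> y) :: ennreal) \<in> borel_measurable \<mu>" by (rule measurable_compose[OF \<pi>m]) simp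
          have "(\<integral>\<^sup>+y. c k y * H y \<partial>\<mu>) = ennreal (1 / v k) * (\<integral>\<^sup>+y. H y * indicator S (\<pi> y) \<partial>\<mu>)" if [measurable]: "H \<in> borel_measurable \<mu>" for H
          proof -
            have "(\<integral>\<^sup>+y. c k y * H y \<partial>\<mu>) = (\<integral>\<^sup>+y. ennreal (1 / v k) * (H y * indicator S (\<pi> y)) \<partial>\<mu>)"
              by (intro nn_integral_cong) (simp add: iS mult_ac)
            also have "\<dots> = ennreal (1 / v k) * (\<integral>\<^sup>+y. H y * indicator S (\<pi> y) \<partial>\<mu>)" by (rule nn_integral_cmult) measurable
            finally show ?thesis .
          qed
          then show ?thesis using avg[of S] by simp
        qed
        then have "AF z = (\<integral>\<^sup>+y. ker z y * g y \<partial>\<mu>)" unfolding AF_def ex[OF Fe] ex[OF gm] by simp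
        also have "\<dots> = (\<integral>\<^sup>+y. ker z y * ennreal (G y) \<partial>\<mu>)" by (intro nn_integral_cong) (simp add: Gg)
        finally show ?thesis .
      qed
      have Gm: "G \<in> borel_measurable \<mu>" unfolding G_def by measurable
      have Gme: "(\<lambda>y. ennreal (G y)) \<in> borel_measurable \<mu>" using Gm by measurable
      define H where "H = {z \<in> disk. ennreal t < (\<integral>\<^sup>+y. ker z y * ennreal (G y) \<partial>\<mu>)}"
      have Hs: "H \<in> sets \<mu>" unfolding H_def by (rule AFset[OF Gme])
      \<comment> \<open>Chebyshev's inequality with exponent 2, for \<open>t\<close> times the
        indicator of \<open>H\<close>. As \<open>G \<le> C' * t\<close>, the integral of the square
        of \<open>G\<close> is at most \<open>C' * t * I\<close>, and one factor \<open>t\<close>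
        cancels.\<close>
      have tH: "ennreal t * emeasure \<mu> H \<le> ennreal (C2 * C') * I"
      proof -
        define R where "R = (\<lambda>z. if z \<in> H then t else 0)"
        have "(\<integral>\<^sup>+z. ennreal (R z powr 2) \<partial>\<mu>) \<le> ennreal C2 * (\<integral>\<^sup>+y. ennreal (G y powr 2) \<partial>\<mu>)"
          by (rule C2(2)[OF Gm]) (use t in \<open>auto simp: R_def H_def G_def less_imp_le\<close>)
        also have "(\<integral>\<^sup>+z. ennreal (R z powr 2) \<partial>\<mu>) = (\<integral>\<^sup>+z. ennreal (t * t) * indicator H z \<partial>\<mu>)"
          using t by (intro nn_integral_cong) (auto simp: R_def indicator_def power2_eq_square)
        also have "\<dots> = ennreal (t * t) * emeasure \<mu> H" by (rule nn_integral_cmult_indicator[OF Hs])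
        also have "(\<integral>\<^sup>+y. ennreal (G y powr 2) \<partial>\<mu>) \<le> (\<integral>\<^sup>+y. ennreal (C' * t) * ennreal (G y) \<partial>\<mu>)"
        proof (rule nn_integral_mono)
          fix y assume "y \<in> space \<mu>"
          then have y: "y \<in> disk" by simp
          have G0: "G y \<ge> 0" by (simp add: G_def)
          have "G y powr 2 = G y * G y" using G0 by (simp add: power2_eq_square)
          also have "\<dots> \<le> (C' * t) * G y" using Gb[OF y] G0 by (intro mult_right_mono) auto
          finally have "ennreal (G y powr 2) \<le> ennreal ((C' * t) * G y)" by (rule ennreal_leI)
          also have "\<dots> = ennreal (C' * t) * ennreal (G y)" using C' t by (intro ennreal_mult') auto
          finally show "ennreal (G y powr 2) \<le> ennreal (C' * t) * ennreal (G y)" .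
        qed
        also have "(\<integral>\<^sup>+y. ennreal (C' * t) * ennreal (G y) \<partial>\<mu>) = ennreal (C' * t) * I"
          unfolding GI[symmetric] by (rule nn_integral_cmult[OF Gme])
        finally have *: "ennreal (t * t) * emeasure \<mu> H \<le> ennreal C2 * (ennreal (C' * t) * I)"
          by (simp add: mult_left_mono)
        have "ennreal t * emeasure \<mu> H = ennreal (1 / t) * (ennreal (t * t) * emeasure \<mu> H)"
          using t by (simp add: mult.assoc[symmetric] flip: ennreal_mult')
        also have "\<dots> \<le> ennreal (1 / t) * (ennreal C2 * (ennreal (C' * t) * I))" using * by (rule mult_left_mono) simp
        also have "\<dots> = ennreal (C2 * C') * I"
          using t C' C2(1) by (simp add: mult.assoc[symmetric] flip: ennreal_mult')
        finally show ?thesis .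
      qed
      \<comment> \<open>The bad cells without a bad ancestor. They are pairwise disjoint, so their
        masses sum to at most \<open>I\<close>, and their neighbourhoods \<open>U n\<close> already
        cover \<open>Om\<close>.\<close>
      define Fst where "Fst = {(l, j). bad l j \<and> (\<forall>i<l. \<not> bad i (j div B ^ (l - i)))}"
      define U where "U = (\<lambda>n. case prod_decode n of (l, j) \<Rightarrow> if (l, j) \<in> Fst then {z \<in> disk. lev l \<le> norm z \<and> cyc (B ^ l) j (cel l z)} else {})"
      define ms where "ms = (\<lambda>n y. case prod_decode n of (l, j) \<Rightarrow> if (l, j) \<in> Fst then ennreal (F y) * indicator (cellset l j) y else 0)"
      have Us: "U n \<in> sets \<mu>" for n unfolding U_def using nbd_sets by (auto split: prod.split)
      have msm [measurable]: "ms n \<in> borel_measurable \<mu>" for n unfolding ms_def by (cases "prod_decode n") auto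
      have cover: "Om \<subseteq> (\<Union>n. U n)"
      proof
        fix z assume "z \<in> Om"
        then obtain k j where z: "z \<in> disk" "lev k \<le> norm z" "cyc (B ^ k) (cel k z) j" "bad k j" by (auto simp: Om_def)
        define P where "P = (\<lambda>i. i \<le> k \<and> bad i (j div B ^ (k - i)))"
        \<comment> \<open>The generation of the topmost bad ancestor of the cell found; by
          \<open>cyc_anc\<close> the cell of \<open>z\<close> in that generation is still a
          neighbour.\<close>
        define l where "l = (LEAST i. P i)"
        have "P k" using z by (simp add: P_def)
        then have Pl: "P l" unfolding l_def by (rule LeastI)
        have nP: "\<not> P i" if "i < l" for i using that not_less_Least unfolding l_def by blast
        define j' where "j' = j div B ^ (k - l)"
        have "(l, j') \<in> Fst"
        proof -
          have "\<not> bad i (j' div B ^ (l - i))" if i: "i < l" for i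
          proof -
            have il: "(k - l) + (l - i) = k - i" using i Pl by (auto simp: P_def)
            have "j' div B ^ (l - i) = j div B ^ (k - i)" unfolding j'_def il[symmetric] power_add by (simp add: div_mult2_eq)
            then show ?thesis using nP[OF i] i Pl by (auto simp: P_def)
          qed
          then show ?thesis using Pl by (auto simp: Fst_def P_def j'_def)
        qed
        moreover have "cyc (B ^ l) (cel l z) j'"
          using cyc_anc[OF z(3), of l] cel_anc[of l k z] Pl by (simp add: P_def j'_def)
        moreover have "lev l \<le> norm z" using lev_mono[of l k] Pl z by (auto simp: P_def)
        ultimately have "z \<in> U (prod_encode (l, j'))" using z by (simp add: U_def cyc_sym)
        then show "z \<in> (\<Union>n. U n)" by blast
      qed
      have tU: "ennreal t * emeasure \<mu> (U n) \<le> 4 * (\<integral>\<^sup>+y. ms n y \<partial>\<mu>)" for n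
      proof -
        obtain l j where n: "prod_decode n = (l, j)" by (cases "prod_decode n")
        show ?thesis
        proof (cases "(l, j) \<in> Fst")
          case True
          have Un: "U n = {z \<in> disk. lev l \<le> norm z \<and> cyc (B ^ l) j (cel l z)}" using True by (simp only: U_def n prod.case if_True)
          have "ennreal t * emeasure \<mu> (U n) \<le> ennreal t * ennreal (4 * (ann (lev l) / real B ^ l))"
            unfolding Un by (rule mult_left_mono[OF nbd_measure]) auto
          also have "\<dots> = ennreal (4 * (t * v l))" using t v_pos[of l] by (simp add: v_def a_def mult_ac flip: ennreal_mult')
          also have "\<dots> = 4 * ennreal (t * v l)" using ennreal_mult'[of 4 "t * v l"] by simp
          also have "\<dots> \<le> 4 * mass l j" using True by (intro mult_left_mono) (auto simp: Fst_def bad_def)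
          also have "mass l j = (\<integral>\<^sup>+y. ms n y \<partial>\<mu>)" using True by (simp add: ms_def n mass_def)
          finally show ?thesis .
        qed (simp add: U_def n)
      qed
      have tOm: "ennreal t * emeasure \<mu> (\<Union>n. U n) \<le> 4 * I"
      proof -
        have "ennreal t * emeasure \<mu> (\<Union>n. U n) \<le> ennreal t * (\<Sum>n. emeasure \<mu> (U n))"
          using Us by (intro mult_left_mono emeasure_subadditive_countably) auto
        also have "\<dots> = (\<Sum>n. ennreal t * emeasure \<mu> (U n))" by simp
        also have "\<dots> \<le> (\<Sum>n. 4 * (\<integral>\<^sup>+y. ms n y \<partial>\<mu>))" using tU by (intro suminf_le) auto
        also have "\<dots> = 4 * (\<integral>\<^sup>+y. (\<Sum>n. ms n y) \<partial>\<mu>)" by (simp add: nn_integral_suminf)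
        also have "\<dots> \<le> 4 * I" unfolding I_def
        proof (intro mult_left_mono nn_integral_mono)
          fix y assume "y \<in> space \<mu>"
          \<comment> \<open>A point lies in at most one maximal bad cell, and \<open>n0\<close> is
            the only index under which it can be listed.\<close>
          define n0 where "n0 = prod_encode (bl y, cel (bl y) y)"
          have "(\<Sum>n. ms n y) \<le> (\<Sum>n. if n = n0 then ennreal (F y) else 0)"
          proof (rule suminf_le)
            fix n
            obtain l j where n: "prod_decode n = (l, j)" by (cases "prod_decode n")
            show "ms n y \<le> (if n = n0 then ennreal (F y) else 0)"
            proof (cases "(l, j) \<in> Fst \<and> y \<in> cellset l j")
              case True
              then have y: "lev l \<le> norm y" "cel l y = j" by (auto simp: cellset_def)
              have "bl y = l"
              proof (rule bl_eq)
                show "isb y l" using True y by (auto simp: isb_def Fst_def)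
                fix i assume "i < l"
                then show "\<not> isb y i" using True y cel_anc[of i l y] by (auto simp: isb_def Fst_def)
              qed
              then have "n = n0" using y n unfolding n0_def by (metis prod_decode_inverse)
              moreover have "ms n y \<le> ennreal (F y)" unfolding ms_def n prod.case by (simp add: indicator_def)
              ultimately show ?thesis by simp
            next
              case False
              then have "ms n y = 0" unfolding ms_def n prod.case by (simp add: indicator_def)
              then show ?thesis by simp
            qed
          qed auto
          also have "\<dots> = ennreal (F y)" by (subst suminf_finite[of "{n0}"]) auto
          finally show "(\<Sum>n. ms n y) \<le> ennreal (F y)" .
        qed simp
        finally show ?thesis .
      qed
      have UnS: "(\<Union>n. U n) \<in> sets \<mu>" using Us by auto
      have "{z \<in> disk. ennreal t < AF z} \<subseteq> (\<Union>n. U n) \<union> H"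
      proof
        fix z assume z: "z \<in> {z \<in> disk. ennreal t < AF z}"
        show "z \<in> (\<Union>n. U n) \<union> H"
        proof (cases "z \<in> Om")
          case True
          with cover show ?thesis by blast
        next
          case False
          with z AFG[of z] have "z \<in> H" unfolding H_def mem_Collect_eq by metis
          then show ?thesis by blast
        qed
      qed
      then have "ennreal t * emeasure \<mu> {z \<in> disk. ennreal t < AF z} \<le> ennreal t * emeasure \<mu> ((\<Union>n. U n) \<union> H)"
        using UnS Hs by (intro mult_left_mono emeasure_mono) auto
      also have "\<dots> \<le> ennreal t * (emeasure \<mu> (\<Union>n. U n) + emeasure \<mu> H)"
        using UnS Hs by (intro mult_left_mono emeasure_subadditive) auto
      also have "\<dots> \<le> 4 * I + ennreal (C2 * C') * I" unfolding distrib_left by (intro add_mono tOm tH)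
      also have "\<dots> = ennreal (4 + C2 * C') * I" using C2(1) C' by (subst ennreal_plus) (simp_all add: distrib_right)
      finally show ?thesis by (simp add: AF_def I_def)
    qed
  qed
qed

end

section \<open>From \<open>class_D\<close> to boundedness of the projection\<close>

context radial
begin

text \<open>Iterating each of the two tail conditions often enough turns them into bounds for the
  masses of consecutive generations, provided that the base is large.\<close>

lemma class_D_imp_tree:
  assumes D: "\<omega> \<in> class_D"
  obtains B Cd where "tree \<omega> B Cd"
proof -
  obtain C1 C2 where C: "C1 > 1" "C2 > 1" "\<And>r. 0 < r \<Longrightarrow> r < 1 \<Longrightarrow> hat r \<ge> C1 * hat (1 - (1 - r) / C2)"
    using D unfolding class_D_def by blast
  have "\<omega> \<in> class_D_hat" using D by (simp add: class_D_def)
  then obtain C0 where C0: "C0 \<ge> 1" "\<And>r. 0 \<le> r \<Longrightarrow> r < 1 \<Longrightarrow> hat r \<le> C0 * hat ((1 + r) / 2)"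
    unfolding class_D_hat_def by blast
  have upper: "hat r \<ge> C1 ^ m * hat (1 - (1 - r) / C2 ^ m)" if r: "0 < r" "r < 1" for r m
  proof (induction m)
    case (Suc m)
    let ?s = "1 - (1 - r) / C2 ^ m"
    have p1: "1 \<le> C2 ^ m" using C(2) by simp
    have "(1 - r) / C2 ^ m \<le> (1 - r) / 1" using p1 r by (intro divide_left_mono) auto
    then have s: "0 < ?s" "?s < 1" using r p1 by auto
    have "C1 ^ m * (C1 * hat (1 - (1 - ?s) / C2)) \<le> C1 ^ m * hat ?s" using C(3)[OF s] C(1) by (intro mult_left_mono) auto
    also have "\<dots> \<le> hat r" by (rule Suc)
    also have "(1 - ?s) / C2 = (1 - r) / C2 ^ Suc m" by simp
    finally show ?case by (simp add: mult_ac)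
  qed simp
  have lower: "hat r \<le> C0 ^ m * hat (1 - (1 - r) / 2 ^ m)" if r: "0 \<le> r" "r < 1" for r m
  proof (induction m)
    case (Suc m)
    let ?s = "1 - (1 - r) / 2 ^ m"
    have "1 - r \<le> 2 ^ m" using r one_le_power[of "2::real" m] by linarith
    then have s: "0 \<le> ?s" "?s < 1" using r by auto
    have "hat r \<le> C0 ^ m * hat ?s" by (rule Suc)
    also have "\<dots> \<le> C0 ^ m * (C0 * hat ((1 + ?s) / 2))" using C0(2)[OF s] C0(1) by (intro mult_left_mono) auto
    also have "(1 + ?s) / 2 = 1 - (1 - r) / 2 ^ Suc m" by (simp add: field_simps)
    finally show ?case by (simp add: mult_ac)
  qed simp
  \<comment> \<open>The area factor \<open>2 * r\<close> is lost near the origin. There one doubling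
    leads to the tail at radius 1/2, where the factor is 1.\<close>
  have ann_ge: "hat r \<le> C0 * ann r" if r: "0 \<le> r" "r < 1" for r
  proof (cases "r \<ge> 1 / 2")
    case True
    have h0: "hat r > 0" using r by (rule hat_pos)
    have "1 * hat r \<le> (2 * r) * hat r" using True h0 by (intro mult_right_mono) auto
    also have "\<dots> \<le> ann r" by (rule ann_bounds(1)[OF r(1)])
    also have "\<dots> \<le> C0 * ann r" using C0(1) by (simp add: ann_def mult_le_cancel_right1)
    finally show ?thesis by simp
  next
    case False
    have "hat r \<le> C0 * hat ((1 + r) / 2)" by (rule C0(2)[OF r])
    also have "\<dots> \<le> C0 * hat (1 / 2)" using C0(1) r by (intro mult_left_mono hat_mono) auto
    also have "\<dots> \<le> C0 * ann (1 / 2)" using ann_bounds(1)[of "1/2"] C0(1) by (intro mult_left_mono) auto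
    also have "\<dots> \<le> C0 * ann r" using False C0(1) unfolding ann_def
      by (intro mult_left_mono M.finite_measure_mono) (auto intro!: sets_\<mu>_borel[of "{z. r \<le> norm z}", simplified])
    finally show ?thesis .
  qed
  \<comment> \<open>\<open>4 * C0\<close> pays for \<open>ann_ge\<close>, for
    \<open>ann_bounds\<close> and for the final factor 2. The base is \<open>2 * C2 ^ m\<close>,
    rounded up, with the 2 because reverse doubling is assumed only at positive radii and is
    therefore started at \<open>(1 + r) / 2\<close>.\<close>
  obtain m where m: "4 * C0 < C1 ^ m" using real_arch_pow[OF C(1)] by blast
  define B where "B = nat \<lceil>2 * C2 ^ m\<rceil>"
  have C2m: "C2 ^ m \<ge> 1" using C(2) by simp
  have B: "real B \<ge> 2 * C2 ^ m" unfolding B_def by (rule real_nat_ceiling_ge)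
  have "real B \<ge> 2" using B C2m by linarith
  then have B2: "B \<ge> 2" by simp
  \<comment> \<open>Halving the distance to the boundary \<open>i\<close> times covers one
    generation of base \<open>B\<close>.\<close>
  obtain i :: nat where i: "real B < 2 ^ i" using real_arch_pow[of 2 "real B"] by auto
  define Cd where "Cd = 2 * C0 ^ i * C0"
  have next_lev: "1 - 1 / real B ^ Suc k = 1 - (1 - (1 - 1 / real B ^ k)) / real B" for k by simp
  have lev: "0 \<le> 1 - 1 / real B ^ k" "1 - 1 / real B ^ k < 1" for k using B2 by auto
  have "tree \<omega> B Cd"
  proof (intro tree.intro tree_axioms.intro)
    show "radial \<omega>" by (rule radial_axioms)
    show "B \<ge> 2" by (rule B2)
    fix k
    define r where "r = 1 - 1 / real B ^ k"
    define s where "s = 1 - (1 - r) / real B"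
    have r: "0 \<le> r" "r < 1" using lev[of k] by (auto simp: r_def)
    have s: "1 - 1 / real B ^ Suc k = s" unfolding next_lev[of k] s_def r_def ..
    have s01: "0 \<le> s" "s < 1" using lev[of "Suc k"] unfolding s by auto
    have "hat ((1 + r) / 2) \<ge> C1 ^ m * hat (1 - (1 - (1 + r) / 2) / C2 ^ m)" using r by (intro upper) auto
    moreover have "hat ((1 + r) / 2) \<le> hat r" using r by (intro hat_mono) auto
    moreover have "hat s \<le> hat (1 - (1 - (1 + r) / 2) / C2 ^ m)"
    proof (rule hat_mono)
      have e: "(1 - (1 + r) / 2) / C2 ^ m = (1 - r) / (2 * C2 ^ m)" by (simp add: field_simps)
      have "(1 - r) / (2 * C2 ^ m) \<le> (1 - r) / 1" using C2m r by (intro divide_left_mono) auto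
      then show "0 \<le> 1 - (1 - (1 + r) / 2) / C2 ^ m" unfolding e using r by simp
      have "(1 - r) / real B \<le> (1 - r) / (2 * C2 ^ m)" using B C2m r by (intro divide_left_mono) auto
      then show "1 - (1 - (1 + r) / 2) / C2 ^ m \<le> s" unfolding e s_def by simp
    qed
    then have "C1 ^ m * hat s \<le> C1 ^ m * hat (1 - (1 - (1 + r) / 2) / C2 ^ m)" using C(1) by (intro mult_left_mono) auto
    moreover have "4 * C0 * hat s \<le> C1 ^ m * hat s" using m hat_pos[OF s01] by (intro mult_right_mono) auto
    ultimately have "4 * C0 * hat s \<le> hat r" by linarith
    also have "\<dots> \<le> C0 * ann r" by (rule ann_ge[OF r])
    finally have "C0 * (4 * hat s) \<le> C0 * ann r" by simp
    then have "4 * hat s \<le> ann r" using C0(1) by simp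
    then show "ann (1 - 1 / real B ^ Suc k) \<le> ann (1 - 1 / real B ^ k) / 2"
      using ann_bounds(2)[OF s01(1)] unfolding s r_def[symmetric] by linarith
    have "hat r \<le> C0 ^ i * hat (1 - (1 - r) / 2 ^ i)" by (rule lower[OF r])
    also have "\<dots> \<le> C0 ^ i * hat s"
    proof (intro mult_left_mono hat_mono s01(1))
      have "(1 - r) / 2 ^ i \<le> (1 - r) / real B" using i B2 r by (intro divide_left_mono) auto
      then show "s \<le> 1 - (1 - r) / 2 ^ i" by (simp add: s_def)
    qed (use C0 in auto)
    also have "\<dots> \<le> C0 ^ i * (C0 * ann s)" using C0(1) by (intro mult_left_mono ann_ge s01) auto
    finally have "2 * hat r \<le> Cd * ann s" by (simp add: Cd_def mult_ac)
    then show "ann (1 - 1 / real B ^ k) \<le> Cd * ann (1 - 1 / real B ^ Suc k)"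
      using ann_bounds(2)[OF r(1)] unfolding s r_def[symmetric] by linarith
  qed
  then show thesis by (rule that)
qed

lemma proj_measurable:
  assumes f: "f \<in> borel_measurable \<mu>"
  shows "max_bergman_projection \<omega> f \<in> borel_measurable \<mu>"
proof -
  have k: "(\<lambda>x. kern (cnj (fst x) * snd x)) \<in> borel_measurable (borel \<Otimes>\<^sub>M borel)" by measurable
  have "(\<lambda>x. (fst x, snd x)) \<in> measurable (\<mu> \<Otimes>\<^sub>M \<mu>) (borel \<Otimes>\<^sub>M borel)"
    by (intro measurable_Pair measurable_compose[OF measurable_fst id_\<mu>] measurable_compose[OF measurable_snd id_\<mu>])
  from measurable_compose[OF this k]
  have k': "(\<lambda>x. kern (cnj (fst x) * snd x)) \<in> borel_measurable (\<mu> \<Otimes>\<^sub>M \<mu>)" by simp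
  have f': "(\<lambda>x. f (snd x)) \<in> borel_measurable (\<mu> \<Otimes>\<^sub>M \<mu>)" by (rule measurable_compose[OF measurable_snd f])
  have "(\<lambda>(z, \<zeta>). f \<zeta> * of_real (norm (kern (cnj z * \<zeta>)))) \<in> borel_measurable (\<mu> \<Otimes>\<^sub>M \<mu>)"
    unfolding split_beta' using k' f' by measurable
  from M.borel_measurable_lebesgue_integral[OF this]
  show ?thesis unfolding max_bergman_projection_def bergman_kernel_eq .
qed

lemma norm_proj_le:
  "ennreal (norm (max_bergman_projection \<omega> f z)) \<le> (\<integral>\<^sup>+\<zeta>. ennreal (norm (f \<zeta>) * norm (kern (cnj z * \<zeta>))) \<partial>\<mu>)"
proof (cases "integrable \<mu> (\<lambda>\<zeta>. f \<zeta> * of_real (norm (kern (cnj z * \<zeta>))))")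
  case True
  show ?thesis unfolding max_bergman_projection_def bergman_kernel_eq
    using integral_norm_bound_ennreal[OF True] by (simp add: norm_mult)
next
  \<comment> \<open>Without integrability the Bochner integral is 0 by convention, and the bound is
    trivial.\<close>
  case False
  then show ?thesis unfolding max_bergman_projection_def bergman_kernel_eq by (simp add: not_integrable_integral_eq)
qed

lemma class_D_bounded:
  assumes D: "\<omega> \<in> class_D"
  shows "p > 1 \<Longrightarrow> bounded_Lp_Lp \<omega> p" and "bounded_L1_weak_L1 \<omega>"
proof -
  obtain B Cd where "tree \<omega> B Cd" using class_D_imp_tree[OF D] .
  then interpret T: tree \<omega> B Cd .
  have Dh: "\<omega> \<in> class_D_hat" using D by (simp add: class_D_def)
  obtain C where C: "C > 0" "\<And>z y. z \<in> disk \<Longrightarrow> y \<in> disk \<Longrightarrow> ennreal (norm (kern (cnj z * y))) \<le> ennreal C * T.ker z y"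
    using T.kern_le_ker[OF Dh] by blast
  \<comment> \<open>Apart from measurability this is all that is used of the projection: up to the
    constant \<open>C\<close> it lies below the tree operator, so both estimates for the latter
    carry over.\<close>
  have dom: "ennreal (norm (max_bergman_projection \<omega> f z) / C) \<le> (\<integral>\<^sup>+y. T.ker z y * ennreal (norm (f y)) \<partial>\<mu>)"
    if f: "f \<in> borel_measurable \<mu>" and z: "z \<in> disk" for f z
  proof -
    have km: "(\<lambda>y. T.ker z y) \<in> borel_measurable \<mu>"
      using measurable_compose[OF measurable_Pair1'[of z \<mu> \<mu>] T.ker_measurable] z by simp
    have "ennreal (norm (max_bergman_projection \<omega> f z)) \<le> (\<integral>\<^sup>+\<zeta>. ennreal (norm (f \<zeta>) * norm (kern (cnj z * \<zeta>))) \<partial>\<mu>)" by (rule norm_proj_le)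
    also have "\<dots> \<le> (\<integral>\<^sup>+y. ennreal C * (T.ker z y * ennreal (norm (f y))) \<partial>\<mu>)"
    proof (rule nn_integral_mono)
      fix y assume "y \<in> space \<mu>"
      then have y: "y \<in> disk" by simp
      have "ennreal (norm (f y) * norm (kern (cnj z * y))) = ennreal (norm (f y)) * ennreal (norm (kern (cnj z * y)))" by (rule ennreal_mult) auto
      also have "\<dots> \<le> ennreal (norm (f y)) * (ennreal C * T.ker z y)" using C(2)[OF z y] by (rule mult_left_mono) simp
      finally show "ennreal (norm (f y) * norm (kern (cnj z * y))) \<le> ennreal C * (T.ker z y * ennreal (norm (f y)))" by (simp add: mult_ac)
    qed
    also have "\<dots> = ennreal C * (\<integral>\<^sup>+y. T.ker z y * ennreal (norm (f y)) \<partial>\<mu>)"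
      using km f by (intro nn_integral_cmult) auto
    finally have "ennreal (1 / C) * ennreal (norm (max_bergman_projection \<omega> f z)) \<le> ennreal (1 / C) * (ennreal C * (\<integral>\<^sup>+y. T.ker z y * ennreal (norm (f y)) \<partial>\<mu>))"
      by (rule mult_left_mono) simp
    also have "\<dots> = (\<integral>\<^sup>+y. T.ker z y * ennreal (norm (f y)) \<partial>\<mu>)"
      using C(1) by (simp add: mult.assoc[symmetric] flip: ennreal_mult')
    also have "ennreal (1 / C) * ennreal (norm (max_bergman_projection \<omega> f z)) = ennreal (norm (max_bergman_projection \<omega> f z) / C)"
      using C(1) by (simp flip: ennreal_mult')
    finally show ?thesis .
  qed
  show "bounded_Lp_Lp \<omega> p" if p: "p > 1"
  proof -
    obtain K where K: "K > 0" "\<And>F R :: complex \<Rightarrow> real. F \<in> borel_measurable \<mu> \<Longrightarrow> (\<And>y. F y \<ge> 0) \<Longrightarrow> (\<And>z. R z \<ge> 0) \<Longrightarrow>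
      (\<And>z. z \<in> disk \<Longrightarrow> ennreal (R z) \<le> (\<integral>\<^sup>+y. T.ker z y * ennreal (F y) \<partial>\<mu>)) \<Longrightarrow>
      (\<integral>\<^sup>+z. ennreal (R z powr p) \<partial>\<mu>) \<le> ennreal K * (\<integral>\<^sup>+y. ennreal (F y powr p) \<partial>\<mu>)"
      using T.tree_Lp[OF p] by blast
    show ?thesis unfolding bounded_Lp_Lp_def bounded_operator_def
    proof (intro exI[of _ "(C powr p * K) powr (1 / p)"] ballI)
      fix f assume f: "f \<in> Lp_space \<omega> p"
      then have fm: "f \<in> borel_measurable \<mu>" and fi: "integrable \<mu> (\<lambda>z. norm (f z) powr p)" by (auto simp: Lp_space_def)
      define P where "P = max_bergman_projection \<omega> f"
      have Pm: "P \<in> borel_measurable \<mu>" unfolding P_def by (rule proj_measurable[OF fm])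
      have Pm': "(\<lambda>z. norm (P z) powr p) \<in> borel_measurable \<mu>" using Pm by measurable
      define J where "J = (LINT z|\<mu>. norm (f z) powr p)"
      have J0: "J \<ge> 0" unfolding J_def by (rule integral_nonneg_AE) auto
      have fJ: "(\<integral>\<^sup>+y. ennreal (norm (f y) powr p) \<partial>\<mu>) = ennreal J" unfolding J_def by (rule nn_integral_eq_integral[OF fi]) auto
      have "(\<integral>\<^sup>+z. ennreal ((norm (P z) / C) powr p) \<partial>\<mu>) \<le> ennreal K * (\<integral>\<^sup>+y. ennreal (norm (f y) powr p) \<partial>\<mu>)"
      proof (rule K(2))
        show "(\<lambda>y. norm (f y)) \<in> borel_measurable \<mu>" using fm by measurable
        show "ennreal (norm (P z) / C) \<le> (\<integral>\<^sup>+y. T.ker z y * ennreal (norm (f y)) \<partial>\<mu>)" if "z \<in> disk" for z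
          unfolding P_def by (rule dom[OF fm that])
      qed (use C in auto)
      then have 1: "(\<integral>\<^sup>+z. ennreal ((norm (P z) / C) powr p) \<partial>\<mu>) \<le> ennreal (K * J)"
        unfolding fJ using K(1) by (simp add: ennreal_mult')
      have "(\<integral>\<^sup>+z. ennreal (norm (P z) powr p) \<partial>\<mu>) = (\<integral>\<^sup>+z. ennreal (C powr p) * ennreal ((norm (P z) / C) powr p) \<partial>\<mu>)"
        using C(1) by (intro nn_integral_cong) (simp add: powr_divide flip: ennreal_mult')
      also have "\<dots> = ennreal (C powr p) * (\<integral>\<^sup>+z. ennreal ((norm (P z) / C) powr p) \<partial>\<mu>)"
        using Pm by (intro nn_integral_cmult) measurable
      also have "\<dots> \<le> ennreal (C powr p) * ennreal (K * J)" using 1 by (rule mult_left_mono) simp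
      also have "\<dots> = ennreal (C powr p * (K * J))" by (rule ennreal_mult'[symmetric]) simp
      finally have 2: "(\<integral>\<^sup>+z. ennreal (norm (P z) powr p) \<partial>\<mu>) \<le> ennreal (C powr p * (K * J))" .
      have Pi: "integrable \<mu> (\<lambda>z. norm (P z) powr p)"
        by (rule integrableI_nonneg[OF Pm']) (use 2 in \<open>auto intro: le_less_trans\<close>)
      have "ennreal (LINT z|\<mu>. norm (P z) powr p) \<le> ennreal (C powr p * (K * J))"
        using 2 unfolding nn_integral_eq_integral[OF Pi AE_I2[OF powr_ge_zero]] .
      then have 3: "(LINT z|\<mu>. norm (P z) powr p) \<le> (C powr p * K) * J"
        using K(1) J0 C(1) by (subst (asm) ennreal_le_iff) auto
      have "Lp_norm \<omega> p P \<le> ((C powr p * K) * J) powr (1 / p)" unfolding Lp_norm_def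
        using 3 p by (intro powr_mono2 integral_nonneg_AE) auto
      also have "\<dots> = (C powr p * K) powr (1 / p) * Lp_norm \<omega> p f" unfolding Lp_norm_def J_def by (rule powr_mult)
      finally have "Lp_norm \<omega> p P \<le> (C powr p * K) powr (1 / p) * Lp_norm \<omega> p f" .
      moreover have "P \<in> Lp_space \<omega> p" using Pm Pi by (simp add: Lp_space_def)
      ultimately show "max_bergman_projection \<omega> f \<in> Lp_space \<omega> p \<and>
        Lp_norm \<omega> p (max_bergman_projection \<omega> f) \<le> (C powr p * K) powr (1 / p) * Lp_norm \<omega> p f" by (simp add: P_def)
    qed
  qed
  obtain K where K: "K > 0" "\<And>F t. F \<in> borel_measurable \<mu> \<Longrightarrow> (\<And>y. F y \<ge> (0::real)) \<Longrightarrow> t > 0 \<Longrightarrow>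
    ennreal t * emeasure \<mu> {z \<in> disk. ennreal t < (\<integral>\<^sup>+y. T.ker z y * ennreal (F y) \<partial>\<mu>)} \<le> ennreal K * (\<integral>\<^sup>+y. ennreal (F y) \<partial>\<mu>)"
    using T.tree_weak by blast
  show "bounded_L1_weak_L1 \<omega>" unfolding bounded_L1_weak_L1_def bounded_operator_def
  proof (intro exI[of _ "C * K"] ballI)
    fix f assume f: "f \<in> Lp_space \<omega> 1"
    then have fm: "f \<in> borel_measurable \<mu>" and fi: "integrable \<mu> (\<lambda>z. norm (f z))" by (auto simp: Lp_space_def)
    define P where "P = max_bergman_projection \<omega> f"
    have Pm: "P \<in> borel_measurable \<mu>" unfolding P_def by (rule proj_measurable[OF fm])
    define J where "J = (LINT z|\<mu>. norm (f z))"
    have J0: "J \<ge> 0" unfolding J_def by (rule integral_nonneg_AE) auto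
    have nf: "Lp_norm \<omega> 1 f = J" using J0 by (simp add: Lp_norm_def J_def)
    have fJ: "(\<integral>\<^sup>+y. ennreal (norm (f y)) \<partial>\<mu>) = ennreal J" unfolding J_def by (rule nn_integral_eq_integral[OF fi]) auto
    have fn: "(\<lambda>y. norm (f y)) \<in> borel_measurable \<mu>" using fm by measurable
    have Q: "weak_L1_quasinorm \<omega> P \<le> ennreal (C * K * J)" unfolding weak_L1_quasinorm_def
    proof (rule SUP_least)
      fix s :: real assume "s \<in> {0<..}"
      then have s: "s > 0" by simp
      define t where "t = s / C"
      have t: "t > 0" using s C by (simp add: t_def)
      note [measurable] = T.ker_measurable fn
      have "(\<lambda>z. \<integral>\<^sup>+y. T.ker z y * ennreal (norm (f y)) \<partial>\<mu>) \<in> borel_measurable \<mu>"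
        by (rule M.borel_measurable_nn_integral) (simp add: split_beta')
      from borel_measurable_less[OF _ this, of "\<lambda>_. ennreal t"]
      have S: "{z \<in> disk. ennreal t < (\<integral>\<^sup>+y. T.ker z y * ennreal (norm (f y)) \<partial>\<mu>)} \<in> sets \<mu>" by simp
      have sub: "{z \<in> disk. s < norm (P z)} \<subseteq> {z \<in> disk. ennreal t < (\<integral>\<^sup>+y. T.ker z y * ennreal (norm (f y)) \<partial>\<mu>)}"
      proof
        fix z assume "z \<in> {z \<in> disk. s < norm (P z)}"
        then have z: "z \<in> disk" and zs: "s < norm (P z)" by auto
        have "t < norm (P z) / C" unfolding t_def using zs C by (intro divide_strict_right_mono) auto
        then have "ennreal t < ennreal (norm (P z) / C)" using t by (intro ennreal_lessI) auto
        also have "\<dots> \<le> (\<integral>\<^sup>+y. T.ker z y * ennreal (norm (f y)) \<partial>\<mu>)" unfolding P_def by (rule dom[OF fm z])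
        finally show "z \<in> {z \<in> disk. ennreal t < (\<integral>\<^sup>+y. T.ker z y * ennreal (norm (f y)) \<partial>\<mu>)}" using z by blast
      qed
      have "ennreal s = ennreal C * ennreal t" using C t by (simp add: t_def flip: ennreal_mult')
      then have "ennreal s * emeasure \<mu> {z \<in> disk. s < norm (P z)} = ennreal C * (ennreal t * emeasure \<mu> {z \<in> disk. s < norm (P z)})"
        by (simp add: mult.assoc)
      also have "\<dots> \<le> ennreal C * (ennreal t * emeasure \<mu> {z \<in> disk. ennreal t < (\<integral>\<^sup>+y. T.ker z y * ennreal (norm (f y)) \<partial>\<mu>)})"
        by (intro mult_left_mono emeasure_mono sub S) auto
      also have "\<dots> \<le> ennreal C * (ennreal K * (\<integral>\<^sup>+y. ennreal (norm (f y)) \<partial>\<mu>))"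
        using t by (intro mult_left_mono K(2) fn) auto
      also have "\<dots> = ennreal (C * K * J)" unfolding fJ using C(1) K(1) by (simp add: mult.assoc flip: ennreal_mult')
      finally show "ennreal s * emeasure \<mu> {z \<in> disk. s < norm (P z)} \<le> ennreal (C * K * J)" .
    qed
    have "enn2real (weak_L1_quasinorm \<omega> P) \<le> C * K * J" using Q C(1) K(1) J0 by (intro enn2real_leI) auto
    moreover have "weak_L1_quasinorm \<omega> P < \<infinity>" using Q by (rule le_less_trans) simp
    ultimately show "max_bergman_projection \<omega> f \<in> weak_L1_space \<omega> \<and>
      enn2real (weak_L1_quasinorm \<omega> (max_bergman_projection \<omega> f)) \<le> C * K * Lp_norm \<omega> 1 f"
      using Pm unfolding nf P_def[symmetric] weak_L1_space_def by simp
  qed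
qed

end

theorem corollary1p3:
  fixes \<omega> :: "real \<Rightarrow> real"
  assumes "radial_weight \<omega>"
  shows "(bounded_L1_weak_L1 \<omega> \<longleftrightarrow> (\<forall>p>1. bounded_Lp_Lp \<omega> p)) \<and>
         ((\<forall>p>1. bounded_Lp_Lp \<omega> p) \<longleftrightarrow> (\<exists>p>1. p \<noteq> 2 \<and> bounded_Lp_Lp \<omega> p)) \<and>
         ((\<exists>p>1. p \<noteq> 2 \<and> bounded_Lp_Lp \<omega> p) \<longleftrightarrow> \<omega> \<in> class_D)"
proof -
  interpret radial \<omega> by (rule radial.intro[OF assms])
  have "\<exists>p>1. p \<noteq> 2 \<and> bounded_Lp_Lp \<omega> p" if "\<forall>p>1. bounded_Lp_Lp \<omega> p"
    using that by (intro exI[of _ 3]) auto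
  then show ?thesis
    using class_D_bounded Lp_bounded_imp_class_D weak_bounded_imp_class_D by metis
qed

end
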